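(* Let $m\neq \pm 1$ be a rational integer such that $f(x)=x^8-m$ is irreducible over $\mathbb Q$, and write $m=a_1a_2^2a_3^3a_4^4a_5^5a_6^6a_7^7$ where $a_1,\dots,a_7$ are square free, pairwise coprime rational integers. Let $\alpha$ be a root of $f(x)$ and $K=\mathbb Q(\alpha)$. Suppose that $\nu_2(m)$ is odd or $m\equiv 3\pmod 4$. If $K$ is monogenic, then $8a_1a_3a_5a_7$ divides $a_2^2a_6^2+1$ or $8a_1a_3a_5a_7$ divides $a_2^2a_6^2-1$.
   Context: $K$ is monogenic if its ring of integers $\mathbb Z_K$ equals $\mathbb Z[\theta]$ for some $\theta\in\mathbb Z_K$. $\nu_2$ denotes the $2$-adic valuation. *)

theory Defs
  imports
    Complex_Main
    "HOL-Algebra.Generated_Rings"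
    "HOL-Algebra.Generated_Fields"
    "HOL-Algebra.Algebraic_Closure_Type"
    "HOL-Computational_Algebra.Computational_Algebra"
    "HOL-Number_Theory.Cong"
begin

(* The type class operations are packaged as a HOL-Algebra ring record, so that the subfield and
   the (unital) subring generated by a set are the ones of HOL-Algebra.  In characteristic 0 the
   prime field is the field of rationals, so the subfield generated by x is Q(x). *)
definition rat_adjoin :: "'a::field_char_0 \<Rightarrow> 'a set" where
  "rat_adjoin x = generate_field ring_of_type_algebra {x}"

(* The subring generated by 1 and x, i.e. Z[x]. *)
definition int_adjoin :: "'a::field_char_0 \<Rightarrow> 'a set" where
  "int_adjoin x = generate_ring ring_of_type_algebra {x}"

definition ring_of_integers :: "'a::field_char_0 set \<Rightarrow> 'a set" where
  "ring_of_integers K = {x \<in> K. algebraic_int x}"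

definition monogenic :: "'a::field_char_0 set \<Rightarrow> bool" where
  "monogenic K \<longleftrightarrow> (\<exists>\<theta>\<in>ring_of_integers K. ring_of_integers K = int_adjoin \<theta>)"

end

theory Submission
  imports Defs "Jordan_Normal_Form.Char_Poly"
begin

text \<open>
  Put \<open>d = a\<^sub>1 a\<^sub>3 a\<^sub>5 a\<^sub>7\<close> and \<open>b = a\<^sub>2 a\<^sub>6\<close>, which is odd. Monogenicity forces \<open>b\<^sup>2 = 1\<close> or
  \<open>d = \<plusminus>1\<close>, and in both cases \<open>8 d\<close> divides \<open>b\<^sup>2 - 1\<close>.

  The hypothesis on \<open>m\<close> makes the elements \<open>w\<^sub>j = \<alpha>\<^sup>j / \<Prod>\<^sub>i a\<^sub>i\<^bsup>\<lfloor>i j / 8\<rfloor>\<^esup>\<close> an integral basis. If the integers are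
  \<open>\<int>[\<theta>]\<close>, then every difference of conjugates of \<open>\<theta>\<close> divides the corresponding differences of the
  conjugates of all \<open>w\<^sub>j\<close>. Let \<open>v\<close> and \<open>v'\<close> be the products of the differences of consecutive conjugates
  starting at an even, respectively odd, index. Then \<open>v + v' = 8 d E\<close> and \<open>v' - v = 4 b \<surd>(-d) Q\<close>, while
  \<open>v v'\<close> is \<open>4 d\<close> times a unit, so that \<open>b\<^sup>2 Q\<^sup>2 + 4 d E\<^sup>2\<close> is a unit; complex conjugation, applied to a
  suitable root \<open>\<alpha>\<close>, puts \<open>E\<close> and \<open>Q\<close> into \<open>\<int>[\<surd>2]\<close>. For \<open>d > 0\<close> its norm is at least \<open>b\<^sup>4\<close>.
  For \<open>d < -1\<close> the relative discriminant over \<open>\<rat>(\<surd>d)\<close>, whose only units are \<open>\<plusminus>1\<close>, shows that three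
  combinations of the coordinates of \<open>\<theta>\<close> form a geometric progression. This expresses \<open>v\<close> and \<open>v'\<close>
  by real squares, and congruences modulo 4 reduce the unit condition to quartic equations that are
  solved by Fermat's descent.
\<close>

section \<open>Algebraic integers\<close>

text \<open>No index or discriminant is ever computed; of monogenicity only a divisibility between
  differences of conjugates survives. The factor 4d arises because the eight differences of
  neighbouring conjugates of w_j multiply, for odd j, to 4 w_j^8 up to a unit, and every such w_j^8
  is d times an integer; the four cofactors, together with the one from j = 4, have no common prime.
  The sign of d shapes the proof. For d > 0 the quantity b^2 Q^2 + 4 d E^2 is positive definite in
  both real embeddings, so being a unit bounds b. For d < 0 it is indefinite and gives no such
  bound; the missing information comes from the other differences of conjugates, those between roots
  that differ by a fourth root of unity. The root \<alpha> must be chosen so that complex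
  conjugation respects neighbouring pairs of conjugates. A real \<alpha> makes it exchange v and v';
  an \<alpha> whose conjugate is exp(i pi/4) \<alpha> makes it fix both. The value d = -1 is set
  apart since \<int>[i] has the additional units i and -i.\<close>

lemma algebraic_int_of_int_eigenvector:
  fixes x :: "'a::field_char_0" and v :: "nat \<Rightarrow> 'a" and A :: "nat \<Rightarrow> nat \<Rightarrow> int"
  assumes eq: "\<And>i. i < n \<Longrightarrow> x * v i = (\<Sum>j<n. of_int (A i j) * v j)"
    and nz: "k < n" "v k \<noteq> 0"
  shows "algebraic_int x"
proof -
  define B where "B = Matrix.mat n n (\<lambda>(i, j). A i j)"
  have B: "B \<in> carrier_mat n n"
    by (simp add: B_def)
  define M where "M = map_mat (of_int :: int \<Rightarrow> 'a) B"
  have M: "M \<in> carrier_mat n n"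
    using B by (simp add: M_def)
  have "eigenvector M (vec n v) x"
    unfolding eigenvector_def
  proof (intro conjI)
    show "vec n v \<in> carrier_vec (dim_row M)"
      using M by simp
    show "vec n v \<noteq> 0\<^sub>v (dim_row M)"
    proof
      assume "vec n v = 0\<^sub>v (dim_row M)"
      then have "vec n v $ k = 0\<^sub>v (dim_row M) $ k"
        by simp
      with nz M show False
        by simp
    qed
    show "M *\<^sub>v vec n v = x \<cdot>\<^sub>v vec n v"
    proof (rule eq_vecI)
      fix i assume "i < dim_vec (x \<cdot>\<^sub>v vec n v)"
      then have i: "i < n"
        by simp
      then show "(M *\<^sub>v vec n v) $ i = (x \<cdot>\<^sub>v vec n v) $ i"
        by (simp add: M_def B_def scalar_prod_def eq lessThan_atLeast0)
    qed (use M in simp)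
  qed
  \<comment> \<open>The characteristic polynomial of an integer matrix is monic with integer
    coefficients, so its eigenvalues are algebraic integers.\<close>
  then have "poly (char_poly M) x = 0"
    using eigenvalue_root_char_poly[OF M] by (auto simp: eigenvalue_def)
  moreover have "char_poly M = map_poly of_int (char_poly B)"
    unfolding M_def using B by (simp add: of_int_hom.char_poly_hom)
  moreover have "lead_coeff (char_poly B) = 1"
    using degree_monic_char_poly[OF B] by simp
  ultimately show ?thesis
    by (auto simp: algebraic_int_altdef_ipoly)
qed

text \<open>The additive group generated by a finite \<open>G\<close>, with coefficients indexed by
  the elements themselves. For infinite \<open>G\<close> the sum is 0 by convention.\<close>

definition int_span :: "'a::comm_ring_1 set \<Rightarrow> 'a set" where
  "int_span G = {\<Sum>g\<in>G. of_int (c g) * g | c. True}"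

lemma int_span_add: "u \<in> int_span G \<Longrightarrow> w \<in> int_span G \<Longrightarrow> u + w \<in> int_span G"
  unfolding int_span_def
proof safe
  fix c d :: "'a \<Rightarrow> int"
  show "\<exists>e. (\<Sum>g\<in>G. of_int (c g) * g) + (\<Sum>g\<in>G. of_int (d g) * g) = (\<Sum>g\<in>G. of_int (e g) * g) \<and> True"
    by (rule exI[of _ "\<lambda>g. c g + d g"]) (simp add: sum.distrib algebra_simps)
qed

lemma int_span_scale: "u \<in> int_span G \<Longrightarrow> of_int k * u \<in> int_span G"
  unfolding int_span_def
proof safe
  fix c :: "'a \<Rightarrow> int"
  show "\<exists>e. of_int k * (\<Sum>g\<in>G. of_int (c g) * g) = (\<Sum>g\<in>G. of_int (e g) * g) \<and> True"
    by (rule exI[of _ "\<lambda>g. k * c g"]) (simp add: sum_distrib_left mult.assoc)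
qed

lemma int_span_zero: "0 \<in> int_span G"
  unfolding int_span_def by (auto intro: exI[of _ "\<lambda>_. 0"])

lemma int_span_sum: "(\<And>i. i \<in> I \<Longrightarrow> u i \<in> int_span G) \<Longrightarrow> sum u I \<in> int_span G"
  by (induction I rule: infinite_finite_induct) (auto intro: int_span_add int_span_zero)

lemma int_span_base:
  assumes "finite G" "h \<in> G"
  shows "h \<in> int_span G"
proof -
  have "(\<Sum>g\<in>G. of_int (if g = h then 1 else 0) * g) = (\<Sum>g\<in>G. if g = h then g else 0)"
    by (intro sum.cong) auto
  also have "\<dots> = h"
    using assms by simp
  finally show ?thesis
    unfolding int_span_def by (auto intro!: exI[of _ "\<lambda>g. if g = h then 1 else 0"])
qed

lemma int_span_mult:
  assumes "\<And>g. g \<in> G \<Longrightarrow> x * g \<in> int_span G" "u \<in> int_span G"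
  shows "x * u \<in> int_span G"
proof -
  obtain c where "u = (\<Sum>g\<in>G. of_int (c g) * g)"
    using assms(2) unfolding int_span_def by blast
  then have "x * u = (\<Sum>g\<in>G. of_int (c g) * (x * g))"
    by (simp add: sum_distrib_left mult_ac)
  then show ?thesis
    using assms(1) by (auto intro!: int_span_sum int_span_scale)
qed

text \<open>The determinant trick: multiplication by \<open>x\<close> acts on the generators through
  an integer matrix, so the list of generators is an eigenvector; \<open>h\<close> guarantees that
  it is not zero.\<close>

lemma algebraic_int_of_int_span:
  fixes x :: "'a::field_char_0"
  assumes fin: "finite G" and closed: "\<And>g. g \<in> G \<Longrightarrow> x * g \<in> int_span G"
    and nz: "h \<in> G" "h \<noteq> 0"
  shows "algebraic_int x"
proof -
  obtain n and v :: "nat \<Rightarrow> 'a" where v: "bij_betw v {..<n} G"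
    using ex_bij_betw_nat_finite[OF fin] by (metis lessThan_atLeast0)
  have "\<forall>i\<in>{..<n}. \<exists>c. x * v i = (\<Sum>g\<in>G. of_int (c g) * g)"
    using closed v by (fastforce simp: int_span_def bij_betw_def)
  then obtain c where c: "\<And>i. i < n \<Longrightarrow> x * v i = (\<Sum>g\<in>G. of_int (c i g) * g)"
    by (metis lessThan_iff)
  obtain k where "k < n" "v k = h"
    using nz v by (auto simp: bij_betw_def)
  show ?thesis
  proof (rule algebraic_int_of_int_eigenvector[where n = n and v = v and A = "\<lambda>i j. c i (v j)"])
    fix i assume "i < n"
    then show "x * v i = (\<Sum>j<n. of_int (c i (v j)) * v j)"
      using c sum.reindex_bij_betw[OF v, of "\<lambda>g. of_int (c i g) * g"] by simp
  qed (use \<open>k < n\<close> \<open>v k = h\<close> nz in auto)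
qed

lemma algebraic_int_power_reduce:
  fixes x :: "'a::field_char_0"
  assumes "algebraic_int x"
  obtains m c where "m > 0" "x ^ m = (\<Sum>i<m. of_int (c i) * x ^ i)"
proof -
  obtain p where p: "poly (map_poly of_int p) x = 0" "lead_coeff p = 1"
    using assms by (auto simp: algebraic_int_altdef_ipoly)
  define m where "m = degree p"
  have deg: "degree (map_poly of_int p :: 'a poly) = m"
    by (simp add: m_def degree_map_poly)
  have "(0::'a) = (\<Sum>i\<le>m. of_int (coeff p i) * x ^ i)"
    using p(1) by (simp add: poly_altdef deg[unfolded m_def] m_def coeff_map_poly)
  also have "\<dots> = (\<Sum>i<m. of_int (coeff p i) * x ^ i) + x ^ m"
    using p(2) by (simp add: m_def flip: lessThan_Suc_atMost)
  finally have "x ^ m = - (\<Sum>i<m. of_int (coeff p i) * x ^ i)"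
    by (simp add: eq_neg_iff_add_eq_0 add.commute)
  then have *: "x ^ m = (\<Sum>i<m. of_int (- coeff p i) * x ^ i)"
    by (simp add: sum_negf)
  have "m > 0"
  proof (rule ccontr)
    assume "\<not> m > 0"
    with * show False
      by simp
  qed
  then show ?thesis
    using * by (rule that)
qed

lemma algebraic_int_common_span:
  fixes x y :: "'a::field_char_0"
  assumes "algebraic_int x" "algebraic_int y"
  obtains G where "finite G" "1 \<in> G" "\<And>g. g \<in> G \<Longrightarrow> x * g \<in> int_span G" "\<And>g. g \<in> G \<Longrightarrow> y * g \<in> int_span G"
proof -
  obtain m c where m: "m > 0" "x ^ m = (\<Sum>i<m. of_int (c i) * x ^ i)"
    using algebraic_int_power_reduce[OF assms(1)] .
  obtain n d where n: "n > 0" "y ^ n = (\<Sum>i<n. of_int (d i) * y ^ i)"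
    using algebraic_int_power_reduce[OF assms(2)] .
  \<comment> \<open>The monic relations lower any exponent that reaches \<open>m\<close> or
    \<open>n\<close>, so these monomials span a module stable under both \<open>x\<close> and
    \<open>y\<close>, and one module serves sums and products.\<close>
  define G where "G = (\<lambda>(i, j). x ^ i * y ^ j) ` ({..<m} \<times> {..<n})"
  have fin: "finite G"
    by (simp add: G_def)
  have G: "x ^ i * y ^ j \<in> int_span G" if "i < m" "j < n" for i j
    using that by (intro int_span_base[OF fin]) (auto simp: G_def)
  have 1: "1 \<in> G"
    using m(1) n(1) by (auto simp: G_def intro!: image_eqI[of _ _ "(0, 0)"])
  have x: "x * g \<in> int_span G" if g: "g \<in> G" for g
  proof -
    obtain i j where ij: "i < m" "j < n" "g = x ^ i * y ^ j"
      using g by (auto simp: G_def)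
    show ?thesis
    proof (cases "Suc i < m")
      case True
      then show ?thesis
        using G[OF True ij(2)] ij by (simp add: mult_ac)
    next
      case False
      then have "m = Suc i"
        using ij by simp
      then have "x * g = x ^ m * y ^ j"
        using ij by (simp add: mult_ac)
      also have "\<dots> = (\<Sum>i<m. of_int (c i) * (x ^ i * y ^ j))"
        unfolding m(2) sum_distrib_right by (intro sum.cong) (auto simp: mult_ac)
      also have "\<dots> \<in> int_span G"
        using ij by (auto intro!: int_span_sum int_span_scale G)
      finally show ?thesis .
    qed
  qed
  have y: "y * g \<in> int_span G" if g: "g \<in> G" for g
  proof -
    obtain i j where ij: "i < m" "j < n" "g = x ^ i * y ^ j"
      using g by (auto simp: G_def)
    show ?thesis
    proof (cases "Suc j < n")
      case True
      then show ?thesis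
        using G[OF ij(1) True] ij by (simp add: mult_ac)
    next
      case False
      then have "n = Suc j"
        using ij by simp
      then have "y * g = x ^ i * y ^ n"
        using ij by (simp add: mult_ac)
      also have "\<dots> = (\<Sum>j<n. of_int (d j) * (x ^ i * y ^ j))"
        unfolding n(2) sum_distrib_left by (intro sum.cong) (auto simp: mult_ac)
      also have "\<dots> \<in> int_span G"
        using ij by (auto intro!: int_span_sum int_span_scale G)
      finally show ?thesis .
    qed
  qed
  show ?thesis
    using that fin 1 x y by blast
qed

lemma algebraic_int_add [intro]:
  fixes x y :: "'a::field_char_0"
  assumes "algebraic_int x" "algebraic_int y"
  shows "algebraic_int (x + y)"
proof -
  obtain G where "finite G" "1 \<in> G" "\<And>g. g \<in> G \<Longrightarrow> x * g \<in> int_span G" "\<And>g. g \<in> G \<Longrightarrow> y * g \<in> int_span G"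
    using algebraic_int_common_span[OF assms] by blast
  then show ?thesis
    by (intro algebraic_int_of_int_span[of G _ 1]) (auto simp: distrib_right intro: int_span_add)
qed

lemma algebraic_int_mult [intro]:
  fixes x y :: "'a::field_char_0"
  assumes "algebraic_int x" "algebraic_int y"
  shows "algebraic_int (x * y)"
proof -
  obtain G where "finite G" "1 \<in> G" "\<And>g. g \<in> G \<Longrightarrow> x * g \<in> int_span G" "\<And>g. g \<in> G \<Longrightarrow> y * g \<in> int_span G"
    using algebraic_int_common_span[OF assms] by blast
  then show ?thesis
    by (intro algebraic_int_of_int_span[of G _ 1]) (auto simp: mult.assoc intro: int_span_mult)
qed

lemma algebraic_int_diff [intro]:
  fixes x y :: "'a::field_char_0"
  shows "algebraic_int x \<Longrightarrow> algebraic_int y \<Longrightarrow> algebraic_int (x - y)"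
  using algebraic_int_add[of x "- y"] by simp

lemma algebraic_int_power [intro]:
  fixes x :: "'a::field_char_0"
  shows "algebraic_int x \<Longrightarrow> algebraic_int (x ^ n)"
  by (induction n) auto

lemma algebraic_int_sum [intro]:
  fixes f :: "'b \<Rightarrow> 'a::field_char_0"
  shows "(\<And>i. i \<in> I \<Longrightarrow> algebraic_int (f i)) \<Longrightarrow> algebraic_int (sum f I)"
  by (induction I rule: infinite_finite_induct) auto

lemma algebraic_int_poly:
  fixes x :: "'a::field_char_0"
  assumes "algebraic_int x"
  shows "algebraic_int (poly (map_poly of_int p) x)"
  unfolding poly_altdef using assms by (intro algebraic_int_sum algebraic_int_mult) (auto simp: coeff_map_poly)

lemma algebraic_int_of_power:
  fixes x :: "'a::field_char_0"
  assumes "algebraic_int (x ^ n)" "n > 0"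
  shows "algebraic_int x"
proof (rule algebraic_int_root[OF assms(1), of "monom 1 n"])
  show "poly (monom 1 n) x = x ^ n"
    by (simp add: poly_monom)
qed (use assms(2) in \<open>auto simp: degree_monom_eq\<close>)

text \<open>X - Y divides P(X) - P(Y) over the integers. This is how monogenicity enters:
  differences of conjugates of \<theta> divide those of every element of \<int>[\<theta>].\<close>

lemma algebraic_int_poly_diff_quotient:
  fixes x y :: "'a::field_char_0"
  assumes "algebraic_int x" "algebraic_int y"
  obtains g where "algebraic_int g" "poly (map_poly of_int p) x - poly (map_poly of_int p) y = g * (x - y)"
proof -
  have "\<exists>g. algebraic_int g \<and> poly (map_poly of_int p) x - poly (map_poly of_int p) y = g * (x - y)"
  proof (induction p)
    case 0
    then show ?case by (auto intro: exI[of _ 0])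
  next
    case (pCons c p)
    then obtain g where g: "algebraic_int g"
      "poly (map_poly of_int p) x - poly (map_poly of_int p) y = g * (x - y)"
      by blast
    have "poly (map_poly of_int (pCons c p)) x - poly (map_poly of_int (pCons c p)) y
        = poly (map_poly of_int p) x * (x - y) + y * (poly (map_poly of_int p) x - poly (map_poly of_int p) y)"
      by (simp add: of_int_hom.map_poly_pCons_hom algebra_simps)
    also have "\<dots> = (poly (map_poly of_int p) x + y * g) * (x - y)"
      unfolding g(2) by (simp add: distrib_right)
    finally have "poly (map_poly of_int (pCons c p)) x - poly (map_poly of_int (pCons c p)) y
        = (poly (map_poly of_int p) x + y * g) * (x - y)" .
    moreover have "algebraic_int (poly (map_poly of_int p) x + y * g)"
      using assms g(1) by (auto intro: algebraic_int_poly)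
    ultimately show ?case
      by blast
  qed
  then show ?thesis
    using that by blast
qed

section \<open>Quartic Diophantine equations\<close>

lemma coprime_mult_eq_power:
  fixes x y z :: int
  assumes "x * y = z ^ n" "coprime x y" "x > 0" "y > 0" "n > 0"
  shows "\<exists>s t. s > 0 \<and> t > 0 \<and> x = s ^ n \<and> y = t ^ n \<and> coprime s t"
proof -
  have "nat x * nat y = nat \<bar>z\<bar> ^ n"
  proof -
    have "x * y = \<bar>z\<bar> ^ n"
      using assms by (metis abs_of_pos mult_pos_pos power_abs)
    then show ?thesis
      using assms by (metis abs_ge_zero nat_mult_distrib nat_power_eq order_less_imp_le)
  qed
  moreover have "coprime (nat x) (nat y)"
    using assms by (simp add: coprime_int_iff[symmetric])
  ultimately have "is_nth_power n (nat x)" "is_nth_power n (nat y)"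
    using is_nth_power_mult_coprime_nat_iff[of "nat x" "nat y" n] by auto
  then obtain s t where st: "nat x = s ^ n" "nat y = t ^ n"
    by (auto simp: is_nth_power_def)
  have xy: "x = int s ^ n" "y = int t ^ n"
    using st assms by (metis int_nat_eq of_nat_power order_less_imp_le)+
  have "s > 0" "t > 0"
    using st assms by (metis gr0I nat_0_iff not_le zero_power zero_less_nat_eq less_irrefl)+
  moreover have "coprime (int s) (int t)"
    using assms xy by auto
  ultimately show ?thesis
    using xy by (intro exI[of _ "int s"] exI[of _ "int t"]) simp
qed

lemma square_mod_4_int: "(x::int)\<^sup>2 mod 4 = (if even x then 0 else 1)"
proof -
  have "x mod 4 = 0 \<or> x mod 4 = 1 \<or> x mod 4 = 2 \<or> x mod 4 = 3"
    by presburger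
  moreover have "x\<^sup>2 mod 4 = (x mod 4)\<^sup>2 mod 4"
    by (simp add: power_mod)
  moreover have "even x \<longleftrightarrow> x mod 4 = 0 \<or> x mod 4 = 2"
    by presburger
  ultimately show ?thesis
    by auto
qed

text \<open>Fermat's descent on \<open>a\<close>. The factors a^2 - b^2 and a^2 + b^2 of c^2 share
  at most the prime 2; extracting squares from them leads to a solution with a smaller first entry,
  at once for odd \<open>b\<close> and after a second factorization for even
  \<open>b\<close>.\<close>

lemma fermat_right_triangle:
  fixes a b c :: int
  assumes "a ^ 4 = b ^ 4 + c\<^sup>2" "coprime a b" "a > 0" "b > 0" "c > 0"
  shows False
  using assms
proof (induction "nat a" arbitrary: a b c rule: less_induct)
  case less
  have IH: False if "t ^ 4 = s ^ 4 + w\<^sup>2" "coprime t s" "t > 0" "s > 0" "w > 0" "t < a" for t s w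
    using less.hyps[of t s w] that by simp
  have prod: "(a\<^sup>2 - b\<^sup>2) * (a\<^sup>2 + b\<^sup>2) = c\<^sup>2"
    using less.prems(1) by Groebner_Basis.algebra
  have pos: "a\<^sup>2 + b\<^sup>2 > 0" "a\<^sup>2 - b\<^sup>2 > 0"
  proof -
    show *: "a\<^sup>2 + b\<^sup>2 > 0"
      using less.prems by (simp add: add_pos_pos)
    have "(a\<^sup>2 - b\<^sup>2) * (a\<^sup>2 + b\<^sup>2) > 0"
      using less.prems by (simp add: prod)
    then show "a\<^sup>2 - b\<^sup>2 > 0"
      using * by (simp add: zero_less_mult_iff)
  qed
  have "odd a"
  proof
    assume "even a"
    then have "odd b"
      using less.prems(2) by (metis coprime_common_divisor odd_one)
    have "(b\<^sup>2)\<^sup>2 mod 4 = 1"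
      using \<open>odd b\<close> square_mod_4_int[of "b\<^sup>2"] by simp
    moreover have "(a\<^sup>2)\<^sup>2 mod 4 = 0"
      using \<open>even a\<close> square_mod_4_int[of "a\<^sup>2"] by simp
    moreover have "c\<^sup>2 = (a\<^sup>2)\<^sup>2 - (b\<^sup>2)\<^sup>2"
      using less.prems(1) by Groebner_Basis.algebra
    ultimately have "c\<^sup>2 mod 4 = 3"
      by presburger
    then show False
      by (simp add: square_mod_4_int split: if_splits)
  qed
  have cop2: "coprime (a\<^sup>2) (b\<^sup>2)"
    using less.prems(2) by simp
  show False
  proof (cases "even b")
    case False
    define x y where "x = (a\<^sup>2 - b\<^sup>2) div 2" and "y = (a\<^sup>2 + b\<^sup>2) div 2"
    have x: "a\<^sup>2 - b\<^sup>2 = 2 * x" and y: "a\<^sup>2 + b\<^sup>2 = 2 * y"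
      using \<open>odd a\<close> False by (simp_all add: x_def y_def)
    have "even c"
      using prod x by (metis dvd_triv_left even_mult_iff even_power pos2)
    then obtain d where d: "c = 2 * d" ..
    have xy: "x * y = d\<^sup>2"
      using prod unfolding x y d by (simp add: power2_eq_square)
    have "a\<^sup>2 = x + y" "b\<^sup>2 = y - x"
      using x y by auto
    then have "coprime (x + y) (y - x)"
      using cop2 by simp
    then have "coprime x y"
      by (meson coprimeI coprime_common_divisor dvd_add dvd_diff)
    moreover have "x > 0" "y > 0"
      using pos x y by auto
    ultimately obtain s t where st: "s > 0" "t > 0" "x = s\<^sup>2" "y = t\<^sup>2" "coprime s t"
      using coprime_mult_eq_power[OF xy] by auto
    have a2: "a\<^sup>2 = s\<^sup>2 + t\<^sup>2" and b2: "b\<^sup>2 = t\<^sup>2 - s\<^sup>2"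
      using \<open>a\<^sup>2 = x + y\<close> \<open>b\<^sup>2 = y - x\<close> st by auto
    have "t ^ 4 = s ^ 4 + (a * b)\<^sup>2"
      using a2 b2 by Groebner_Basis.algebra
    moreover have "t < a"
    proof (rule power2_less_imp_less)
      show "t\<^sup>2 < a\<^sup>2"
        using a2 st by simp
    qed (use less.prems in simp)
    ultimately show False
      using IH[of t s "a * b"] st less.prems by (simp add: coprime_commute)
  next
    case True
    have "odd (a\<^sup>2 - b\<^sup>2)"
      using \<open>odd a\<close> True by simp
    have cop: "coprime (a\<^sup>2 - b\<^sup>2) (a\<^sup>2 + b\<^sup>2)"
    proof (rule coprimeI)
      fix k assume k: "k dvd a\<^sup>2 - b\<^sup>2" "k dvd a\<^sup>2 + b\<^sup>2"
      have "odd k"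
        using k(1) \<open>odd (a\<^sup>2 - b\<^sup>2)\<close> dvd_trans by blast
      have "k dvd 2 * a\<^sup>2"
        using dvd_add[OF k] by simp
      then have "k dvd a\<^sup>2"
        using \<open>odd k\<close> by (metis coprime_commute coprime_dvd_mult_right_iff coprime_right_2_iff_odd)
      have "k dvd 2 * b\<^sup>2"
        using dvd_diff[OF k(2) k(1)] by simp
      then have "k dvd b\<^sup>2"
        using \<open>odd k\<close> by (metis coprime_commute coprime_dvd_mult_right_iff coprime_right_2_iff_odd)
      show "is_unit k"
        using cop2 \<open>k dvd a\<^sup>2\<close> \<open>k dvd b\<^sup>2\<close> coprime_common_divisor by blast
    qed
    obtain s t where st: "s > 0" "t > 0" "a\<^sup>2 - b\<^sup>2 = s\<^sup>2" "a\<^sup>2 + b\<^sup>2 = t\<^sup>2"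
      using coprime_mult_eq_power[OF prod cop pos(2) pos(1)] by auto
    have "odd (s\<^sup>2)" "odd (t\<^sup>2)"
      unfolding st(3)[symmetric] st(4)[symmetric] using \<open>odd a\<close> True by simp_all
    then have odd_st: "odd s" "odd t"
      by simp_all
    \<comment> \<open>In these coordinates a^2 = p^2 + q^2 and b^2 = 2pq: a right triangle with legs
      p, q whose area is the square (b/2)^2.\<close>
    define p q where "p = (t + s) div 2" and "q = (t - s) div 2"
    have tp: "t = p + q" and sp: "s = p - q"
      using odd_st by (auto simp: p_def q_def elim!: oddE)
    have a2: "a\<^sup>2 = p\<^sup>2 + q\<^sup>2" and b2: "b\<^sup>2 = 2 * p * q"
      using st(3,4) unfolding tp sp by (auto simp: power2_eq_square algebra_simps)
    have "p > 0"
      using st tp sp by simp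
    have "2 * p * q > 0"
      using b2 less.prems by (metis zero_less_power)
    then have "q > 0"
      using \<open>p > 0\<close> by (simp add: zero_less_mult_iff)
    have "coprime p q"
    proof (rule coprimeI)
      fix k assume "k dvd p" "k dvd q"
      then have "k dvd a\<^sup>2" "k dvd b\<^sup>2"
        unfolding a2 b2 by (simp_all add: power2_eq_square)
      then show "is_unit k"
        using cop2 coprime_common_divisor by blast
    qed
    \<comment> \<open>Stated with the even leg named \<open>u\<close>, because it is not known which
      of \<open>p\<close> and \<open>q\<close> is even.\<close>
    have main: False
      if pq: "a\<^sup>2 = u\<^sup>2 + v\<^sup>2" "b\<^sup>2 = 2 * u * v" "u > 0" "v > 0" "coprime u v" "even u" for u v
    proof -
      have "odd v"
        using pq(5,6) by (metis coprime_common_divisor odd_one)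
      obtain r where r: "u = 2 * r"
        using pq(6) ..
      obtain b' where b': "b = 2 * b'"
        using True ..
      have "r * v = b'\<^sup>2"
        using pq(2) unfolding r b' by (simp add: power2_eq_square)
      moreover have "coprime r v"
        using pq(5) r by simp
      ultimately obtain g h where gh: "g > 0" "h > 0" "r = g\<^sup>2" "v = h\<^sup>2" "coprime g h"
        using coprime_mult_eq_power[of r v b' 2] pq r by auto
      have "odd h"
        using \<open>odd v\<close> gh by simp
      have a2': "a\<^sup>2 = 4 * g ^ 4 + h ^ 4"
        using pq(1) unfolding r gh by Groebner_Basis.algebra
      \<comment> \<open>From (a - h^2)(a + h^2) = 4 g^4 the halves \<open>x\<close> and
        \<open>y\<close> are coprime with product g^4, hence fourth powers, and their difference is
        h^2.\<close>
      define x y where "x = (a - h\<^sup>2) div 2" and "y = (a + h\<^sup>2) div 2"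
      have x: "a - h\<^sup>2 = 2 * x" and y: "a + h\<^sup>2 = 2 * y"
        using \<open>odd a\<close> \<open>odd h\<close> by (simp_all add: x_def y_def)
      have a_xy: "a = x + y" and h_xy: "h\<^sup>2 = y - x"
        using x y by auto
      have "4 * (x * y) = (a - h\<^sup>2) * (a + h\<^sup>2)"
        unfolding x y by simp
      also have "\<dots> = 4 * g ^ 4"
        using a2' by Groebner_Basis.algebra
      finally have xy: "x * y = g ^ 4"
        by simp
      have "y > 0"
        using y less.prems gh by (smt (verit) zero_le_power2)
      have "x * y > 0"
        using xy gh by simp
      then have "x > 0"
        using \<open>y > 0\<close> by (simp add: zero_less_mult_iff)
      have "coprime x y"
      proof (rule coprimeI)
        fix k assume k: "k dvd x" "k dvd y"
        then have "k dvd a"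
          by (simp add: a_xy)
        moreover have "k dvd b\<^sup>2"
          using k(1) xy by (simp add: pq(2) r gh(3))
            (metis (no_types, opaque_lifting) dvd_mult2 dvd_diff h_xy k(1,2) dvd_mult gh(4))
        ultimately show "is_unit k"
          using less.prems(2) by (metis coprime_common_divisor coprime_power_right_iff)
      qed
      then obtain m n where mn: "m > 0" "n > 0" "x = m ^ 4" "y = n ^ 4" "coprime m n"
        using coprime_mult_eq_power[OF xy] \<open>x > 0\<close> \<open>y > 0\<close> by auto
      have "n ^ 4 = m ^ 4 + h\<^sup>2"
        using h_xy mn by simp
      moreover have "n < a"
      proof -
        have "n \<le> n ^ 4"
          using mn(2) by (simp add: self_le_power)
        also have "\<dots> < a"
          using a_xy mn by simp
        finally show ?thesis .
      qed
      ultimately show False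
        using IH[of n m h] mn gh by (simp add: coprime_commute)
    qed
    have "even p \<or> even q"
      using a2 \<open>odd a\<close> by (metis even_add even_power)
    then show False
      using main[of p q] main[of q p] a2 b2 \<open>p > 0\<close> \<open>q > 0\<close> \<open>coprime p q\<close>
      by (auto simp: coprime_commute mult_ac add.commute)
  qed
qed

text \<open>Squaring gives (v^2)^4 = u^4 + ((u^4 - 1)/2)^2, which the descent excludes unless the
  last square vanishes.\<close>

lemma fourth_power_plus_one_eq_double:
  fixes u v :: int
  assumes "u ^ 4 + 1 = 2 * v ^ 4"
  shows "u\<^sup>2 = 1 \<and> v\<^sup>2 = 1"
proof -
  define s w where "s = \<bar>u\<bar>" and "w = \<bar>v\<bar>"
  have eq: "s ^ 4 + 1 = 2 * w ^ 4"
    using assms by (simp add: s_def w_def)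
  have "even (s ^ 4 + 1)"
    unfolding eq by simp
  then have "odd s"
    by simp
  have "s > 0"
    using \<open>odd s\<close> s_def by (metis abs_ge_zero even_zero order_le_less)
  have "w > 0"
  proof (rule ccontr)
    assume "\<not> w > 0"
    then have "w = 0"
      by (simp add: w_def)
    then show False
      using eq zero_less_power[OF \<open>s > 0\<close>, of 4] by simp
  qed
  have "s = 1"
  proof (rule ccontr)
    assume "s \<noteq> 1"
    then have "s ^ 4 > 1"
      using \<open>s > 0\<close> by (intro one_less_power) auto
    obtain c where c: "s ^ 4 - 1 = 2 * c"
      using \<open>odd s\<close> by (metis even_diff evenE odd_one even_power odd_even_add)
    have "(w\<^sup>2) ^ 4 = s ^ 4 + c\<^sup>2"
    proof -
      have "4 * (w\<^sup>2) ^ 4 = (2 * w ^ 4)\<^sup>2"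
        by Groebner_Basis.algebra
      also have "\<dots> = (s ^ 4 + 1)\<^sup>2"
        by (simp add: eq)
      also have "\<dots> = 4 * s ^ 4 + (s ^ 4 - 1)\<^sup>2"
        by Groebner_Basis.algebra
      also have "\<dots> = 4 * (s ^ 4 + c\<^sup>2)"
        unfolding c by (simp add: power2_eq_square)
      finally show ?thesis
        by simp
    qed
    moreover have "coprime (w\<^sup>2) s"
    proof (rule coprimeI)
      fix k assume k: "k dvd w\<^sup>2" "k dvd s"
      have double: "2 * w ^ 4 = w\<^sup>2 * (2 * w\<^sup>2)"
        by Groebner_Basis.algebra
      have "k dvd 2 * w ^ 4"
        unfolding double using k(1) by (rule dvd_mult2)
      moreover have "k dvd s ^ 4"
        using k(2) by (simp add: power4_eq_xxxx)
      ultimately have *: "k dvd 2 * w ^ 4" "k dvd s ^ 4" .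
      have "k dvd 2 * w ^ 4 - s ^ 4"
        using * by (rule dvd_diff)
      moreover have "2 * w ^ 4 - s ^ 4 = 1"
        using eq by simp
      ultimately show "is_unit k"
        by simp
    qed
    ultimately show False
      using fermat_right_triangle[of "w\<^sup>2" s c] \<open>s > 0\<close> \<open>w > 0\<close> \<open>s ^ 4 > 1\<close> c by simp
  qed
  then have "w ^ 4 = 1"
    using eq by simp
  then have "w = 1"
    using \<open>w > 0\<close> by (metis power_eq_1_iff zero_neq_numeral abs_of_pos abs_1 power_eq_imp_eq_base zero_le_one order_less_imp_le one_power2 power_one zero_less_numeral)
  with \<open>s = 1\<close> show ?thesis
    unfolding s_def w_def by (metis one_power2 power2_abs)
qed

lemma square_mod_8_int: "odd (x::int) \<Longrightarrow> x\<^sup>2 mod 8 = 1"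
proof -
  assume "odd x"
  then obtain k where k: "x = 2 * k + 1" ..
  have "even (k * (k + 1))"
    by simp
  then obtain j where j: "k * (k + 1) = 2 * j" ..
  have "x\<^sup>2 = 4 * (k * (k + 1)) + 1"
    unfolding k by Groebner_Basis.algebra
  then show ?thesis
    unfolding j by simp
qed

lemma coprime_succ_int: "coprime (k::int) (k + 1)"
  by (rule coprimeI) (metis add_diff_cancel_left' dvd_diff)

text \<open>Only one of the coprime factors is divisible by 3, and it absorbs the whole 9. The sign
  alternative allows for a negative \<open>z\<close>.\<close>

lemma coprime_mult_eq_nine_square:
  fixes x y z :: int
  assumes "x * y = 9 * z\<^sup>2" "coprime x y" "x > 0" "y > 0"
  shows "\<exists>s t. s > 0 \<and> t > 0 \<and> (x = 9 * s\<^sup>2 \<and> y = t\<^sup>2 \<or> x = s\<^sup>2 \<and> y = 9 * t\<^sup>2) \<and> (z = s * t \<or> z = - (s * t))"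
proof -
  have aux: "\<exists>s t. s > 0 \<and> t > 0 \<and> u = 9 * s\<^sup>2 \<and> v = t\<^sup>2 \<and> (z = s * t \<or> z = - (s * t))"
    if uv: "u * v = 9 * z\<^sup>2" "coprime u v" "u > 0" "v > 0" "3 dvd u" for u v
  proof -
    have "\<not> 3 dvd v"
      using uv(2,5) by (metis coprime_common_divisor zdvd1_eq abs_numeral numeral_eq_one_iff num.distinct(3))
    then have "coprime 3 v"
      by (simp add: prime_imp_coprime)
    then have "coprime (3 ^ 2) v"
      by (simp only: coprime_power_left_iff) simp
    moreover have "3 ^ 2 dvd u * v"
      unfolding uv(1) by simp
    ultimately have "3 ^ 2 dvd u"
      by (simp only: coprime_dvd_mult_left_iff)
    then obtain w where w: "u = 9 * w"
      by auto
    have "w * v = z ^ 2"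
      using uv(1) w by simp
    moreover have "coprime w v"
      using uv(2) w by simp
    ultimately obtain s t where st: "s > 0" "t > 0" "w = s\<^sup>2" "v = t\<^sup>2"
      using coprime_mult_eq_power[of w v z 2] uv(3,4) w by auto
    have "z\<^sup>2 = (s * t)\<^sup>2"
      using \<open>w * v = z ^ 2\<close> st by (simp add: power_mult_distrib)
    then show ?thesis
      using st w by (auto simp: power2_eq_iff)
  qed
  have "3 dvd x * y"
    unfolding assms(1) by simp
  then consider "3 dvd x" | "3 dvd y"
    by (auto simp: prime_dvd_mult_iff)
  then show ?thesis
  proof cases
    case 1
    then show ?thesis
      using aux[of x y] assms by blast
  next
    case 2
    then show ?thesis
      using aux[of y x] assms by (metis coprime_commute mult.commute)
  qed
qed

lemma square_not_7_mod_8: "(x::int)\<^sup>2 mod 8 \<noteq> 7"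
proof (cases "even x")
  case True
  then obtain y where "x = 2 * y" ..
  then have "x\<^sup>2 = 4 * y\<^sup>2"
    by simp
  then show ?thesis
    by presburger
qed (simp add: square_mod_8_int)

lemma square_mod_3_int: "(x::int)\<^sup>2 mod 3 = 0 \<or> x\<^sup>2 mod 3 = 1"
proof -
  have "x mod 3 = 0 \<or> x mod 3 = 1 \<or> x mod 3 = 2"
    by presburger
  moreover have "x\<^sup>2 mod 3 = (x mod 3)\<^sup>2 mod 3"
    by (simp add: power_mod)
  ultimately show ?thesis
    by auto
qed

text \<open>With k = (3s - 1)/2 the equation reads k(k + 1) = 8 r^2. If k is even, then k = 8 u^2
  and 3 divides u^2 + 1; if k is odd, it is a square congruent to 7 modulo 8. Both are
  impossible.\<close>

lemma nine_square_eq_thirty_two_square: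
  fixes s r :: int
  assumes "9 * s\<^sup>2 = 32 * r\<^sup>2 + 1" "s > 0" "r \<noteq> 0"
  shows False
proof -
  have "odd (9 * s\<^sup>2)"
    unfolding assms(1) by simp
  then have "odd s"
    by simp
  define k where "k = (3 * s - 1) div 2"
  have k: "3 * s = 2 * k + 1"
    using \<open>odd s\<close> by (simp add: k_def)
  have "4 * (k * (k + 1)) = 9 * s\<^sup>2 - 1"
    using k by Groebner_Basis.algebra
  then have kk: "k * (k + 1) = 8 * r\<^sup>2"
    using assms(1) by simp
  have "k > 0"
    using k assms by simp
  show False
  proof (cases "even k")
    case True
    then have "coprime (2 ^ 3) (k + 1)"
      by (simp only: coprime_power_left_iff) simp
    moreover have "2 ^ 3 dvd k * (k + 1)"
      unfolding kk by simp
    ultimately have "2 ^ 3 dvd k"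
      by (simp only: coprime_dvd_mult_left_iff)
    then obtain j where j: "k = 8 * j"
      by auto
    have prod: "j * (k + 1) = r ^ 2"
      using kk j by simp
    have cop: "coprime j (k + 1)"
      by (metis j coprime_succ_int coprime_mult_left_iff)
    have pos: "j > 0" "k + 1 > 0"
      using \<open>k > 0\<close> j by simp_all
    from coprime_mult_eq_power[OF prod cop pos pos2] obtain u where "j = u\<^sup>2"
      by blast
    then have "3 * s = 16 * u\<^sup>2 + 1"
      using k j by linarith
    then have "u\<^sup>2 + 1 = 3 * (s - 5 * u\<^sup>2)"
      by (simp add: algebra_simps)
    then have "(u\<^sup>2 + 1) mod 3 = 0"
      by (metis mod_mult_self1_is_0)
    then show False
      using square_mod_3_int[of u] by presburger
  next
    case False
    then have "coprime (2 ^ 3) k"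
      by (simp only: coprime_power_left_iff) simp
    moreover have "2 ^ 3 dvd k * (k + 1)"
      unfolding kk by simp
    ultimately have "2 ^ 3 dvd k + 1"
      by (simp only: coprime_dvd_mult_right_iff)
    then obtain j where j: "k + 1 = 8 * j"
      by auto
    have prod: "k * j = r ^ 2"
      using kk j by simp
    have cop: "coprime k j"
      by (metis j coprime_succ_int coprime_mult_right_iff)
    have "j > 0"
      using \<open>k > 0\<close> j by linarith
    then obtain u where "k = u\<^sup>2"
      using coprime_mult_eq_power[OF prod cop \<open>k > 0\<close>] by auto
    then show False
      using square_not_7_mod_8[of u] j by presburger
  qed
qed

text \<open>Put 3 p^2 - 1 = 2x and 3 p^2 + 1 = 4y. Then xy = q^4 and x + 1 = 2y, so x and y are
  coprime fourth powers m^4 and n^4 with m^4 + 1 = 2 n^4.\<close>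

lemma nine_fourth_power_eq:
  fixes p q :: int
  assumes "9 * p ^ 4 = 8 * q ^ 4 + 1" "q > 0"
  shows "p\<^sup>2 = 1 \<and> q\<^sup>2 = 1"
proof -
  have "odd (9 * p ^ 4)"
    unfolding assms(1) by simp
  then have "odd p"
    by simp
  have "p\<^sup>2 mod 8 = 1"
    using \<open>odd p\<close> by (rule square_mod_8_int)
  then obtain j where j: "p\<^sup>2 = 8 * j + 1"
    by (metis mult_div_mod_eq)
  define x y where "x = 12 * j + 1" and "y = 6 * j + 1"
  have x: "3 * p\<^sup>2 - 1 = 2 * x" and y: "3 * p\<^sup>2 + 1 = 4 * y"
    by (simp_all add: x_def y_def j)
  have "8 * (x * y) = (3 * p\<^sup>2 - 1) * (3 * p\<^sup>2 + 1)"
    unfolding x y by simp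
  also have "\<dots> = 8 * q ^ 4"
    using assms(1) by Groebner_Basis.algebra
  finally have xy: "x * y = q ^ 4"
    by simp
  have xy1: "x + 1 = 2 * y"
    by (simp add: x_def y_def)
  have "coprime x y"
  proof (rule coprimeI)
    fix k assume k: "k dvd x" "k dvd y"
    then have "k dvd 2 * y - x"
      by (intro dvd_diff dvd_mult)
    moreover have "2 * y - x = 1"
      using xy1 by simp
    ultimately show "is_unit k"
      by simp
  qed
  have "p \<noteq> 0"
    using \<open>odd p\<close> by auto
  then have "p\<^sup>2 > 0"
    by simp
  then have "x > 0" "y > 0"
    using x y by linarith+
  obtain m n where mn: "x = m ^ 4" "y = n ^ 4"
    using coprime_mult_eq_power[OF xy \<open>coprime x y\<close> \<open>x > 0\<close> \<open>y > 0\<close>] by auto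
  have "m\<^sup>2 = 1 \<and> n\<^sup>2 = 1"
    using xy1 mn by (intro fourth_power_plus_one_eq_double) simp
  then have "(m\<^sup>2)\<^sup>2 = 1" "(n\<^sup>2)\<^sup>2 = 1"
    by simp_all
  then have "x = 1" "y = 1"
    using mn by simp_all
  then have "q ^ 4 = 1" "p\<^sup>2 = 1"
    using xy x by auto
  moreover have "q = 1"
    using \<open>q ^ 4 = 1\<close> assms(2) power_eq_imp_eq_base[of q 4 1] by simp
  ultimately show ?thesis
    by simp
qed

text \<open>Completing the square gives the Pell equation t^2 - 288 z^2 = 1 with t = a^2 - 17z.
  Factoring t^2 - 1, and then a^2 = t + 17z, leads down to 9 p^4 = 8 q^4 + 1.\<close>

lemma quadratic_in_square_eq_one:
  fixes a z :: int
  assumes eq: "a ^ 4 - 34 * a\<^sup>2 * z + z\<^sup>2 = 1" and "odd a" "4 dvd z"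
  shows "a\<^sup>2 = 1"
proof (cases "z = 0")
  case True
  then have "(a\<^sup>2)\<^sup>2 = 1"
    using eq by simp
  then show ?thesis
    by (metis power2_eq_1_iff zero_le_power2 neg_0_le_iff_le not_one_le_zero)
next
  case False
  have "a\<^sup>2 mod 8 = 1"
    using \<open>odd a\<close> by (rule square_mod_8_int)
  then obtain j where j: "a\<^sup>2 = 8 * j + 1"
    by (metis mult_div_mod_eq)
  obtain z' where z': "z = 4 * z'"
    using \<open>4 dvd z\<close> ..
  have "(8 * j + 1)\<^sup>2 - 34 * (8 * j + 1) * (4 * z') + (4 * z')\<^sup>2 = 1"
    using eq unfolding j[symmetric] z'[symmetric] by simp
  \<comment> \<open>Modulo 16 the terms a^4 - 1 and z^2 vanish, so 34 a^2 z does too; this improves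
    divisibility of \<open>z\<close> by 4 to divisibility by 8.\<close>
  then have "8 * (8 * j\<^sup>2 + 2 * j - 34 * 4 * j * z' - 17 * z' + 2 * z'\<^sup>2) = 0"
    by Groebner_Basis.algebra
  then have "17 * z' = 2 * (4 * j\<^sup>2 + j - 68 * j * z' + z'\<^sup>2)"
    by simp
  then have "even (17 * z')"
    by (metis dvd_triv_left)
  then have "even z'"
    by simp
  then obtain z'' where z'': "z = 8 * z''"
    using z' by auto
  define t where "t = a\<^sup>2 - 17 * z"
  have t: "t\<^sup>2 = 288 * z\<^sup>2 + 1"
    unfolding t_def using eq by Groebner_Basis.algebra
  have t8: "t = 8 * (j - 17 * z'') + 1"
    by (simp add: t_def j z'')
  define h where "h = 4 * (j - 17 * z'')"
  have th: "t = 2 * h + 1"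
    by (simp add: t8 h_def)
  have "4 * (h * (h + 1)) = 4 * (72 * z\<^sup>2)"
    using t unfolding th by Groebner_Basis.algebra
  then have hh: "h * (h + 1) = 72 * z\<^sup>2"
    by simp
  then have "h * (h + 1) > 0"
    using False by simp
  then consider "h > 0" | "h + 1 < 0"
    by (auto simp: zero_less_mult_iff)
  then show ?thesis
  proof cases
    case 1
    have "even h"
      by (simp add: h_def)
    then have "coprime (2 ^ 3) (h + 1)"
      by (simp only: coprime_power_left_iff) simp
    moreover have "2 ^ 3 dvd h * (h + 1)"
      unfolding hh by simp
    ultimately have "2 ^ 3 dvd h"
      by (simp only: coprime_dvd_mult_left_iff)
    then obtain i where i: "h = 8 * i"
      by auto
    have ii: "i * (h + 1) = 9 * z\<^sup>2"
      using hh i by simp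
    have "coprime i (h + 1)"
      by (metis i coprime_succ_int coprime_mult_left_iff)
    then obtain s r where sr: "s > 0" "r > 0" "i = 9 * s\<^sup>2 \<and> h + 1 = r\<^sup>2 \<or> i = s\<^sup>2 \<and> h + 1 = 9 * r\<^sup>2"
      "z = s * r \<or> z = - (s * r)"
      using coprime_mult_eq_nine_square[OF ii] 1 i by auto
    from sr(3) show ?thesis
    proof
      assume *: "i = s\<^sup>2 \<and> h + 1 = 9 * r\<^sup>2"
      have "even z"
        using z'' by simp
      then have "even (s * r)"
        using sr(4) by auto
      moreover have "odd (9 * r\<^sup>2)"
        using * \<open>even h\<close> by (metis even_plus_one_iff)
      ultimately obtain s' where "s = 2 * s'"
        by auto
      then have "9 * r\<^sup>2 = 32 * s'\<^sup>2 + 1"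
        using * i by simp
      then show ?thesis
        using nine_square_eq_thirty_two_square[of r s'] sr \<open>s = 2 * s'\<close> by simp
    next
      assume *: "i = 9 * s\<^sup>2 \<and> h + 1 = r\<^sup>2"
      \<comment> \<open>The sign of \<open>z\<close> is moved into \<open>w\<close>, so that z = r w
        with r > 0.\<close>
      define w where "w = (if z = s * r then s else - s)"
      have w: "w\<^sup>2 = s\<^sup>2" "z = r * w"
        using sr(4) by (auto simp: w_def)
      have r2: "r\<^sup>2 = 72 * w\<^sup>2 + 1"
        using * i w by simp
      have "a\<^sup>2 = t + 17 * z"
        by (simp add: t_def)
      also have "t = r\<^sup>2 + 72 * w\<^sup>2"
        using th * i w by simp
      \<comment> \<open>The form r^2 + 17 r w + 72 w^2 splits over the integers. Its factors differ
        by \<open>w\<close>, and r^2 - 72 w^2 = 1 makes them coprime, so each is a square.\<close>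
      finally have prod: "(r + 8 * w) * (r + 9 * w) = a\<^sup>2"
        unfolding w(2) by Groebner_Basis.algebra
      have "\<bar>8 * w\<bar> < r"
      proof (rule power2_less_imp_less)
        show "\<bar>8 * w\<bar>\<^sup>2 < r\<^sup>2"
          unfolding r2 by (simp add: power_mult_distrib)
      qed (use sr in simp)
      then have pos: "r + 8 * w > 0"
        by linarith
      have "(r + 8 * w) * (r + 9 * w) > 0"
        unfolding prod using \<open>odd a\<close> by auto
      then have pos': "r + 9 * w > 0"
        using pos by (simp add: zero_less_mult_iff)
      have cop: "coprime (r + 8 * w) (r + 9 * w)"
      proof (rule coprimeI)
        fix k assume k: "k dvd r + 8 * w" "k dvd r + 9 * w"
        then have "k dvd (r + 9 * w) - (r + 8 * w)"
          by (intro dvd_diff)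
        then have kw: "k dvd w"
          by simp
        then have "k dvd (r + 8 * w) - 8 * w"
          using k by (intro dvd_diff dvd_mult)
        then have "k dvd r * r - 72 * w * w"
          using kw by (intro dvd_diff dvd_mult) auto
        then show "is_unit k"
          using r2 by (simp add: power2_eq_square)
      qed
      obtain p q where pq: "p > 0" "q > 0" "r + 8 * w = p\<^sup>2" "r + 9 * w = q\<^sup>2"
        using coprime_mult_eq_power[OF prod cop pos pos'] by auto
      have "w = q\<^sup>2 - p\<^sup>2" "r = 9 * p\<^sup>2 - 8 * q\<^sup>2"
        using pq by auto
      then have "9 * p ^ 4 = 8 * q ^ 4 + 1"
        using r2 by Groebner_Basis.algebra
      then have "p\<^sup>2 = 1 \<and> q\<^sup>2 = 1"
        using pq by (intro nine_fourth_power_eq)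
      then show ?thesis
        using prod pq by simp
    qed
  next
    case 2
    \<comment> \<open>Now \<open>x\<close> and x + 1 = -h are positive and consecutive, and 8
      divides the latter. So \<open>x\<close> is 7 modulo 8, while the factorization makes it s^2 or
      9 s^2.\<close>
    define x where "x = - (h + 1)"
    have xh: "x * (- h) = 72 * z\<^sup>2"
      using hh by (simp add: x_def algebra_simps)
    have x4: "x mod 4 = 3"
      unfolding x_def h_def by presburger
    have "odd x"
      using x4 by presburger
    then have "coprime (2 ^ 3) x"
      by (simp only: coprime_power_left_iff) simp
    moreover have "2 ^ 3 dvd x * (- h)"
      unfolding xh by simp
    ultimately have "2 ^ 3 dvd - h"
      by (simp only: coprime_dvd_mult_right_iff)
    then obtain i where i: "- h = 8 * i"
      by auto
    have ii: "x * i = 9 * z\<^sup>2"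
      using xh unfolding i by (simp add: mult.commute)
    have "coprime x (- h)"
      using coprime_succ_int[of x] by (simp add: x_def)
    then have "coprime x i"
      unfolding i by simp
    then obtain s r where "x = 9 * s\<^sup>2 \<or> x = s\<^sup>2"
      using coprime_mult_eq_nine_square[OF ii] 2 i by (auto simp: x_def)
    moreover have "x mod 8 = 7"
      using i x_def by presburger
    ultimately have "s\<^sup>2 mod 8 = 7"
      by presburger
    then show ?thesis
      using square_not_7_mod_8[of s] by simp
  qed
qed

text \<open>These congruences make the unit A + B sqrt 2 totally positive: norm -1 fails modulo 8,
  and a negative \<open>A\<close> would turn (-A - 1)/2 into a square congruent to 7 modulo
  8.\<close>

lemma norm_sqrt2_pos:
  fixes A B :: int
  assumes "\<bar>A\<^sup>2 - 2 * B\<^sup>2\<bar> = 1" "A mod 4 = 1" "4 dvd B"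
  shows "A > 0 \<and> A\<^sup>2 - 2 * B\<^sup>2 = 1"
proof -
  obtain b where b: "B = 4 * b"
    using assms(3) ..
  have "odd A"
    using assms(2) by presburger
  have A1: "A\<^sup>2 = 32 * b\<^sup>2 + 1"
  proof -
    have "A\<^sup>2 - 2 * B\<^sup>2 = A\<^sup>2 - 32 * b\<^sup>2"
      by (simp add: b power_mult_distrib)
    moreover have "A\<^sup>2 mod 8 = 1"
      using \<open>odd A\<close> by (rule square_mod_8_int)
    ultimately show ?thesis
      using assms(1) by presburger
  qed
  have "A > 0"
  proof (rule ccontr)
    assume "\<not> A > 0"
    define k where "k = (- A - 1) div 2"
    have k: "- A = 2 * k + 1"
      using \<open>odd A\<close> by (simp add: k_def)
    have "4 * (k * (k + 1)) = 4 * (8 * b\<^sup>2)"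
      using A1 k by Groebner_Basis.algebra
    then have kk: "k * (k + 1) = 8 * b\<^sup>2"
      by simp
    have "odd k"
      using k assms(2) by presburger
    have "k > 0"
      using k \<open>\<not> A > 0\<close> \<open>odd k\<close> by presburger
    have "coprime (2 ^ 3) k"
      using \<open>odd k\<close> by (simp only: coprime_power_left_iff) simp
    moreover have "2 ^ 3 dvd k * (k + 1)"
      unfolding kk by simp
    ultimately have "2 ^ 3 dvd k + 1"
      by (simp only: coprime_dvd_mult_right_iff)
    then obtain j where j: "k + 1 = 8 * j"
      by auto
    have prod: "k * j = b ^ 2"
      using kk j by simp
    have cop: "coprime k j"
      by (metis j coprime_succ_int coprime_mult_right_iff)
    have "j > 0"
      using \<open>k > 0\<close> j by linarith
    then obtain u where "k = u\<^sup>2"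
      using coprime_mult_eq_power[OF prod cop \<open>k > 0\<close>] by auto
    then show False
      using square_not_7_mod_8[of u] j by presburger
  qed
  with A1 b show ?thesis
    by (simp add: power_mult_distrib)
qed

section \<open>Products of rotated linear forms\<close>

text \<open>The product of z0 + u z1 + u^2 z2 + u^3 z3 over the fourth roots of unity u, that is,
  the determinant of a circulant matrix of size four.\<close>

definition rotation_product :: "complex \<Rightarrow> complex \<Rightarrow> complex \<Rightarrow> complex \<Rightarrow> complex" where
  "rotation_product z0 z1 z2 z3 =
     (z0 + z1 + z2 + z3) * (z0 + \<i> * z1 - z2 - \<i> * z3) * (z0 - z1 + z2 - z3) * (z0 - \<i> * z1 - z2 + \<i> * z3)"

lemma imaginary_unit_power_simps: "\<i> ^ 2 = -1" "\<i> ^ 3 = - \<i>" "\<i> ^ 4 = 1"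
  by (simp_all add: power3_eq_cube power4_eq_xxxx)

text \<open>Both triples s (x^2, xy, y^2) and s' (x'^2, x'y', y'^2) are geometric progressions, so
  the factors x - u y and x' - u l y' telescope them; because u^4 = 1, only a quadratic polynomial
  in u remains.\<close>

lemma harmonic_difference_identity:
  fixes s x y s' x' y' \<tau> u l :: complex
  assumes "u ^ 4 = 1" "l ^ 4 = 1"
  shows "(\<tau> + u * (s * x\<^sup>2 - l * (s' * x'\<^sup>2)) + u\<^sup>2 * (s * x * y - l\<^sup>2 * (s' * x' * y'))
      + u ^ 3 * (s * y\<^sup>2 - l ^ 3 * (s' * y'\<^sup>2))) * ((x - u * y) * (x' - u * l * y'))
    = (x * x' * \<tau> - s * y ^ 3 * x' + s' * y' ^ 3 * x)
      + l * u\<^sup>2 * (y * y' * \<tau> - s * x ^ 3 * y' + s' * x' ^ 3 * y)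
      + u * ((- \<tau> * y * x' + s * x ^ 3 * x' - s' * y' ^ 3 * y) - l * (\<tau> * y' * x + s' * x' ^ 3 * x - s * y ^ 3 * y'))"
  using assms by Groebner_Basis.algebra

lemma rotation_product_harmonic:
  fixes s x y s' x' y' \<tau> l :: complex
  assumes "l ^ 4 = 1"
  defines "Y \<equiv> x * x' * \<tau> - s * y ^ 3 * x' + s' * y' ^ 3 * x"
    and "Z \<equiv> y * y' * \<tau> - s * x ^ 3 * y' + s' * x' ^ 3 * y"
    and "b \<equiv> (- \<tau> * y * x' + s * x ^ 3 * x' - s' * y' ^ 3 * y) - l * (\<tau> * y' * x + s' * x' ^ 3 * x - s * y ^ 3 * y')"
  shows "rotation_product \<tau> (s * x\<^sup>2 - l * (s' * x'\<^sup>2)) (s * x * y - l\<^sup>2 * (s' * x' * y')) (s * y\<^sup>2 - l ^ 3 * (s' * y'\<^sup>2))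
      * ((x ^ 4 - y ^ 4) * (x' ^ 4 - y' ^ 4))
    = ((Y + l * Z)\<^sup>2 - b\<^sup>2) * ((Y - l * Z)\<^sup>2 + b\<^sup>2)"
proof -
  define z1 z2 z3 where "z1 = s * x\<^sup>2 - l * (s' * x'\<^sup>2)" and "z2 = s * x * y - l\<^sup>2 * (s' * x' * y')"
    and "z3 = s * y\<^sup>2 - l ^ 3 * (s' * y'\<^sup>2)"
  have id: "(\<tau> + u * z1 + u\<^sup>2 * z2 + u ^ 3 * z3) * ((x - u * y) * (x' - u * l * y')) = Y + l * u\<^sup>2 * Z + u * b"
    if "u ^ 4 = 1" for u
    unfolding z1_def z2_def z3_def Y_def Z_def b_def using that assms(1) by (rule harmonic_difference_identity)
  have 1: "(\<tau> + z1 + z2 + z3) * ((x - y) * (x' - l * y')) = Y + l * Z + b"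
    using id[of 1] by simp
  have 2: "(\<tau> + \<i> * z1 - z2 - \<i> * z3) * ((x - \<i> * y) * (x' - \<i> * l * y')) = Y - l * Z + \<i> * b"
    using id[of \<i>] by (simp add: imaginary_unit_power_simps)
  have 3: "(\<tau> - z1 + z2 - z3) * ((x + y) * (x' + l * y')) = Y + l * Z - b"
    using id[of "-1"] by simp
  have 4: "(\<tau> - \<i> * z1 - z2 + \<i> * z3) * ((x + \<i> * y) * (x' + \<i> * l * y')) = Y - l * Z - \<i> * b"
    using id[of "- \<i>"] by (simp add: imaginary_unit_power_simps)
  have q: "(x - y) * (x - \<i> * y) * (x + y) * (x + \<i> * y) = x ^ 4 - y ^ 4"
    using i_squared by Groebner_Basis.algebra
  have q': "(x' - l * y') * (x' - \<i> * l * y') * (x' + l * y') * (x' + \<i> * l * y') = x' ^ 4 - y' ^ 4"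
    using i_squared assms(1) by Groebner_Basis.algebra
  have "rotation_product \<tau> z1 z2 z3 * ((x ^ 4 - y ^ 4) * (x' ^ 4 - y' ^ 4))
     = ((\<tau> + z1 + z2 + z3) * ((x - y) * (x' - l * y')))
     * ((\<tau> + \<i> * z1 - z2 - \<i> * z3) * ((x - \<i> * y) * (x' - \<i> * l * y')))
     * ((\<tau> - z1 + z2 - z3) * ((x + y) * (x' + l * y')))
     * ((\<tau> - \<i> * z1 - z2 + \<i> * z3) * ((x + \<i> * y) * (x' + \<i> * l * y')))"
    unfolding rotation_product_def q[symmetric] q'[symmetric] by (simp only: mult_ac)
  also have "\<dots> = (Y + l * Z + b) * (Y - l * Z + \<i> * b) * (Y + l * Z - b) * (Y - l * Z - \<i> * b)"
    unfolding 1 2 3 4 ..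
  also have "\<dots> = ((Y + l * Z)\<^sup>2 - b\<^sup>2) * ((Y - l * Z)\<^sup>2 + b\<^sup>2)"
    using i_squared by Groebner_Basis.algebra
  finally show ?thesis
    unfolding z1_def z2_def z3_def .
qed

text \<open>The second progression is now the conjugate of the first. Then \<open>Y\<close> and
  \<open>Z\<close> are purely imaginary, the linear coefficient is B - l cnj B, and |B|^2 + Y Z = |s
  (x^4 - y^4)|^2. Normalizing by this value gives real quadratic forms for all four \<open>l\<close>
  in the same few parameters.\<close>

lemma rotation_product_real_form:
  fixes s x y \<tau> :: complex
  assumes "cnj \<tau> = - \<tau>" and nz: "s * s * (x ^ 4 - y ^ 4) \<noteq> 0"
  defines "P \<equiv> \<lambda>l. rotation_product \<tau> (s * x\<^sup>2 - l * cnj (s * x\<^sup>2)) (s * x * y - l\<^sup>2 * cnj (s * x * y)) (s * y\<^sup>2 - l ^ 3 * cnj (s * y\<^sup>2))"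
    and "N \<equiv> (cmod (s * s * (x ^ 4 - y ^ 4)))\<^sup>2"
  shows "\<exists>e g c R J :: real. e \<ge> 0 \<and> g \<ge> 0 \<and> e * g = c\<^sup>2 \<and> R\<^sup>2 + J\<^sup>2 = (1 + c)\<^sup>2 \<and>
    P 1 = of_real (N * ((e + g)\<^sup>2 - 4 * (R - 1)\<^sup>2)) \<and>
    P (-1) = of_real (N * ((e + g)\<^sup>2 - 4 * (R + 1)\<^sup>2)) \<and>
    P (-\<i>) = of_real (N * ((e - g)\<^sup>2 + 4 * (J + 1)\<^sup>2)) \<and>
    P \<i> = of_real (N * ((e - g)\<^sup>2 + 4 * (J - 1)\<^sup>2))"
proof -
  define q where "q = x ^ 4 - y ^ 4"
  define Y where "Y = x * cnj x * \<tau> - s * y ^ 3 * cnj x + cnj s * cnj y ^ 3 * x"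
  define Z where "Z = y * cnj y * \<tau> - s * x ^ 3 * cnj y + cnj s * cnj x ^ 3 * y"
  define B where "B = - \<tau> * y * cnj x + s * x ^ 3 * cnj x - cnj s * cnj y ^ 3 * y"
  define \<Delta> where "\<Delta> = (cmod s)\<^sup>2 * (cmod q)\<^sup>2"
  have "s \<noteq> 0" "q \<noteq> 0"
    using nz by (auto simp: q_def)
  then have \<Delta>: "\<Delta> > 0"
    by (simp add: \<Delta>_def)
  have cB: "cnj B = \<tau> * cnj y * x + cnj s * cnj x ^ 3 * x - s * y ^ 3 * cnj y"
    by (simp add: B_def assms(1))
  have "cnj Y = - Y" "cnj Z = - Z"
    by (simp_all add: Y_def Z_def assms(1))
  then have "Y = \<i> * of_real (Im Y)" "Z = \<i> * of_real (Im Z)"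
    by (simp_all add: complex_eq_iff)
  then obtain yh xh where yh: "Y = \<i> * of_real yh" and xh: "Z = \<i> * of_real xh"
    by blast
  obtain b1 b2 where b: "B = Complex b1 b2"
    by (cases B)
  have "B * cnj B + Z * Y = s * cnj s * (q * cnj q)"
    unfolding cB unfolding B_def Z_def Y_def q_def complex_cnj_diff complex_cnj_power by Groebner_Basis.algebra
  also have "\<dots> = of_real \<Delta>"
    by (simp add: \<Delta>_def complex_norm_square flip: of_real_power)
  finally have "of_real (b1\<^sup>2 + b2\<^sup>2 - xh * yh) = (of_real \<Delta> :: complex)"
    by (simp add: b xh yh complex_eq_iff power2_eq_square)
  then have det: "b1\<^sup>2 + b2\<^sup>2 = \<Delta> + xh * yh"
    by (simp only: of_real_eq_iff)
  have Pl: "P l * of_real ((cmod q)\<^sup>2) = ((Y + l * Z)\<^sup>2 - (B - l * cnj B)\<^sup>2) * ((Y - l * Z)\<^sup>2 + (B - l * cnj B)\<^sup>2)"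
    if "l ^ 4 = 1" for l
  proof -
    have "P l * (q * cnj q) = ((Y + l * Z)\<^sup>2 - (B - l * cnj B)\<^sup>2) * ((Y - l * Z)\<^sup>2 + (B - l * cnj B)\<^sup>2)"
      unfolding P_def q_def cB unfolding Y_def Z_def B_def
      using rotation_product_harmonic[OF that, of \<tau> s x "cnj s" "cnj x" y "cnj y"] by simp
    then show ?thesis
      by (simp only: complex_norm_square)
  qed
  have solve: "P l = of_real (N * (V / \<Delta>\<^sup>2))" if "P l * of_real ((cmod q)\<^sup>2) = of_real V" for l V
  proof -
    have "N * (cmod q)\<^sup>2 = \<Delta>\<^sup>2"
      by (simp add: N_def \<Delta>_def norm_mult q_def power2_eq_square)
    then have "N * (V / \<Delta>\<^sup>2) * (cmod q)\<^sup>2 = V"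
      using \<Delta> by (metis (no_types, lifting) mult.assoc mult.commute nonzero_mult_div_cancel_left order_less_irrefl power_not_zero times_divide_eq_right)
    then have "P l * of_real ((cmod q)\<^sup>2) = of_real (N * (V / \<Delta>\<^sup>2)) * of_real ((cmod q)\<^sup>2)"
      using that by (metis of_real_mult)
    then show ?thesis
      using \<open>q \<noteq> 0\<close> by (simp only: mult_cancel_right of_real_eq_0_iff power_eq_0_iff norm_eq_zero) auto
  qed
  \<comment> \<open>\<open>R\<close> + i \<open>J\<close> is B^2 / \<Delta>, whose absolute value is
    |1 + c| by \<open>det\<close>; \<open>e\<close>, \<open>g\<close> and \<open>c\<close> come from
    the imaginary parts of \<open>Y\<close> and \<open>Z\<close>.\<close>
  define e g c R J where "e = yh\<^sup>2 / \<Delta>" and "g = xh\<^sup>2 / \<Delta>" and "c = xh * yh / \<Delta>"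
    and "R = (b1\<^sup>2 - b2\<^sup>2) / \<Delta>" and "J = 2 * b1 * b2 / \<Delta>"
  have sub: "yh\<^sup>2 = e * \<Delta>" "xh\<^sup>2 = g * \<Delta>" "b1\<^sup>2 - b2\<^sup>2 = R * \<Delta>" "2 * b1 * b2 = J * \<Delta>"
    using \<Delta> by (simp_all add: e_def g_def R_def J_def)
  have P1: "P 1 = of_real (N * (((- (yh + xh)\<^sup>2 + 4 * b2\<^sup>2) * (- (yh - xh)\<^sup>2 - 4 * b2\<^sup>2)) / \<Delta>\<^sup>2))"
    by (rule solve, subst Pl) (simp_all add: b xh yh complex_eq_iff power2_eq_square algebra_simps)
  have P2: "P (-1) = of_real (N * (((- (yh - xh)\<^sup>2 - 4 * b1\<^sup>2) * (- (yh + xh)\<^sup>2 + 4 * b1\<^sup>2)) / \<Delta>\<^sup>2))"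
    by (rule solve, subst Pl) (simp_all add: b xh yh complex_eq_iff power2_eq_square algebra_simps)
  have P3: "P (-\<i>) = of_real (N * (((xh\<^sup>2 - yh\<^sup>2)\<^sup>2 + 4 * ((b1 + b2)\<^sup>2 - xh * yh)\<^sup>2) / \<Delta>\<^sup>2))"
    by (rule solve, subst Pl) (simp_all add: imaginary_unit_power_simps b xh yh complex_eq_iff power2_eq_square algebra_simps)
  have P4: "P \<i> = of_real (N * (((xh\<^sup>2 - yh\<^sup>2)\<^sup>2 + 4 * ((b1 - b2)\<^sup>2 - xh * yh)\<^sup>2) / \<Delta>\<^sup>2))"
    by (rule solve, subst Pl) (simp_all add: imaginary_unit_power_simps b xh yh complex_eq_iff power2_eq_square algebra_simps)
  have V1: "((- (yh + xh)\<^sup>2 + 4 * b2\<^sup>2) * (- (yh - xh)\<^sup>2 - 4 * b2\<^sup>2)) / \<Delta>\<^sup>2 = (e + g)\<^sup>2 - 4 * (R - 1)\<^sup>2"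
  proof -
    have "4 * b2\<^sup>2 = 2 * \<Delta> + 2 * (xh * yh) - 2 * (b1\<^sup>2 - b2\<^sup>2)"
      using det by simp
    then have "(- (yh + xh)\<^sup>2 + 4 * b2\<^sup>2) * (- (yh - xh)\<^sup>2 - 4 * b2\<^sup>2)
        = (yh\<^sup>2 + xh\<^sup>2)\<^sup>2 - 4 * ((b1\<^sup>2 - b2\<^sup>2) - \<Delta>)\<^sup>2"
      by Groebner_Basis.algebra
    also have "\<dots> = \<Delta>\<^sup>2 * ((e + g)\<^sup>2 - 4 * (R - 1)\<^sup>2)"
      unfolding sub by Groebner_Basis.algebra
    finally show ?thesis
      using \<Delta> by simp
  qed
  have V2: "((- (yh - xh)\<^sup>2 - 4 * b1\<^sup>2) * (- (yh + xh)\<^sup>2 + 4 * b1\<^sup>2)) / \<Delta>\<^sup>2 = (e + g)\<^sup>2 - 4 * (R + 1)\<^sup>2"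
  proof -
    have "4 * b1\<^sup>2 = 2 * \<Delta> + 2 * (xh * yh) + 2 * (b1\<^sup>2 - b2\<^sup>2)"
      using det by simp
    then have "(- (yh - xh)\<^sup>2 - 4 * b1\<^sup>2) * (- (yh + xh)\<^sup>2 + 4 * b1\<^sup>2)
        = (yh\<^sup>2 + xh\<^sup>2)\<^sup>2 - 4 * ((b1\<^sup>2 - b2\<^sup>2) + \<Delta>)\<^sup>2"
      by Groebner_Basis.algebra
    also have "\<dots> = \<Delta>\<^sup>2 * ((e + g)\<^sup>2 - 4 * (R + 1)\<^sup>2)"
      unfolding sub by Groebner_Basis.algebra
    finally show ?thesis
      using \<Delta> by simp
  qed
  have V3: "((xh\<^sup>2 - yh\<^sup>2)\<^sup>2 + 4 * ((b1 + b2)\<^sup>2 - xh * yh)\<^sup>2) / \<Delta>\<^sup>2 = (e - g)\<^sup>2 + 4 * (J + 1)\<^sup>2"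
  proof -
    have "(b1 + b2)\<^sup>2 - xh * yh = \<Delta> + 2 * b1 * b2"
      using det by (simp add: power2_sum)
    then have "(xh\<^sup>2 - yh\<^sup>2)\<^sup>2 + 4 * ((b1 + b2)\<^sup>2 - xh * yh)\<^sup>2 = \<Delta>\<^sup>2 * ((e - g)\<^sup>2 + 4 * (J + 1)\<^sup>2)"
      unfolding sub by Groebner_Basis.algebra
    then show ?thesis
      using \<Delta> by simp
  qed
  have V4: "((xh\<^sup>2 - yh\<^sup>2)\<^sup>2 + 4 * ((b1 - b2)\<^sup>2 - xh * yh)\<^sup>2) / \<Delta>\<^sup>2 = (e - g)\<^sup>2 + 4 * (J - 1)\<^sup>2"
  proof -
    have "(b1 - b2)\<^sup>2 - xh * yh = \<Delta> - 2 * b1 * b2"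
      using det by (simp add: power2_diff)
    then have "(xh\<^sup>2 - yh\<^sup>2)\<^sup>2 + 4 * ((b1 - b2)\<^sup>2 - xh * yh)\<^sup>2 = \<Delta>\<^sup>2 * ((e - g)\<^sup>2 + 4 * (J - 1)\<^sup>2)"
      unfolding sub by Groebner_Basis.algebra
    then show ?thesis
      using \<Delta> by simp
  qed
  have eg: "e \<ge> 0" "g \<ge> 0" "e * g = c\<^sup>2"
    using \<Delta> by (simp_all add: e_def g_def c_def power2_eq_square)
  have RJ: "R\<^sup>2 + J\<^sup>2 = (1 + c)\<^sup>2"
  proof -
    have "xh * yh = c * \<Delta>"
      using \<Delta> by (simp add: c_def)
    have "\<Delta>\<^sup>2 * (R\<^sup>2 + J\<^sup>2) = (b1\<^sup>2 - b2\<^sup>2)\<^sup>2 + (2 * b1 * b2)\<^sup>2"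
      unfolding sub by Groebner_Basis.algebra
    also have "\<dots> = (b1\<^sup>2 + b2\<^sup>2)\<^sup>2"
      by Groebner_Basis.algebra
    also have "\<dots> = \<Delta>\<^sup>2 * (1 + c)\<^sup>2"
      unfolding det \<open>xh * yh = c * \<Delta>\<close> by Groebner_Basis.algebra
    finally show ?thesis
      using \<Delta> by simp
  qed
  show ?thesis
    by (intro exI[of _ e] exI[of _ g] exI[of _ c] exI[of _ R] exI[of _ J] conjI eg RJ
        P1[unfolded V1] P2[unfolded V2] P3[unfolded V3] P4[unfolded V4])
qed

text \<open>The arithmetic-geometric mean inequality gives 2|c| \<le> e + g. The negative forms are
  differences of squares and force e + g < 2 - 2R and e + g < 2 + 2R.\<close>

lemma abs_less_one_of_negative_forms:
  fixes e g c R J :: real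
  assumes "e \<ge> 0" "g \<ge> 0" "e * g = c\<^sup>2" "R\<^sup>2 + J\<^sup>2 = (1 + c)\<^sup>2"
    and "(e + g)\<^sup>2 - 4 * (R - 1)\<^sup>2 < 0" "(e + g)\<^sup>2 - 4 * (R + 1)\<^sup>2 < 0"
  shows "\<bar>c\<bar> < 1"
proof -
  have am: "(2 * c)\<^sup>2 \<le> (e + g)\<^sup>2"
  proof -
    have "(e + g)\<^sup>2 - (2 * c)\<^sup>2 = (e - g)\<^sup>2"
      unfolding power_mult_distrib assms(3)[symmetric] by (simp add: power2_eq_square algebra_simps)
    then show ?thesis
      by (smt (verit) zero_le_power2)
  qed
  then have "\<bar>2 * c\<bar>\<^sup>2 \<le> (e + g)\<^sup>2"
    by (simp only: power2_abs)
  then have "\<bar>2 * c\<bar> \<le> e + g"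
    by (rule power2_le_imp_le) (use assms(1,2) in simp)
  have "R\<^sup>2 \<le> (1 + c)\<^sup>2"
    using assms(4) by (smt (verit) zero_le_power2)
  then have "\<bar>R\<bar> \<le> \<bar>1 + c\<bar>"
    by (simp add: abs_le_square_iff)
  then have p: "e + g + 2 - 2 * R \<ge> 0" "e + g + 2 + 2 * R \<ge> 0"
    using \<open>\<bar>2 * c\<bar> \<le> e + g\<close> by linarith+
  have "(e + g - 2 + 2 * R) * (e + g + 2 - 2 * R) < 0"
    using assms(5) by (simp add: power2_eq_square algebra_simps)
  then have "e + g - 2 + 2 * R < 0"
    using p(1) by (simp add: mult_less_0_iff)
  moreover have "(e + g - 2 - 2 * R) * (e + g + 2 + 2 * R) < 0"
    using assms(6) by (simp add: power2_eq_square algebra_simps)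
  then have "e + g - 2 - 2 * R < 0"
    using p(2) by (simp add: mult_less_0_iff)
  ultimately show ?thesis
    using \<open>\<bar>2 * c\<bar> \<le> e + g\<close> by linarith
qed

section \<open>The unit equation for negative discriminants\<close>

lemma squarefree_square_dvd:
  fixes a d e :: int
  assumes "squarefree d" "a\<^sup>2 dvd d * e\<^sup>2" "a \<noteq> 0"
  shows "a dvd e"
proof -
  define g where "g = gcd a e"
  have "g \<noteq> 0"
    using assms(3) by (simp add: g_def)
  obtain a' e' where ae: "a = a' * g" "e = e' * g" "coprime a' e'"
    using gcd_coprime_exists[of a e] \<open>g \<noteq> 0\<close> unfolding g_def by auto
  have "g\<^sup>2 * a'\<^sup>2 dvd g\<^sup>2 * (d * e'\<^sup>2)"
    using assms(2) by (simp add: ae power_mult_distrib mult_ac)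
  then have "a'\<^sup>2 dvd d * e'\<^sup>2"
    using \<open>g \<noteq> 0\<close> by simp
  moreover have "coprime (a'\<^sup>2) (e'\<^sup>2)"
    using ae(3) by simp
  ultimately have "a'\<^sup>2 dvd d"
    by (simp add: coprime_dvd_mult_left_iff)
  then have "is_unit a'"
    using assms(1) unfolding squarefree_def by blast
  then show ?thesis
    by (metis ae(1,2) dvd_refl mult_dvd_mono unit_imp_dvd)
qed

text \<open>
  Here \<^term>\<open>v j\<close> stands for the product of the conjugate differences \<open>\<theta>\<^sub>k - \<theta>\<^sub>l\<close> with
  \<open>l - k\<close> of one of the four residue types, and \<^term>\<open>s\<close> for the square root of \<^term>\<open>d\<close>.
\<close>

lemma unit_sum_of_squares_pos:
  fixes a d q0 q1 e0 e1 :: int and s e g c R J :: real and v :: "nat \<Rightarrow> real"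
  assumes a: "a > 0" "odd a" and d: "d \<ge> 2" "squarefree d" "d mod 4 \<noteq> 3" and even: "even e0" "even e1"
    and s: "s > 0" "s\<^sup>2 = of_int d"
    and v: "v 0 = 2 * d * (e0 + e1 * sqrt 2) - 2 * s * a * (q0 + q1 * sqrt 2)"
      "v 1 = 2 * d * (e0 + e1 * sqrt 2) + 2 * s * a * (q0 + q1 * sqrt 2)"
      "v 2 = 2 * d * (e0 - e1 * sqrt 2) - 2 * s * a * (q0 - q1 * sqrt 2)"
      "v 3 = 2 * d * (e0 - e1 * sqrt 2) + 2 * s * a * (q0 - q1 * sqrt 2)"
    and form: "e \<ge> 0" "g \<ge> 0" "e * g = c\<^sup>2" "R\<^sup>2 + J\<^sup>2 = (1 + c)\<^sup>2"
      "v 0 = (a * s) * ((e + g)\<^sup>2 - 4 * (R - 1)\<^sup>2)"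
      "v 2 = (a * s) * ((e + g)\<^sup>2 - 4 * (R + 1)\<^sup>2)"
      "v 1 = (a * s) * ((e - g)\<^sup>2 + 4 * (J + 1)\<^sup>2)"
      "v 3 = (a * s) * ((e - g)\<^sup>2 + 4 * (J - 1)\<^sup>2)"
    and unit: "\<bar>(a\<^sup>2 * (q0\<^sup>2 + 2 * q1\<^sup>2) - d * (e0\<^sup>2 + 2 * e1\<^sup>2))\<^sup>2 - 2 * (2 * a\<^sup>2 * q0 * q1 - 2 * d * e0 * e1)\<^sup>2\<bar> = 1"
  shows "a\<^sup>2 = 1"
proof -
  have as: "a * s > 0"
    using a s by simp
  define A B where "A = a\<^sup>2 * (q0\<^sup>2 + 2 * q1\<^sup>2) - d * (e0\<^sup>2 + 2 * e1\<^sup>2)" and "B = 2 * a\<^sup>2 * q0 * q1 - 2 * d * e0 * e1"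
  define V0 V1 V2 V3 where "V0 = (e + g)\<^sup>2 - 4 * (R - 1)\<^sup>2" and "V1 = (e - g)\<^sup>2 + 4 * (J + 1)\<^sup>2"
    and "V2 = (e + g)\<^sup>2 - 4 * (R + 1)\<^sup>2" and "V3 = (e - g)\<^sup>2 + 4 * (J - 1)\<^sup>2"
  have va: "v 0 = (a * s) * V0" "v 1 = (a * s) * V1" "v 2 = (a * s) * V2" "v 3 = (a * s) * V3"
    using form by (simp_all add: V0_def V1_def V2_def V3_def)
  \<comment> \<open>This combination isolates \<open>q0\<close>, and the two relations among
    \<open>e\<close>, \<open>g\<close>, \<open>c\<close>, \<open>R\<close>, \<open>J\<close> make it
    linear in \<open>c\<close>. The differences V0 - V2 and V1 - V3 isolate \<open>R\<close> and
    \<open>J\<close> in the same manner.\<close>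
  have "(a * s) * (V0 + V2 - V1 - V3) = v 0 + v 2 - v 1 - v 3"
    unfolding va by (simp add: algebra_simps)
  also have "\<dots> = (a * s) * (- 8 * q0)"
    unfolding v by (simp add: algebra_simps)
  finally have "V0 + V2 - V1 - V3 = - 8 * q0"
    using as by (simp only: mult_cancel_left) auto
  moreover have "V0 + V2 - V1 - V3 = - 16 * c - 24"
  proof -
    have "V0 + V2 - V1 - V3 = 8 * (e * g) - 8 * (R\<^sup>2 + J\<^sup>2) - 16"
      unfolding V0_def V1_def V2_def V3_def by Groebner_Basis.algebra
    then show ?thesis
      unfolding form(3,4) by (simp add: power2_eq_square algebra_simps)
  qed
  ultimately have c: "2 * c = q0 - 3"
    by simp
  have "(a * s) * (16 * R) = (a * s) * (V0 - V2)"
    unfolding V0_def V2_def by Groebner_Basis.algebra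
  also have "\<dots> = v 0 - v 2"
    unfolding va by (simp add: algebra_simps)
  also have "\<dots> = 4 * sqrt 2 * (d * e1 - s * a * q1)"
    unfolding v by (simp add: algebra_simps)
  also have "\<dots> = s * (4 * sqrt 2 * (s * e1 - a * q1))"
    using s(2) by (auto simp: algebra_simps power2_eq_square)
  finally have "s * (16 * a * R) = s * (4 * sqrt 2 * (s * e1 - a * q1))"
    by (simp only: mult_ac)
  then have "16 * a * R = 4 * sqrt 2 * (s * e1 - a * q1)"
    using s(1) by (simp only: mult_cancel_left) auto
  then have R: "4 * a * R = sqrt 2 * (s * e1 - a * q1)"
    by linarith
  have "(a * s) * (16 * J) = (a * s) * (V1 - V3)"
    unfolding V1_def V3_def by Groebner_Basis.algebra
  also have "\<dots> = v 1 - v 3"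
    unfolding va by (simp add: algebra_simps)
  also have "\<dots> = 4 * sqrt 2 * (d * e1 + s * a * q1)"
    unfolding v by (simp add: algebra_simps)
  also have "\<dots> = s * (4 * sqrt 2 * (s * e1 + a * q1))"
    using s(2) by (auto simp: algebra_simps power2_eq_square)
  finally have "s * (16 * a * J) = s * (4 * sqrt 2 * (s * e1 + a * q1))"
    by (simp only: mult_ac)
  then have "16 * a * J = 4 * sqrt 2 * (s * e1 + a * q1)"
    using s(1) by (simp only: mult_cancel_left) auto
  then have J: "4 * a * J = sqrt 2 * (s * e1 + a * q1)"
    by linarith
  have quarter: "4 * (R\<^sup>2 + J\<^sup>2) = (q0 - 1)\<^sup>2"
  proof -
    have "2 * (1 + c) = of_int (q0 - 1)"
      using c by simp
    then have "(2 * (1 + c))\<^sup>2 = of_int ((q0 - 1)\<^sup>2)"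
      by (simp only: of_int_power)
    then show ?thesis
      unfolding form(4) by (simp add: power2_eq_square algebra_simps)
  qed
  \<comment> \<open>In R^2 + J^2 the mixed terms s a e1 q1 cancel, so an equation between integers
    remains.\<close>
  have "4 * (s\<^sup>2 * e1\<^sup>2 + a\<^sup>2 * q1\<^sup>2) = (4 * a * R)\<^sup>2 + (4 * a * J)\<^sup>2"
    unfolding R J by (simp add: power2_eq_square algebra_simps)
  also have "\<dots> = 4 * a\<^sup>2 * (4 * (R\<^sup>2 + J\<^sup>2))"
    by (simp add: power2_eq_square algebra_simps)
  finally have "4 * (s\<^sup>2 * e1\<^sup>2 + a\<^sup>2 * q1\<^sup>2) = 4 * a\<^sup>2 * (q0 - 1)\<^sup>2"
    unfolding quarter by simp
  then have "of_int (d * e1\<^sup>2 + a\<^sup>2 * q1\<^sup>2) = (of_int (a\<^sup>2 * (q0 - 1)\<^sup>2) :: real)"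
    unfolding s(2) by simp
  then have rel: "d * e1\<^sup>2 + a\<^sup>2 * q1\<^sup>2 = a\<^sup>2 * (q0 - 1)\<^sup>2"
    by (simp only: of_int_eq_iff)
  then have "d * e1\<^sup>2 = a\<^sup>2 * ((q0 - 1)\<^sup>2 - q1\<^sup>2)"
    by Groebner_Basis.algebra
  then have "a\<^sup>2 dvd d * e1\<^sup>2"
    by (rule dvdI)
  then have "a dvd e1"
    by (rule squarefree_square_dvd[OF d(2)]) (use a in simp)
  then obtain f where f: "e1 = a * f" ..
  have "even f"
    using even(2) a(2) f by simp
  have "a\<^sup>2 * (d * f\<^sup>2 + q1\<^sup>2) = a\<^sup>2 * (q0 - 1)\<^sup>2"
    using rel unfolding f by Groebner_Basis.algebra
  then have rel: "d * f\<^sup>2 + q1\<^sup>2 = (q0 - 1)\<^sup>2"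
    using a by simp
  have "odd A"
  proof
    assume "even A"
    then have "even (A\<^sup>2 - 2 * B\<^sup>2)"
      by simp
    then have "even \<bar>A\<^sup>2 - 2 * B\<^sup>2\<bar>"
      by simp
    then show False
      using unit unfolding A_def B_def by simp
  qed
  then have "odd q0"
    using even a by (auto simp: A_def)
  have "even q1"
  proof -
    have "even (d * f\<^sup>2 + q1\<^sup>2)"
      unfolding rel using \<open>odd q0\<close> by simp
    then show ?thesis
      using \<open>even f\<close> by simp
  qed
  then obtain r where r: "q1 = 2 * r" ..
  obtain f' where f': "f = 2 * f'"
    using \<open>even f\<close> ..
  obtain e0' where e0': "e0 = 2 * e0'"
    using even(1) ..
  \<comment> \<open>Since \<open>e0\<close>, \<open>e1\<close> and \<open>q1\<close> are even,
    \<open>A\<close> is an odd square modulo 4 and 4 divides \<open>B\<close>; so the unit is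
    totally positive, which fixes the signs of v 0 v 1 and v 2 v 3.\<close>
  have "A = (a * q0)\<^sup>2 + 4 * (2 * a\<^sup>2 * r\<^sup>2 - d * (e0'\<^sup>2 + 2 * (a * f')\<^sup>2))"
    unfolding A_def f r f' e0' by Groebner_Basis.algebra
  moreover have "(a * q0)\<^sup>2 mod 4 = 1"
    using a \<open>odd q0\<close> by (simp only: square_mod_4_int) simp
  ultimately have "A mod 4 = 1"
    by (metis mod_mult_self2)
  moreover have "4 dvd B"
    unfolding B_def f r f' e0' by (intro dvd_diff) simp_all
  moreover have "\<bar>A\<^sup>2 - 2 * B\<^sup>2\<bar> = 1"
    using unit unfolding A_def B_def .
  ultimately have "A > 0" "A\<^sup>2 - 2 * B\<^sup>2 = 1"
    using norm_sqrt2_pos by blast+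
  have uu: "(A + B * sqrt 2) * (A - B * sqrt 2) = 1"
  proof -
    have "(A + B * sqrt 2) * (A - B * sqrt 2) = of_int (A\<^sup>2 - 2 * B\<^sup>2)"
      by (simp add: power2_eq_square algebra_simps)
    then show ?thesis
      using \<open>A\<^sup>2 - 2 * B\<^sup>2 = 1\<close> by simp
  qed
  have "(A + B * sqrt 2) + (A - B * sqrt 2) > 0"
    using \<open>A > 0\<close> by simp
  then have "A + B * sqrt 2 > 0 \<and> A - B * sqrt 2 > 0"
    using uu by (smt (verit) mult_less_0_iff mult_nonneg_nonpos mult_nonneg_nonpos2 zero_less_mult_iff)
  moreover have "v 0 * v 1 = - (4 * d * (A + B * sqrt 2))"
    unfolding v A_def B_def of_int_diff of_int_mult of_int_add of_int_power of_int_numeral s(2)[symmetric]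
    by (simp add: power2_eq_square algebra_simps)
  moreover have "v 2 * v 3 = - (4 * d * (A - B * sqrt 2))"
    unfolding v A_def B_def of_int_diff of_int_mult of_int_add of_int_power of_int_numeral s(2)[symmetric]
    by (simp add: power2_eq_square algebra_simps)
  ultimately have neg: "v 0 * v 1 < 0" "v 2 * v 3 < 0"
    using d(1) by simp_all
  \<comment> \<open>V1 and V3 are sums of squares, so in the negative products it is V0 and V2 that
    are negative.\<close>
  have "V1 \<ge> 0" "V3 \<ge> 0"
    by (simp_all add: V1_def V3_def)
  then have "v 1 \<ge> 0" "v 3 \<ge> 0"
    using as va by simp_all
  then have "v 0 < 0" "v 2 < 0"
    using neg by (simp_all add: mult_less_0_iff)
  then have "V0 < 0" "V2 < 0"
    unfolding va mult_less_0_iff[of "a * s"] using as order_less_asym by blast+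
  then have "\<bar>c\<bar> < 1"
    using abs_less_one_of_negative_forms[OF form(1-4)] by (simp add: V0_def V2_def)
  \<comment> \<open>As \<open>q0\<close> is odd, 2c = q0 - 3 makes \<open>c\<close> an integer, and
    |c| < 1 leaves c = 0, that is q0 = 3.\<close>
  moreover obtain k where k: "q0 = 2 * k + 1"
    using \<open>odd q0\<close> ..
  moreover have "c = of_int (k - 1)"
    using c k by simp
  ultimately have "k = 1"
    by auto
  then have "q0 = 3"
    using k by simp
  have "d * f'\<^sup>2 + r\<^sup>2 = 1"
    using rel unfolding \<open>q0 = 3\<close> f' r by simp
  have "f' = 0"
  proof (rule ccontr)
    assume "f' \<noteq> 0"
    then have "f'\<^sup>2 \<ge> 1"
      by (smt (verit) zero_less_power2)
    then have "d * f'\<^sup>2 \<ge> 2 * 1"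
      using d(1) by (intro mult_mono) auto
    then show False
      using \<open>d * f'\<^sup>2 + r\<^sup>2 = 1\<close> by (smt (verit) zero_le_power2)
  qed
  then have "r\<^sup>2 = 1" "e1 = 0"
    using \<open>d * f'\<^sup>2 + r\<^sup>2 = 1\<close> f f' by simp_all
  \<comment> \<open>The constants come from (3 + 2 r sqrt 2)^2 = 17 + 12 r sqrt 2 with r^2 = 1; the
    norm equation then collapses because 17^2 - 288 = 1.\<close>
  have "A = 17 * a\<^sup>2 - d * e0\<^sup>2"
    unfolding A_def \<open>q0 = 3\<close> r using \<open>r\<^sup>2 = 1\<close> \<open>e1 = 0\<close> by (simp add: power_mult_distrib)
  moreover have "B\<^sup>2 = 144 * a ^ 4"
    unfolding B_def \<open>q0 = 3\<close> r \<open>e1 = 0\<close> using \<open>r\<^sup>2 = 1\<close> by Groebner_Basis.algebra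
  ultimately have "(17 * a\<^sup>2 - d * e0\<^sup>2)\<^sup>2 - 288 * a ^ 4 = 1"
    using \<open>A\<^sup>2 - 2 * B\<^sup>2 = 1\<close> by simp
  then have "a ^ 4 - 34 * a\<^sup>2 * (d * e0\<^sup>2) + (d * e0\<^sup>2)\<^sup>2 = 1"
    by Groebner_Basis.algebra
  moreover have "4 dvd d * e0\<^sup>2"
    unfolding e0' by simp
  ultimately show ?thesis
    using a(2) by (intro quadratic_in_square_eq_one)
qed

section \<open>Integer polynomial functions at primitive eighth roots of unity\<close>

definition int_poly_fun :: "(complex \<Rightarrow> complex) \<Rightarrow> bool" where
  "int_poly_fun F \<longleftrightarrow> (\<exists>p :: int poly. \<forall>z. F z = poly (map_poly of_int p) z)"

named_theorems int_poly_fun_intros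

lemma int_poly_fun_const [int_poly_fun_intros]: "int_poly_fun (\<lambda>z. of_int c)"
  unfolding int_poly_fun_def by (rule exI[of _ "[:c:]"]) (simp add: of_int_hom.map_poly_pCons_hom)

lemma int_poly_fun_numeral [int_poly_fun_intros]:
  "int_poly_fun (\<lambda>z. 1)" "int_poly_fun (\<lambda>z. numeral n)"
  using int_poly_fun_const[of 1] int_poly_fun_const[of "numeral n"] by simp_all

lemma int_poly_fun_id [int_poly_fun_intros]: "int_poly_fun (\<lambda>z. z)"
  unfolding int_poly_fun_def by (rule exI[of _ "[:0, 1:]"]) (simp add: of_int_hom.map_poly_pCons_hom)

lemma int_poly_fun_add [int_poly_fun_intros]:
  "int_poly_fun F \<Longrightarrow> int_poly_fun G \<Longrightarrow> int_poly_fun (\<lambda>z. F z + G z)"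
  unfolding int_poly_fun_def by (metis of_int_poly_hom.hom_add poly_add)

lemma int_poly_fun_mult [int_poly_fun_intros]:
  "int_poly_fun F \<Longrightarrow> int_poly_fun G \<Longrightarrow> int_poly_fun (\<lambda>z. F z * G z)"
  unfolding int_poly_fun_def by (metis of_int_poly_hom.hom_mult poly_mult)

lemma int_poly_fun_uminus [int_poly_fun_intros]:
  "int_poly_fun F \<Longrightarrow> int_poly_fun (\<lambda>z. - F z)"
  unfolding int_poly_fun_def by (metis of_int_poly_hom.hom_uminus poly_minus)

lemma int_poly_fun_diff [int_poly_fun_intros]:
  "int_poly_fun F \<Longrightarrow> int_poly_fun G \<Longrightarrow> int_poly_fun (\<lambda>z. F z - G z)"
  unfolding int_poly_fun_def by (metis of_int_poly_hom.hom_minus poly_diff)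

lemma int_poly_fun_power [int_poly_fun_intros]:
  "int_poly_fun F \<Longrightarrow> int_poly_fun (\<lambda>z. F z ^ n)"
  by (induction n) (auto intro: int_poly_fun_intros)

text \<open>Reduction modulo z^4 + 1. The same four integers serve every primitive eighth root,
  which permits the comparison of the values at z and -z.\<close>

lemma int_poly_fun_primitive_eighth_root:
  assumes "int_poly_fun F"
  shows "\<exists>p q r s :: int. \<forall>z. z ^ 4 = -1 \<longrightarrow> F z = of_int p + of_int q * z + of_int r * z\<^sup>2 + of_int s * z ^ 3"
proof -
  obtain P :: "int poly" where P: "\<And>z. F z = poly (map_poly of_int P) z"
    using assms unfolding int_poly_fun_def by blast
  have "\<exists>p q r s :: int. \<forall>z::complex. z ^ 4 = -1 \<longrightarrow>
      poly (map_poly of_int P) z = of_int p + of_int q * z + of_int r * z\<^sup>2 + of_int s * z ^ 3"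
  proof (induction P)
    case 0
    show ?case
      by (intro exI[of _ 0]) simp
  next
    case (pCons c P)
    then obtain p q r s :: int where *: "\<And>z::complex. z ^ 4 = -1 \<Longrightarrow>
        poly (map_poly of_int P) z = of_int p + of_int q * z + of_int r * z\<^sup>2 + of_int s * z ^ 3"
      by blast
    have "poly (map_poly of_int (pCons c P)) z = of_int (c - s) + of_int p * z + of_int q * z\<^sup>2 + of_int r * z ^ 3"
      if "z ^ 4 = -1" for z :: complex
    proof -
      have "poly (map_poly of_int (pCons c P)) z = of_int c + z * (of_int p + of_int q * z + of_int r * z\<^sup>2 + of_int s * z ^ 3)"
        by (simp add: of_int_hom.map_poly_pCons_hom *[OF that])
      then show ?thesis
        using that unfolding of_int_diff by Groebner_Basis.algebra
    qed
    then show ?case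
      by blast
  qed
  then show ?thesis
    by (simp add: P)
qed

lemma rotation_product_expand:
  "rotation_product z0 z1 z2 z3 = (z0\<^sup>2 - z2\<^sup>2)\<^sup>2 - (z1\<^sup>2 - z3\<^sup>2)\<^sup>2 - 4 * (z1 * z3) * (z0\<^sup>2 + z2\<^sup>2)
    + 4 * (z0 * z2) * (z1\<^sup>2 + z3\<^sup>2)"
  unfolding rotation_product_def using i_squared by Groebner_Basis.algebra

lemma rotation_product_scale:
  "rotation_product (c * z0) (c * z1) (c * z2) (c * z3) = c ^ 4 * rotation_product z0 z1 z2 z3"
  unfolding rotation_product_expand by Groebner_Basis.algebra

text \<open>
  Splits the product into the parts of weight 0 and 4 modulo 8, where \<open>n\<^sub>j\<close> has weight \<open>j\<close>:
  the second product is the first one with \<open>n\<^sub>j\<close> replaced by \<open>z\<^sup>j n\<^sub>j\<close>.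
\<close>

lemma rotation_product_parts:
  fixes z n1 n2 n3 n4 n5 n6 n7 :: complex
  assumes z: "z ^ 4 = -1"
  defines "p2 \<equiv> n2\<^sup>2 + n6\<^sup>2" and "q2 \<equiv> 2 * (n2 * n6)"
    and "g2 \<equiv> n1\<^sup>2 + n5\<^sup>2 - 2 * (n3 * n7)" and "g6 \<equiv> 2 * (n1 * n5) - n3\<^sup>2 - n7\<^sup>2"
    and "k2 \<equiv> n1\<^sup>2 + n5\<^sup>2 + 2 * (n3 * n7)" and "k6 \<equiv> 2 * (n1 * n5) + n3\<^sup>2 + n7\<^sup>2"
    and "h4 \<equiv> n1 * n3 + n5 * n7" and "h0 \<equiv> n1 * n7 + n3 * n5"
  defines "E \<equiv> (n4\<^sup>2 - q2)\<^sup>2 + p2\<^sup>2 - 2 * (g2 * g6) - 4 * (h0 * (n4\<^sup>2 + q2) + h4 * p2) + 4 * (n4 * n2 * k2 + n4 * n6 * k6)"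
    and "Q \<equiv> - 2 * (p2 * (n4\<^sup>2 - q2)) - (g2\<^sup>2 + g6\<^sup>2) - 4 * (h4 * (n4\<^sup>2 + q2) + h0 * p2) + 4 * (n4 * n2 * k6 + n4 * n6 * k2)"
  shows "rotation_product n4 (n1 + n5) (n2 + n6) (n3 + n7) = E + Q"
    and "rotation_product (- n4) (z * (n1 - n5)) (z\<^sup>2 * (n2 - n6)) (z ^ 3 * (n3 - n7)) = E - Q"
proof -
  have "(n2 + n6)\<^sup>2 = p2 + q2" "(n1 + n5)\<^sup>2 - (n3 + n7)\<^sup>2 = g2 + g6" "(n1 + n5)\<^sup>2 + (n3 + n7)\<^sup>2 = k2 + k6"
    "(n1 + n5) * (n3 + n7) = h0 + h4"
    unfolding p2_def q2_def g2_def g6_def k2_def k6_def h0_def h4_def by Groebner_Basis.algebra+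
  then have "rotation_product n4 (n1 + n5) (n2 + n6) (n3 + n7)
      = (n4\<^sup>2 - (p2 + q2))\<^sup>2 - (g2 + g6)\<^sup>2 - 4 * (h0 + h4) * (n4\<^sup>2 + (p2 + q2)) + 4 * (n4 * (n2 + n6)) * (k2 + k6)"
    unfolding rotation_product_expand by simp
  also have "\<dots> = E + Q"
    unfolding E_def Q_def by Groebner_Basis.algebra
  finally show "rotation_product n4 (n1 + n5) (n2 + n6) (n3 + n7) = E + Q" .
  have "(z\<^sup>2 * (n2 - n6))\<^sup>2 = q2 - p2" "(z * (n1 - n5))\<^sup>2 - (z ^ 3 * (n3 - n7))\<^sup>2 = z\<^sup>2 * (g2 - g6)"
    "(z * (n1 - n5))\<^sup>2 + (z ^ 3 * (n3 - n7))\<^sup>2 = z\<^sup>2 * (k2 - k6)"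
    "(z * (n1 - n5)) * (z ^ 3 * (n3 - n7)) = h0 - h4"
    unfolding p2_def q2_def g2_def g6_def k2_def k6_def h0_def h4_def using z by Groebner_Basis.algebra+
  then have "rotation_product (- n4) (z * (n1 - n5)) (z\<^sup>2 * (n2 - n6)) (z ^ 3 * (n3 - n7))
      = ((- n4)\<^sup>2 - (q2 - p2))\<^sup>2 - (z\<^sup>2 * (g2 - g6))\<^sup>2 - 4 * (h0 - h4) * ((- n4)\<^sup>2 + (q2 - p2))
        + 4 * (- n4 * (z\<^sup>2 * (n2 - n6))) * (z\<^sup>2 * (k2 - k6))"
    unfolding rotation_product_expand by simp
  also have "\<dots> = E - Q"
    unfolding E_def Q_def using z by Groebner_Basis.algebra
  finally show "rotation_product (- n4) (z * (n1 - n5)) (z\<^sup>2 * (n2 - n6)) (z ^ 3 * (n3 - n7)) = E - Q" .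
qed

section \<open>Octic radicals\<close>

definition radicand :: "(nat \<Rightarrow> int) \<Rightarrow> int" where
  "radicand a = (\<Prod>i=1..7. a i ^ i)"

definition rad_den :: "(nat \<Rightarrow> int) \<Rightarrow> nat \<Rightarrow> int" where
  "rad_den a j = (\<Prod>i=1..7. a i ^ (i * j div 8))"

text \<open>With exponents reduced modulo 8 this is the integer w_j^8; see
  \<open>rad_power8\<close>.\<close>

definition rad_res :: "(nat \<Rightarrow> int) \<Rightarrow> nat \<Rightarrow> int" where
  "rad_res a j = (\<Prod>i=1..7. a i ^ (i * j mod 8))"

text \<open>The structure constant in the product of w_j and w_k: a factor a_i appears exactly when
  adding the residues of i j and i k modulo 8 produces a carry.\<close>

definition rad_carry :: "(nat \<Rightarrow> int) \<Rightarrow> nat \<Rightarrow> nat \<Rightarrow> int" where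
  "rad_carry a j k = (\<Prod>i=1..7. a i ^ ((i * j mod 8 + i * k mod 8) div 8))"

definition rad :: "(nat \<Rightarrow> int) \<Rightarrow> complex \<Rightarrow> nat \<Rightarrow> complex" where
  "rad a \<alpha> j = \<alpha> ^ j / of_int (rad_den a j)"

lemma prod_atLeast1_atMost7: "(\<Prod>i=1..(7::nat). f i) = f 1 * f 2 * f 3 * f 4 * f 5 * f 6 * f 7"
  by (simp add: eval_nat_numeral atLeastAtMostSuc_conv mult_ac)

locale octic_radical =
  fixes a :: "nat \<Rightarrow> int" and \<alpha> :: complex
  assumes a_nz: "i \<in> {1..7} \<Longrightarrow> a i \<noteq> 0"
    and root: "\<alpha> ^ 8 = of_int (radicand a)"
begin

lemma rad_den_nz: "rad_den a j \<noteq> 0"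
  using a_nz by (auto simp: rad_den_def)

text \<open>For n = 8q + r the floor of i n / 8 is i q plus the floor of i r / 8, so
  \<open>rad_den\<close> absorbs the q-th power of the radicand. Indices can thus be reduced modulo
  8 after multiplying.\<close>

lemma power_eq_rad: "\<alpha> ^ n = of_int (rad_den a n) * rad a \<alpha> (n mod 8)"
proof -
  have n: "n = 8 * (n div 8) + n mod 8"
    by simp
  have "rad_den a n = (\<Prod>i=1..7. a i ^ (i * (n div 8)) * a i ^ (i * (n mod 8) div 8))"
    unfolding rad_den_def
  proof (intro prod.cong refl)
    fix i
    have "i * n = 8 * (i * (n div 8)) + i * (n mod 8)"
      by (metis n distrib_left mult.left_commute)
    then have "i * n div 8 = i * (n div 8) + i * (n mod 8) div 8"
      by simp
    then show "a i ^ (i * n div 8) = a i ^ (i * (n div 8)) * a i ^ (i * (n mod 8) div 8)"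
      by (simp add: power_add)
  qed
  also have "\<dots> = radicand a ^ (n div 8) * rad_den a (n mod 8)"
    by (simp add: prod.distrib radicand_def rad_den_def prod_power_distrib power_mult)
  finally have den: "rad_den a n = radicand a ^ (n div 8) * rad_den a (n mod 8)" .
  have "\<alpha> ^ n = (\<alpha> ^ 8) ^ (n div 8) * \<alpha> ^ (n mod 8)"
    by (metis n power_add power_mult)
  then show ?thesis
    using rad_den_nz by (simp add: root den rad_def)
qed

lemma rad_mult: "rad a \<alpha> j * rad a \<alpha> k = of_int (rad_carry a j k) * rad a \<alpha> ((j + k) mod 8)"
proof -
  have "rad_den a (j + k) = (\<Prod>i=1..7. a i ^ (i * j div 8) * a i ^ (i * k div 8) * a i ^ ((i * j mod 8 + i * k mod 8) div 8))"
    unfolding rad_den_def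
  proof (intro prod.cong refl)
    fix i
    have "i * (j + k) div 8 = i * j div 8 + i * k div 8 + (i * j mod 8 + i * k mod 8) div 8"
      unfolding distrib_left by (rule div_add1_eq)
    then show "a i ^ (i * (j + k) div 8)
        = a i ^ (i * j div 8) * a i ^ (i * k div 8) * a i ^ ((i * j mod 8 + i * k mod 8) div 8)"
      by (simp only: power_add)
  qed
  then have den: "rad_den a (j + k) = rad_den a j * rad_den a k * rad_carry a j k"
    by (simp add: prod.distrib rad_den_def rad_carry_def)
  have "rad a \<alpha> j * rad a \<alpha> k * of_int (rad_den a j * rad_den a k) = \<alpha> ^ (j + k)"
    using rad_den_nz by (simp add: rad_def power_add)
  also have "\<dots> = of_int (rad_carry a j k) * rad a \<alpha> ((j + k) mod 8) * of_int (rad_den a j * rad_den a k)"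
    by (subst power_eq_rad) (simp add: den)
  finally show ?thesis
    using rad_den_nz by (subst (asm) mult_cancel_right) simp
qed

lemma rad_power8: "rad a \<alpha> j ^ 8 = of_int (rad_res a j)"
proof -
  have "radicand a ^ j = (\<Prod>i=1..7. (a i ^ (i * j div 8)) ^ 8 * a i ^ (i * j mod 8))"
    unfolding radicand_def prod_power_distrib
  proof (intro prod.cong refl)
    fix i
    have "i * j = (i * j div 8) * 8 + i * j mod 8"
      by simp
    then show "(a i ^ i) ^ j = (a i ^ (i * j div 8)) ^ 8 * a i ^ (i * j mod 8)"
      by (metis power_add power_mult)
  qed
  then have *: "radicand a ^ j = rad_den a j ^ 8 * rad_res a j"
    by (simp add: prod.distrib rad_den_def rad_res_def prod_power_distrib)
  have "rad a \<alpha> j ^ 8 = of_int (radicand a ^ j) / of_int (rad_den a j ^ 8)"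
  proof -
    have "(\<alpha> ^ j) ^ 8 = of_int (radicand a) ^ j"
      by (metis root power_mult mult.commute)
    then show ?thesis
      by (simp add: rad_def power_divide)
  qed
  then show ?thesis
    using rad_den_nz by (simp add: *)
qed

lemma algebraic_int_rad: "algebraic_int (rad a \<alpha> j)"
  by (rule algebraic_int_of_power[of _ 8]) (simp_all add: rad_power8)

abbreviation w :: "nat \<Rightarrow> complex" where "w \<equiv> rad a \<alpha>"
abbreviation A :: "nat \<Rightarrow> complex" where "A i \<equiv> of_int (a i)"

lemma w_0: "w 0 = 1"
  by (simp add: rad_def rad_den_def)

text \<open>This and the next three lemmas form the multiplication table of the w_j needed below,
  sorted by the index of the product modulo 8.\<close>

lemma w_2_eqs:
  "w 1 * w 1 = A 4 * A 5 * A 6 * A 7 * w 2"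
  "w 5 * w 5 = A 1 * A 3 * A 4 * A 6 * w 2"
  "w 3 * w 7 = A 1 * A 2 * A 4 * A 5 * w 2"
  unfolding rad_mult rad_carry_def prod_atLeast1_atMost7 by (simp_all del: One_nat_def)

lemma w_6_eqs:
  "w 1 * w 5 = A 3 * A 4 * A 6 * A 7 * w 6"
  "w 3 * w 3 = A 2 * A 4 * A 5 * A 7 * w 6"
  "w 7 * w 7 = A 1 * A 2 * A 3 * A 4 * w 6"
  unfolding rad_mult rad_carry_def prod_atLeast1_atMost7 by (simp_all del: One_nat_def)

lemma w_4_eqs:
  "w 1 * w 3 = A 2 * A 4 * A 5 * A 6 * A 7 * w 4"
  "w 5 * w 7 = A 1 * A 2 * A 3 * A 4 * A 6 * w 4"
  "w 2 * w 2 = A 2 * A 3 * A 6 * A 7 * w 4"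
  "w 6 * w 6 = A 1 * A 2 * A 5 * A 6 * w 4"
  unfolding rad_mult rad_carry_def prod_atLeast1_atMost7 by (simp_all del: One_nat_def)

lemma w_0_eqs:
  "w 1 * w 7 = A 1 * A 2 * A 3 * A 4 * A 5 * A 6 * A 7"
  "w 3 * w 5 = A 1 * A 2 * A 3 * A 4 * A 5 * A 6 * A 7"
  "w 2 * w 6 = A 1 * A 2 * A 3 * A 5 * A 6 * A 7"
  "w 4 * w 4 = A 1 * A 3 * A 5 * A 7"
  unfolding rad_mult rad_carry_def prod_atLeast1_atMost7 by (simp_all add: w_0 del: One_nat_def)

end

text \<open>For an eighth root of unity \<open>t\<close>, the conjugate of the sum of all x_j w_j
  obtained by replacing \<alpha> with t \<alpha>.\<close>

definition octic_conj :: "(nat \<Rightarrow> int) \<Rightarrow> (nat \<Rightarrow> int) \<Rightarrow> complex \<Rightarrow> complex \<Rightarrow> complex" where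
  "octic_conj a x \<alpha> t = (\<Sum>j<8. of_int (x j) * rad a \<alpha> j * t ^ j)"

text \<open>With \<theta>_k = f (z^k) and z^4 = -1, the product of \<theta>_k - \<theta>_(k+1) over
  even k; the primed version takes odd k, with \<theta>_8 = \<theta>_0.\<close>

definition conj_product :: "(complex \<Rightarrow> complex) \<Rightarrow> complex \<Rightarrow> complex" where
  "conj_product f z = (f 1 - f z) * (f (z\<^sup>2) - f (z\<^sup>2 * z)) * (f (-1) - f (- z)) * (f (- z\<^sup>2) - f (- z\<^sup>2 * z))"

definition conj_product' :: "(complex \<Rightarrow> complex) \<Rightarrow> complex \<Rightarrow> complex" where
  "conj_product' f z = (f z - f (z\<^sup>2)) * (f (z\<^sup>2 * z) - f (-1)) * (f (- z) - f (- z\<^sup>2)) * (f (- z\<^sup>2 * z) - f 1)"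

lemma sum_lessThan8: "(\<Sum>j<8. f j) = f 0 + f 1 + f 2 + f 3 + f 4 + f 5 + f 6 + f (7::nat)"
  by (simp add: eval_nat_numeral)

lemma rotation_product_eighth_root:
  assumes "z ^ 4 = -1"
  shows "rotation_product z0 z1 z2 z3 =
    (z0 + z1 + z2 + z3) * (z0 + z\<^sup>2 * z1 - z2 - z\<^sup>2 * z3) * (z0 - z1 + z2 - z3) * (z0 - z\<^sup>2 * z1 - z2 + z\<^sup>2 * z3)"
  unfolding rotation_product_expand using assms by Groebner_Basis.algebra

text \<open>Because u^4 = 1, coefficients whose indices agree modulo 4 merge, so running over the
  fourth roots \<open>u\<close> produces a rotation product.\<close>

lemma eighth_root_sum_diff:
  fixes u z y0 y1 y2 y3 y4 y5 y6 y7 :: complex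
  assumes "u ^ 4 = 1" "z ^ 4 = -1"
  defines "f \<equiv> \<lambda>t. y0 + y1 * t + y2 * t\<^sup>2 + y3 * t ^ 3 + y4 * t ^ 4 + y5 * t ^ 5 + y6 * t ^ 6 + y7 * t ^ 7"
  shows "f u - f (u * z) = 2 * y4 + u * (y1 * (1 - z) + y5 * (1 + z)) + u\<^sup>2 * (y2 * (1 - z\<^sup>2) + y6 * (1 + z\<^sup>2))
      + u ^ 3 * (y3 * (1 - z ^ 3) + y7 * (1 + z ^ 3))"
    and "f (u * z) - f (u * z\<^sup>2) = - 2 * y4 + u * (y1 * (1 - z) * z - y5 * (1 + z) * z)
      + u\<^sup>2 * (y2 * (1 - z\<^sup>2) * z\<^sup>2 - y6 * (1 + z\<^sup>2) * z\<^sup>2) + u ^ 3 * (y3 * (1 - z ^ 3) * z ^ 3 - y7 * (1 + z ^ 3) * z ^ 3)"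
  unfolding f_def using assms(1,2) by Groebner_Basis.algebra+

lemma conj_product_eq:
  fixes z y0 y1 y2 y3 y4 y5 y6 y7 :: complex
  assumes z: "z ^ 4 = -1"
    and f: "\<And>t. f t = y0 + y1 * t + y2 * t\<^sup>2 + y3 * t ^ 3 + y4 * t ^ 4 + y5 * t ^ 5 + y6 * t ^ 6 + y7 * t ^ 7"
  shows "conj_product f z = rotation_product (2 * y4) (y1 * (1 - z) + y5 * (1 + z))
      (y2 * (1 - z\<^sup>2) + y6 * (1 + z\<^sup>2)) (y3 * (1 - z ^ 3) + y7 * (1 + z ^ 3))"
    and "conj_product' f z = rotation_product (- 2 * y4) (y1 * (1 - z) * z - y5 * (1 + z) * z)
      (y2 * (1 - z\<^sup>2) * z\<^sup>2 - y6 * (1 + z\<^sup>2) * z\<^sup>2) (y3 * (1 - z ^ 3) * z ^ 3 - y7 * (1 + z ^ 3) * z ^ 3)"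
proof -
  note d = eighth_root_sum_diff[OF _ z, of _ y0 y1 y2 y3 y4 y5 y6 y7, folded f]
  have z68: "z ^ 6 = - z\<^sup>2" "z ^ 8 = 1"
    using z by Groebner_Basis.algebra+
  let ?z1 = "y1 * (1 - z) + y5 * (1 + z)" and ?z2 = "y2 * (1 - z\<^sup>2) + y6 * (1 + z\<^sup>2)"
    and ?z3 = "y3 * (1 - z ^ 3) + y7 * (1 + z ^ 3)"
  have "f 1 - f z = 2 * y4 + ?z1 + ?z2 + ?z3"
    "f (z\<^sup>2) - f (z\<^sup>2 * z) = 2 * y4 + z\<^sup>2 * ?z1 - ?z2 - z\<^sup>2 * ?z3"
    "f (-1) - f (- z) = 2 * y4 - ?z1 + ?z2 - ?z3"
    "f (- z\<^sup>2) - f (- z\<^sup>2 * z) = 2 * y4 - z\<^sup>2 * ?z1 - ?z2 + z\<^sup>2 * ?z3"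
    using d(1)[of 1] d(1)[of "z\<^sup>2"] d(1)[of "-1"] d(1)[of "- z\<^sup>2"] by (simp_all add: z z68)
  then show "conj_product f z = rotation_product (2 * y4) ?z1 ?z2 ?z3"
    unfolding conj_product_def rotation_product_eighth_root[OF z] by (simp only:)
  let ?z1 = "y1 * (1 - z) * z - y5 * (1 + z) * z" and ?z2 = "y2 * (1 - z\<^sup>2) * z\<^sup>2 - y6 * (1 + z\<^sup>2) * z\<^sup>2"
    and ?z3 = "y3 * (1 - z ^ 3) * z ^ 3 - y7 * (1 + z ^ 3) * z ^ 3"
  have "f z - f (z\<^sup>2) = - 2 * y4 + ?z1 + ?z2 + ?z3"
    "f (z\<^sup>2 * z) - f (-1) = - 2 * y4 + z\<^sup>2 * ?z1 - ?z2 - z\<^sup>2 * ?z3"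
    "f (- z) - f (- z\<^sup>2) = - 2 * y4 - ?z1 + ?z2 - ?z3"
    "f (- z\<^sup>2 * z) - f 1 = - 2 * y4 - z\<^sup>2 * ?z1 - ?z2 + z\<^sup>2 * ?z3"
    using d(2)[of 1] d(2)[of "z\<^sup>2"] d(2)[of "-1"] d(2)[of "- z\<^sup>2"] by (simp_all add: z z68)
  then show "conj_product' f z = rotation_product (- 2 * y4) ?z1 ?z2 ?z3"
    unfolding conj_product'_def rotation_product_eighth_root[OF z] by (simp only:)
qed

text \<open>Total ramification of 2 in \<int>[z]: the cofactor of 2 is a unit, with its inverse
  given in \<open>conj_product_unit_inverse\<close>.\<close>

lemma one_minus_power4: "z ^ 4 = -1 \<Longrightarrow> (1 - z) ^ 4 = 2 * (- 2 * z + 3 * z\<^sup>2 - 2 * z ^ 3)" for z :: complex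
  by Groebner_Basis.algebra

context octic_radical
begin

abbreviation d :: int where "d \<equiv> a 1 * a 3 * a 5 * a 7"
abbreviation b :: int where "b \<equiv> a 2 * a 6"

text \<open>All four differences contain 1 - z, which accounts for 2 times a unit. In what remains
  the multiplication table makes the weight 0 part a multiple of 2d and the weight 4 part a multiple
  of b w_4. The second product has the opposite weight 4 part, so sum and difference separate the
  two.\<close>

lemma conj_product_parts:
  "\<exists>E Q. int_poly_fun E \<and> int_poly_fun Q \<and> (\<forall>z. z ^ 4 = -1 \<longrightarrow>
     conj_product (octic_conj a x \<alpha>) z + conj_product' (octic_conj a x \<alpha>) z
       = 8 * of_int d * ((- 2 * z + 3 * z\<^sup>2 - 2 * z ^ 3) * E z) \<and>
     conj_product' (octic_conj a x \<alpha>) z - conj_product (octic_conj a x \<alpha>) z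
       = - 4 * of_int b * w 4 * ((- 2 * z + 3 * z\<^sup>2 - 2 * z ^ 3) * Q z))"
proof -
  define xc where "xc j = (of_int (x j) :: complex)" for j
  \<comment> \<open>By z^4 = -1 these are the quotients of 1 - z^3, 1 + z = 1 - z^5 and 1 + z^3 = 1
    - z^7 by 1 - z.\<close>
  define c3 c5 c7 :: "complex \<Rightarrow> complex" where "c3 = (\<lambda>z. 1 + z + z\<^sup>2)" and "c5 = (\<lambda>z. z * (1 + z + z\<^sup>2))" and "c7 = (\<lambda>z. z ^ 3)"
  define P where "P = A 3 * A 7 * xc 2 ^ 2 - A 1 * A 5 * xc 6 ^ 2"
  define G2 where "G2 = (\<lambda>z. A 4 * A 5 * A 6 * A 7 * xc 1 ^ 2 + c5 z ^ 2 * (A 1 * A 3 * A 4 * A 6 * xc 5 ^ 2)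
      - 2 * (c3 z * c7 z * (A 1 * A 2 * A 4 * A 5 * xc 3 * xc 7)))"
  define G6 where "G6 = (\<lambda>z. 2 * (c5 z * (A 3 * A 4 * A 6 * A 7 * xc 1 * xc 5)) - c3 z ^ 2 * (A 2 * A 4 * A 5 * A 7 * xc 3 ^ 2)
      - c7 z ^ 2 * (A 1 * A 2 * A 3 * A 4 * xc 7 ^ 2))"
  define K2 where "K2 = (\<lambda>z. A 4 * A 5 * A 6 * A 7 * xc 1 ^ 2 + c5 z ^ 2 * (A 1 * A 3 * A 4 * A 6 * xc 5 ^ 2)
      + 2 * (c3 z * c7 z * (A 1 * A 2 * A 4 * A 5 * xc 3 * xc 7)))"
  define K6 where "K6 = (\<lambda>z. 2 * (c5 z * (A 3 * A 4 * A 6 * A 7 * xc 1 * xc 5)) + c3 z ^ 2 * (A 2 * A 4 * A 5 * A 7 * xc 3 ^ 2)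
      + c7 z ^ 2 * (A 1 * A 2 * A 3 * A 4 * xc 7 ^ 2))"
  define H4 where "H4 = (\<lambda>z. c3 z * (A 4 * A 5 * A 7 * xc 1 * xc 3) + c5 z * c7 z * (A 1 * A 3 * A 4 * xc 5 * xc 7))"
  define H0 where "H0 = (\<lambda>z. A 4 * (c7 z * (xc 1 * xc 7) + c3 z * c5 z * (xc 3 * xc 5)))"
  define SM SP where "SM = xc 4 ^ 2 - A 2 * A 6 * xc 2 * xc 6" and "SP = xc 4 ^ 2 + A 2 * A 6 * xc 2 * xc 6"
  define dc bc where "dc = (of_int d :: complex)" and "bc = (of_int b :: complex)"
  \<comment> \<open>Here p^2 = 2r and t^2 = 2 z^2; these squares help to supply the factor 2 that is
    split off from the weight 0 part.\<close>
  define r where "r = (\<lambda>z::complex. 2 * z + 3 * z\<^sup>2 + 2 * z ^ 3)"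
  define p where "p = (\<lambda>z::complex. (1 + z)\<^sup>2)"
  define t where "t = (\<lambda>z::complex. 1 + z\<^sup>2)"
  define E where "E = (\<lambda>z. - 4 * r z * dc * SM\<^sup>2 + r z * bc\<^sup>2 * P\<^sup>2 - bc * G2 z * G6 z
     - 2 * (2 * bc * H0 z * p z * z\<^sup>2 * dc * SP + bc\<^sup>2 * p z * H4 z * P)
     + 2 * p z * t z * xc 4 * bc * (xc 2 * A 3 * A 7 * K2 z + z\<^sup>2 * xc 6 * A 1 * A 5 * K6 z))"
  define Q where "Q = (\<lambda>z. - 8 * r z * z\<^sup>2 * dc * P * SM - (A 3 * A 7 * G2 z ^ 2 + A 1 * A 5 * G6 z ^ 2)
     - 4 * (2 * p z * z\<^sup>2 * dc * H4 z * SP + dc * bc * H0 z * p z * P)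
     + 4 * p z * t z * dc * xc 4 * (xc 2 * K6 z + z\<^sup>2 * xc 6 * K2 z))"
  have "int_poly_fun E" "int_poly_fun Q"
    unfolding E_def Q_def r_def p_def t_def G2_def G6_def K2_def K6_def H4_def H0_def c3_def c5_def c7_def P_def SM_def SP_def xc_def
      dc_def bc_def
    by (intro int_poly_fun_intros)+
  moreover have "conj_product (octic_conj a x \<alpha>) z + conj_product' (octic_conj a x \<alpha>) z
       = 8 * of_int d * ((- 2 * z + 3 * z\<^sup>2 - 2 * z ^ 3) * E z) \<and>
     conj_product' (octic_conj a x \<alpha>) z - conj_product (octic_conj a x \<alpha>) z
       = - 4 * of_int b * w 4 * ((- 2 * z + 3 * z\<^sup>2 - 2 * z ^ 3) * Q z)" if z: "z ^ 4 = -1" for z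
  proof -
    \<comment> \<open>Chosen so that x_j w_j (1 - z^j) = (1 - z) n_j for every j; for j = 4 this
      uses 1 - z^4 = 2.\<close>
    define n1 n2 n3 n4 n5 n6 n7 where n_defs: "n1 = xc 1 * w 1" "n2 = (1 + z) * xc 2 * w 2" "n3 = c3 z * xc 3 * w 3"
      "n4 = (1 + z) * t z * xc 4 * w 4" "n5 = c5 z * xc 5 * w 5" "n6 = (1 + z) * z\<^sup>2 * xc 6 * w 6" "n7 = c7 z * xc 7 * w 7"
    have dcb: "dc = A 1 * A 3 * A 5 * A 7" "bc = A 2 * A 6"
      by (simp_all add: dc_def bc_def)
    have w: "w 2 * w 2 = bc * A 3 * A 7 * w 4" "w 6 * w 6 = bc * A 1 * A 5 * w 4" "w 2 * w 6 = dc * bc" "w 4 * w 4 = dc"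
      using w_4_eqs w_0_eqs by (simp_all add: dcb mult_ac)
    have z4: "t z ^ 2 = 2 * z\<^sup>2" "p z ^ 2 = 2 * r z"
      unfolding t_def p_def r_def by (Groebner_Basis.algebra add: z)+
    have p2: "n2\<^sup>2 + n6\<^sup>2 = p z * bc * w 4 * P"
    proof -
      have "n2\<^sup>2 + n6\<^sup>2 = p z * (xc 2 ^ 2 * (w 2 * w 2) - xc 6 ^ 2 * (w 6 * w 6))"
        unfolding n_defs p_def using z by Groebner_Basis.algebra
      then show ?thesis
        unfolding w P_def by Groebner_Basis.algebra
    qed
    have q2: "2 * (n2 * n6) = 2 * p z * z\<^sup>2 * xc 2 * xc 6 * dc * bc"
    proof -
      have "2 * (n2 * n6) = 2 * p z * z\<^sup>2 * xc 2 * xc 6 * (w 2 * w 6)"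
        unfolding n_defs p_def by Groebner_Basis.algebra
      then show ?thesis
        unfolding w by (simp only: mult.assoc)
    qed
    have n44: "n4\<^sup>2 = 2 * p z * z\<^sup>2 * xc 4 ^ 2 * dc"
    proof -
      have "n4\<^sup>2 = p z * t z ^ 2 * xc 4 ^ 2 * (w 4 * w 4)"
        unfolding n_defs p_def by Groebner_Basis.algebra
      then show ?thesis
        unfolding w z4 by Groebner_Basis.algebra
    qed
    have minus: "n4\<^sup>2 - 2 * (n2 * n6) = 2 * p z * z\<^sup>2 * dc * SM"
      unfolding q2 n44 SM_def dcb(2) by Groebner_Basis.algebra
    have plus: "n4\<^sup>2 + 2 * (n2 * n6) = 2 * p z * z\<^sup>2 * dc * SP"
      unfolding q2 n44 SP_def dcb(2) by Groebner_Basis.algebra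
    have pr: "n1\<^sup>2 = xc 1 ^ 2 * (w 1 * w 1)" "n5\<^sup>2 = c5 z ^ 2 * xc 5 ^ 2 * (w 5 * w 5)" "n3 * n7 = c3 z * c7 z * xc 3 * xc 7 * (w 3 * w 7)"
      "n1 * n5 = c5 z * xc 1 * xc 5 * (w 1 * w 5)" "n3\<^sup>2 = c3 z ^ 2 * xc 3 ^ 2 * (w 3 * w 3)" "n7\<^sup>2 = c7 z ^ 2 * xc 7 ^ 2 * (w 7 * w 7)"
      "n1 * n3 = c3 z * xc 1 * xc 3 * (w 1 * w 3)" "n5 * n7 = c5 z * c7 z * xc 5 * xc 7 * (w 5 * w 7)"
      "n1 * n7 = c7 z * xc 1 * xc 7 * (w 1 * w 7)" "n3 * n5 = c3 z * c5 z * xc 3 * xc 5 * (w 3 * w 5)"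
      unfolding n_defs by Groebner_Basis.algebra+
    have g2: "n1\<^sup>2 + n5\<^sup>2 - 2 * (n3 * n7) = G2 z * w 2"
      unfolding pr w_2_eqs G2_def by Groebner_Basis.algebra
    have k2: "n1\<^sup>2 + n5\<^sup>2 + 2 * (n3 * n7) = K2 z * w 2"
      unfolding pr w_2_eqs K2_def by Groebner_Basis.algebra
    have g6: "2 * (n1 * n5) - n3\<^sup>2 - n7\<^sup>2 = G6 z * w 6"
      unfolding pr w_6_eqs G6_def by Groebner_Basis.algebra
    have k6: "2 * (n1 * n5) + n3\<^sup>2 + n7\<^sup>2 = K6 z * w 6"
      unfolding pr w_6_eqs K6_def by Groebner_Basis.algebra
    have h4: "n1 * n3 + n5 * n7 = bc * w 4 * H4 z"
      unfolding pr w_4_eqs H4_def dcb by Groebner_Basis.algebra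
    have h0: "n1 * n7 + n3 * n5 = dc * bc * H0 z"
      unfolding pr w_0_eqs H0_def dcb by Groebner_Basis.algebra
    have n42: "n4 * n2 = p z * t z * xc 4 * xc 2 * (w 4 * w 2)" "n4 * n6 = p z * t z * z\<^sup>2 * xc 4 * xc 6 * (w 4 * w 6)"
      unfolding n_defs p_def by Groebner_Basis.algebra+
    have wEQ: "(w 4 * w 2) * w 2 = dc * bc * A 3 * A 7" "(w 4 * w 6) * w 6 = dc * bc * A 1 * A 5"
      "(w 4 * w 2) * w 6 = dc * bc * w 4" "(w 4 * w 6) * w 2 = dc * bc * w 4" "w 2 ^ 2 = bc * A 3 * A 7 * w 4" "w 6 ^ 2 = bc * A 1 * A 5 * w 4"
    proof -
      show "(w 4 * w 2) * w 2 = dc * bc * A 3 * A 7"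
        using w(1,4) by Groebner_Basis.algebra
      show "(w 4 * w 6) * w 6 = dc * bc * A 1 * A 5"
        using w(2,4) by Groebner_Basis.algebra
      show "(w 4 * w 2) * w 6 = dc * bc * w 4" "(w 4 * w 6) * w 2 = dc * bc * w 4"
        by (simp_all add: w(3)[symmetric])
      show "w 2 ^ 2 = bc * A 3 * A 7 * w 4" "w 6 ^ 2 = bc * A 1 * A 5 * w 4"
        by (simp_all only: power2_eq_square w)
    qed
    have Ez: "(2 * p z * z\<^sup>2 * dc * SM)\<^sup>2 + (p z * bc * w 4 * P)\<^sup>2 - 2 * (G2 z * w 2 * (G6 z * w 6))
        - 4 * (dc * bc * H0 z * (2 * p z * z\<^sup>2 * dc * SP) + bc * w 4 * H4 z * (p z * bc * w 4 * P))
        + 4 * (n4 * n2 * (K2 z * w 2) + n4 * n6 * (K6 z * w 6)) = 2 * dc * E z"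
    proof -
      have "(2 * p z * z\<^sup>2 * dc * SM)\<^sup>2 + (p z * bc * w 4 * P)\<^sup>2 - 2 * (G2 z * w 2 * (G6 z * w 6))
        - 4 * (dc * bc * H0 z * (2 * p z * z\<^sup>2 * dc * SP) + bc * w 4 * H4 z * (p z * bc * w 4 * P))
        + 4 * (n4 * n2 * (K2 z * w 2) + n4 * n6 * (K6 z * w 6))
        = p z ^ 2 * (4 * z ^ 4 * (dc * SM)\<^sup>2 + (w 4 * w 4) * (bc * P)\<^sup>2) - 2 * (G2 z * G6 z * (w 2 * w 6))
        - 4 * (dc * bc * H0 z * (2 * p z * z\<^sup>2 * dc * SP) + (w 4 * w 4) * bc * H4 z * (p z * bc * P))
        + 4 * p z * t z * (xc 4 * xc 2 * K2 z * ((w 4 * w 2) * w 2) + z\<^sup>2 * xc 4 * xc 6 * K6 z * ((w 4 * w 6) * w 6))"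
        unfolding n42 by Groebner_Basis.algebra
      also have "\<dots> = 2 * dc * E z"
        unfolding wEQ w z4 z E_def by Groebner_Basis.algebra
      finally show ?thesis .
    qed
    have Qz: "- 2 * (p z * bc * w 4 * P * (2 * p z * z\<^sup>2 * dc * SM)) - ((G2 z * w 2)\<^sup>2 + (G6 z * w 6)\<^sup>2)
        - 4 * (bc * w 4 * H4 z * (2 * p z * z\<^sup>2 * dc * SP) + dc * bc * H0 z * (p z * bc * w 4 * P))
        + 4 * (n4 * n2 * (K6 z * w 6) + n4 * n6 * (K2 z * w 2)) = bc * w 4 * Q z"
    proof -
      have "- 2 * (p z * bc * w 4 * P * (2 * p z * z\<^sup>2 * dc * SM)) - ((G2 z * w 2)\<^sup>2 + (G6 z * w 6)\<^sup>2)
        - 4 * (bc * w 4 * H4 z * (2 * p z * z\<^sup>2 * dc * SP) + dc * bc * H0 z * (p z * bc * w 4 * P))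
        + 4 * (n4 * n2 * (K6 z * w 6) + n4 * n6 * (K2 z * w 2))
        = - 4 * p z ^ 2 * z\<^sup>2 * bc * w 4 * P * dc * SM - (G2 z ^ 2 * w 2 ^ 2 + G6 z ^ 2 * w 6 ^ 2)
        - 4 * (bc * w 4 * H4 z * (2 * p z * z\<^sup>2 * dc * SP) + dc * bc * H0 z * (p z * bc * w 4 * P))
        + 4 * p z * t z * (xc 4 * xc 2 * K6 z * ((w 4 * w 2) * w 6) + z\<^sup>2 * xc 4 * xc 6 * K2 z * ((w 4 * w 6) * w 2))"
        unfolding n42 by Groebner_Basis.algebra
      also have "\<dots> = bc * w 4 * Q z"
        unfolding wEQ w z4 Q_def by Groebner_Basis.algebra
      finally show ?thesis .
    qed
    have f: "octic_conj a x \<alpha> u = xc 0 * w 0 + xc 1 * w 1 * u + xc 2 * w 2 * u\<^sup>2 + xc 3 * w 3 * u ^ 3 + xc 4 * w 4 * u ^ 4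
        + xc 5 * w 5 * u ^ 5 + xc 6 * w 6 * u ^ 6 + xc 7 * w 7 * u ^ 7" for u
      by (simp add: octic_conj_def sum_lessThan8 xc_def)
    note parts = rotation_product_parts[OF z, where ?n1.0 = n1 and ?n2.0 = n2 and ?n3.0 = n3 and ?n4.0 = n4 and ?n5.0 = n5
        and ?n6.0 = n6 and ?n7.0 = n7, unfolded minus plus p2 g2 g6 k2 k6 h4 h0 Ez Qz]
    have F: "xc 1 * w 1 * (1 - z) = (1 - z) * n1" "xc 2 * w 2 * (1 - z\<^sup>2) = (1 - z) * n2"
      "xc 3 * w 3 * (1 - z ^ 3) = (1 - z) * n3" "2 * (xc 4 * w 4) = (1 - z) * n4" "xc 5 * w 5 * (1 + z) = (1 - z) * n5"
      "xc 6 * w 6 * (1 + z\<^sup>2) = (1 - z) * n6" "xc 7 * w 7 * (1 + z ^ 3) = (1 - z) * n7"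
      unfolding n_defs c3_def c5_def c7_def t_def by (Groebner_Basis.algebra add: z)+
    have v: "conj_product (octic_conj a x \<alpha>) z = (1 - z) ^ 4 * (2 * dc * E z + bc * w 4 * Q z)"
    proof -
      have "conj_product (octic_conj a x \<alpha>) z
          = rotation_product ((1 - z) * n4) ((1 - z) * (n1 + n5)) ((1 - z) * (n2 + n6)) ((1 - z) * (n3 + n7))"
        unfolding conj_product_eq(1)[OF z f] F by (simp only: distrib_left)
      then show ?thesis
        unfolding rotation_product_scale parts(1) .
    qed
    have v': "conj_product' (octic_conj a x \<alpha>) z = (1 - z) ^ 4 * (2 * dc * E z - bc * w 4 * Q z)"
    proof -
      have "conj_product' (octic_conj a x \<alpha>) z
          = rotation_product ((1 - z) * (- n4)) ((1 - z) * (z * (n1 - n5))) ((1 - z) * (z\<^sup>2 * (n2 - n6))) ((1 - z) * (z ^ 3 * (n3 - n7)))"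
      proof -
        have "- 2 * (xc 4 * w 4) = (1 - z) * (- n4)"
          using F(4) by Groebner_Basis.algebra
        moreover have "(1 - z) * n1 * z - (1 - z) * n5 * z = (1 - z) * (z * (n1 - n5))"
          "(1 - z) * n2 * z\<^sup>2 - (1 - z) * n6 * z\<^sup>2 = (1 - z) * (z\<^sup>2 * (n2 - n6))"
          "(1 - z) * n3 * z ^ 3 - (1 - z) * n7 * z ^ 3 = (1 - z) * (z ^ 3 * (n3 - n7))"
          by (simp_all add: right_diff_distrib left_diff_distrib mult_ac)
        ultimately show ?thesis
          unfolding conj_product_eq(2)[OF z f] F by (simp only:)
      qed
      then show ?thesis
        unfolding rotation_product_scale parts(2) .
    qed
    show ?thesis
      unfolding v v' one_minus_power4[OF z] dc_def[symmetric] bc_def[symmetric] by (simp only: algebra_simps) simp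
  qed
  ultimately show ?thesis
    by blast
qed

end

section \<open>Divisibility of conjugate differences\<close>

text \<open>The integers h for which u h is integral form an ideal of \<int>. Contained in no prime
  ideal, it contains 1.\<close>

lemma algebraic_int_of_coprime_multiples:
  fixes u :: "'a::field_char_0"
  assumes "\<And>h. h \<in> S \<Longrightarrow> algebraic_int (u * of_int h)"
    and "\<And>p :: int. prime p \<Longrightarrow> \<exists>h\<in>S. \<not> p dvd h"
  shows "algebraic_int u"
proof -
  define J where "J = {h. algebraic_int (u * of_int h)}"
  have add: "g + h \<in> J" if "g \<in> J" "h \<in> J" for g h
    using that by (auto simp: J_def distrib_left)
  have scale: "k * h \<in> J" if "h \<in> J" for k h
    using that algebraic_int_mult[of "of_int k" "u * of_int h"] by (simp add: J_def mult_ac)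
  \<comment> \<open>Non-divisibility by 2 supplies a nonzero member of the ideal, hence a least
    positive one.\<close>
  obtain h0 where h0: "h0 \<in> S" "\<not> 2 dvd h0"
    using assms(2)[of 2] by auto
  then have "h0 \<noteq> 0"
    by auto
  then have "nat \<bar>h0\<bar> > 0 \<and> int (nat \<bar>h0\<bar>) \<in> J"
  proof -
    have "h0 \<in> J"
      using assms(1)[OF h0(1)] by (simp add: J_def)
    then have "\<bar>h0\<bar> \<in> J"
      using scale[of h0 "sgn h0"] by (simp add: abs_sgn mult.commute)
    then show ?thesis
      using \<open>h0 \<noteq> 0\<close> by simp
  qed
  define g where "g = (LEAST n. n > 0 \<and> int n \<in> J)"
  have g: "g > 0" "int g \<in> J"
    using LeastI[of "\<lambda>n. n > 0 \<and> int n \<in> J", OF \<open>nat \<bar>h0\<bar> > 0 \<and> int (nat \<bar>h0\<bar>) \<in> J\<close>] by (simp_all add: g_def)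
  have g_dvd: "int g dvd h" if "h \<in> J" for h
  proof -
    have "h mod int g = h + (- (h div int g)) * int g"
      by (simp add: minus_div_mult_eq_mod[symmetric])
    then have mem: "h mod int g \<in> J"
      using add[OF that scale[OF g(2)]] by metis
    have "h mod int g < int g" "h mod int g \<ge> 0"
      using g(1) by simp_all
    then have "\<not> (nat (h mod int g) > 0 \<and> int (nat (h mod int g)) \<in> J)"
      unfolding g_def by (intro not_less_Least) (simp add: g_def nat_less_iff)
    then have "h mod int g = 0"
      using mem \<open>h mod int g \<ge> 0\<close> by simp
    then show ?thesis
      by auto
  qed
  have "g = 1"
  proof (rule ccontr)
    assume "g \<noteq> 1"
    then obtain p where p: "prime p" "p dvd g"
      using prime_factor_nat by blast
    then obtain h where "h \<in> S" "\<not> int p dvd h"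
      using assms(2)[of "int p"] by auto
    moreover have "int g dvd h"
      using g_dvd assms(1) \<open>h \<in> S\<close> by (simp add: J_def)
    moreover have "int p dvd int g"
      using p(2) by simp
    ultimately show False
      using dvd_trans by blast
  qed
  then show ?thesis
    using g(2) by (simp add: J_def)
qed

lemma algebraic_int_eighth_root:
  assumes "t ^ 8 = 1"
  shows "algebraic_int (t :: complex)"
  by (rule algebraic_int_of_power[of _ 8]) (simp_all add: assms)

lemma conj_product_unit_inverse: "y ^ 4 = -1 \<Longrightarrow> (- 2 * y + 3 * y\<^sup>2 - 2 * y ^ 3) * (- 2 * y - 3 * y\<^sup>2 - 2 * y ^ 3) = 1" for y :: complex
  by Groebner_Basis.algebra

text \<open>\<open>conj_dvd\<close> is the form in which monogenicity is used: every difference of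
  conjugates of the generator, with coordinates \<open>x\<close>, divides the corresponding
  difference for each w_j.\<close>

locale octic_index = octic_radical +
  fixes x :: "nat \<Rightarrow> int"
  assumes conj_dvd: "\<And>t u j. t ^ 8 = 1 \<Longrightarrow> u ^ 8 = 1 \<Longrightarrow> j < 8 \<Longrightarrow>
      \<exists>g. algebraic_int g \<and> rad a \<alpha> j * (t ^ j - u ^ j) = g * (octic_conj a x \<alpha> t - octic_conj a x \<alpha> u)"
    and coprime_a: "\<And>i j. i \<in> {1..7} \<Longrightarrow> j \<in> {1..7} \<Longrightarrow> i \<noteq> j \<Longrightarrow> coprime (a i) (a j)"
    and squarefree_a: "\<And>i. i \<in> {1..7} \<Longrightarrow> squarefree (a i)"
    and odd_a: "odd (a 2)" "odd (a 4)" "odd (a 6)"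
    and d_mod_4: "(a 1 * a 3 * a 5 * a 7) mod 4 \<noteq> 1 \<or> a 1 * a 3 * a 5 * a 7 > 0"
begin

abbreviation f :: "complex \<Rightarrow> complex" where "f \<equiv> octic_conj a x \<alpha>"

lemma prime_dvd_unique:
  assumes "prime p" "p dvd a i" "i \<in> {1..7}" "j \<in> {1..7}" "i \<noteq> j"
  shows "\<not> p dvd a j"
  using assms coprime_a[of i j] by (meson coprime_common_divisor not_prime_unit)

lemma w4_square: "w 4 * w 4 = of_int d"
  using w_0_eqs(4) by simp

lemma b_nz: "b \<noteq> 0" and d_nz: "d \<noteq> 0"
  using a_nz by simp_all

lemma w4_nz: "w 4 \<noteq> 0"
  using w4_square d_nz by (metis mult_zero_left of_int_eq_0_iff)

text \<open>
  The exponents \<open>i * j mod 8\<close> show that each prime dividing some \<open>a\<^sub>i\<close> is prime to one of the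
  quotients below.
\<close>

lemma rad_res_eqs:
  "rad_res a 1 = d * (a 2 ^ 2 * a 3 ^ 2 * a 4 ^ 4 * a 5 ^ 4 * a 6 ^ 6 * a 7 ^ 6)"
  "rad_res a 3 = d * (a 1 ^ 2 * a 2 ^ 6 * a 4 ^ 4 * a 5 ^ 6 * a 6 ^ 2 * a 7 ^ 4)"
  "rad_res a 5 = d * (a 1 ^ 4 * a 2 ^ 2 * a 3 ^ 6 * a 4 ^ 4 * a 6 ^ 6 * a 7 ^ 2)"
  "rad_res a 7 = d * (a 1 ^ 6 * a 2 ^ 6 * a 3 ^ 4 * a 4 ^ 4 * a 5 ^ 2 * a 6 ^ 2)"
proof -
  have res: "rad_res a j = a 1 ^ (j mod 8) * a 2 ^ (2 * j mod 8) * a 3 ^ (3 * j mod 8) * a 4 ^ (4 * j mod 8)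
      * a 5 ^ (5 * j mod 8) * a 6 ^ (6 * j mod 8) * a 7 ^ (7 * j mod 8)" for j
    unfolding rad_res_def prod_atLeast1_atMost7 by simp
  have "rad_res a 1 = a 1 * a 2 ^ 2 * a 3 ^ 3 * a 4 ^ 4 * a 5 ^ 5 * a 6 ^ 6 * a 7 ^ 7"
    "rad_res a 3 = a 1 ^ 3 * a 2 ^ 6 * a 3 * a 4 ^ 4 * a 5 ^ 7 * a 6 ^ 2 * a 7 ^ 5"
    "rad_res a 5 = a 1 ^ 5 * a 2 ^ 2 * a 3 ^ 7 * a 4 ^ 4 * a 5 * a 6 ^ 6 * a 7 ^ 3"
    "rad_res a 7 = a 1 ^ 7 * a 2 ^ 6 * a 3 ^ 5 * a 4 ^ 4 * a 5 ^ 3 * a 6 ^ 2 * a 7"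
    by (simp_all add: res)
  then show "rad_res a 1 = d * (a 2 ^ 2 * a 3 ^ 2 * a 4 ^ 4 * a 5 ^ 4 * a 6 ^ 6 * a 7 ^ 6)"
    "rad_res a 3 = d * (a 1 ^ 2 * a 2 ^ 6 * a 4 ^ 4 * a 5 ^ 6 * a 6 ^ 2 * a 7 ^ 4)"
    "rad_res a 5 = d * (a 1 ^ 4 * a 2 ^ 2 * a 3 ^ 6 * a 4 ^ 4 * a 6 ^ 6 * a 7 ^ 2)"
    "rad_res a 7 = d * (a 1 ^ 6 * a 2 ^ 6 * a 3 ^ 4 * a 4 ^ 4 * a 5 ^ 2 * a 6 ^ 2)"
    by (simp_all add: eval_nat_numeral)
qed

end

context octic_index
begin

text \<open>Multiplies the divisibilities for the eight neighbouring pairs t, t z. The eight values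
  t have product z^28 = -1, whence the sign.\<close>

lemma conj_products_dvd:
  assumes z: "z ^ 4 = -1" and "j < 8"
  shows "\<exists>g. algebraic_int g \<and> rad a \<alpha> j ^ 8 * (1 - z ^ j) ^ 8 * (-1) ^ j = g * (conj_product f z * conj_product' f z)"
proof -
  define q where "q t g \<longleftrightarrow> algebraic_int g \<and> rad a \<alpha> j * t ^ j * (1 - z ^ j) = g * (f t - f (t * z))" for t g
  have z8: "z ^ 8 = 1"
    using z by Groebner_Basis.algebra
  have z16: "z ^ 16 = 1"
    using z8 by Groebner_Basis.algebra
  have q: "\<exists>g. q t g" if "t ^ 8 = 1" for t
  proof -
    have "(t * z) ^ 8 = 1"
      using that z8 by (simp add: power_mult_distrib)
    then show ?thesis
      unfolding q_def using conj_dvd[OF that _ \<open>j < 8\<close>, of "t * z"]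
      by (simp add: power_mult_distrib right_diff_distrib mult.assoc)
  qed
  have units: "(z\<^sup>2) ^ 8 = 1" "(- (z\<^sup>2)) ^ 8 = 1" "(z\<^sup>2 * z) ^ 8 = 1" "(- (z\<^sup>2) * z) ^ 8 = 1" "(- z) ^ 8 = 1" "(-1 :: complex) ^ 8 = 1"
    using z8 z16 by (simp_all add: power_mult_distrib flip: power_mult)
  obtain g0 g1 g2 g3 g4 g5 g6 g7 where g: "q 1 g0" "q z g1" "q (z\<^sup>2) g2" "q (z\<^sup>2 * z) g3" "q (-1) g4" "q (- z) g5"
      "q (- (z\<^sup>2)) g6" "q (- (z\<^sup>2) * z) g7"
    using q[of 1] q[OF z8] units[THEN q] by auto
  have zz: "z\<^sup>2 * z * z = -1" "- (z\<^sup>2) * z * z = 1" "- z * z = - (z\<^sup>2)" "z * z = z\<^sup>2"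
    using z by Groebner_Basis.algebra+
  have "algebraic_int (g0 * g1 * g2 * g3 * g4 * g5 * g6 * g7)"
    using g unfolding q_def by (intro algebraic_int_mult) simp_all
  moreover have "rad a \<alpha> j ^ 8 * (1 - z ^ j) ^ 8 * (-1) ^ j
      = (g0 * g1 * g2 * g3 * g4 * g5 * g6 * g7) * (conj_product f z * conj_product' f z)"
  proof -
    have "(1 * z * z\<^sup>2 * (z\<^sup>2 * z) * (-1) * (- z) * (- (z\<^sup>2)) * (- (z\<^sup>2) * z)) = -1"
      using z by Groebner_Basis.algebra
    then have signs: "(-1 :: complex) ^ j = 1 ^ j * z ^ j * (z\<^sup>2) ^ j * (z\<^sup>2 * z) ^ j * (-1) ^ j * (- z) ^ j * (- (z\<^sup>2)) ^ j * (- (z\<^sup>2) * z) ^ j"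
      by (simp only: power_mult_distrib[symmetric])
    have collect: "r ^ 8 * s ^ 8 * (p0 * p1 * p2 * p3 * p4 * p5 * p6 * p7) = (r * p0 * s) * (r * p1 * s) * (r * p2 * s)
        * (r * p3 * s) * (r * p4 * s) * (r * p5 * s) * (r * p6 * s) * (r * p7 * s)" for r s p0 p1 p2 p3 p4 p5 p6 p7 :: complex
      by Groebner_Basis.algebra
    have "rad a \<alpha> j ^ 8 * (1 - z ^ j) ^ 8 * (-1) ^ j
      = (rad a \<alpha> j * 1 ^ j * (1 - z ^ j)) * (rad a \<alpha> j * z ^ j * (1 - z ^ j)) * (rad a \<alpha> j * (z\<^sup>2) ^ j * (1 - z ^ j))
      * (rad a \<alpha> j * (z\<^sup>2 * z) ^ j * (1 - z ^ j)) * (rad a \<alpha> j * (-1) ^ j * (1 - z ^ j)) * (rad a \<alpha> j * (- z) ^ j * (1 - z ^ j))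
      * (rad a \<alpha> j * (- (z\<^sup>2)) ^ j * (1 - z ^ j)) * (rad a \<alpha> j * (- (z\<^sup>2) * z) ^ j * (1 - z ^ j))"
      by (subst signs) (rule collect)
    also have "\<dots> = (g0 * g1 * g2 * g3 * g4 * g5 * g6 * g7) * (conj_product f z * conj_product' f z)"
      unfolding g[unfolded q_def, THEN conjunct2] unfolding zz mult_1_left mult_minus1 conj_product_def conj_product'_def
      by (simp only: mult_ac)
    finally show ?thesis .
  qed
  ultimately show ?thesis
    by blast
qed

text \<open>For odd j the previous lemma gives 4 w_j^8 = 4 d h_j, and for j = 4 it gives 256 d^4 = 4
  d (64 d^3). A prime dividing all four h_j divides a_2, a_4 or a_6, so it is odd and prime to d and
  cannot divide 64 d^3.\<close>

lemma conj_products_unit: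
  assumes z: "z ^ 4 = -1"
  shows "conj_product f z * conj_product' f z \<noteq> 0"
    and "algebraic_int (4 * of_int d / (conj_product f z * conj_product' f z))"
proof -
  define V where "V = conj_product f z * conj_product' f z"
  have odd_case: "\<exists>g. algebraic_int g \<and> 4 * of_int (rad_res a j) = g * V" if "odd j" "j < 8" for j
  proof -
    define y where "y = z ^ j"
    have y: "y ^ 4 = -1"
    proof -
      have "y ^ 4 = (z ^ 4) ^ j"
        by (metis y_def power_mult mult.commute)
      then show ?thesis
        using z that by simp
    qed
    obtain g where g: "algebraic_int g" "rad a \<alpha> j ^ 8 * (1 - y) ^ 8 * (-1) ^ j = g * V"
      using conj_products_dvd[OF z \<open>j < 8\<close>] by (auto simp: y_def V_def)
    define e e' where "e = - 2 * y + 3 * y\<^sup>2 - 2 * y ^ 3" and "e' = - 2 * y - 3 * y\<^sup>2 - 2 * y ^ 3"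
    have "algebraic_int y"
      by (rule algebraic_int_eighth_root) (use y in Groebner_Basis.algebra)
    then have e': "algebraic_int e'"
      unfolding e'_def by (intro algebraic_int_diff algebraic_int_mult algebraic_int_power) simp_all
    have "(1 - y) ^ 8 = ((1 - y) ^ 4)\<^sup>2"
      by simp
    then have "(1 - y) ^ 8 = 4 * e\<^sup>2"
      unfolding one_minus_power4[OF y, folded e_def] by (simp only: power_mult_distrib) simp
    then have "g * V = - (4 * e\<^sup>2 * of_int (rad_res a j))"
      using g(2) that by (simp add: rad_power8 mult_ac)
    moreover have "e * e' = 1"
      unfolding e_def e'_def using y by (rule conj_product_unit_inverse)
    ultimately have "4 * of_int (rad_res a j) = (- g * e'\<^sup>2) * V"
      by Groebner_Basis.algebra
    moreover have "algebraic_int (- g * e'\<^sup>2)"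
      using g e' by (intro algebraic_int_mult algebraic_int_power) simp_all
    ultimately show ?thesis
      by blast
  qed
  have four_case: "\<exists>g. algebraic_int g \<and> 256 * of_int d ^ 4 = g * V"
  proof -
    have "w 4 ^ 8 = (w 4 * w 4) ^ 4"
      by Groebner_Basis.algebra
    then show ?thesis
      using conj_products_dvd[OF z, of 4] z unfolding w4_square by (auto simp: V_def mult.commute)
  qed
  show nz: "conj_product f z * conj_product' f z \<noteq> 0"
    using four_case d_nz by (auto simp: V_def)
  then have V: "V \<noteq> 0"
    by (simp add: V_def)
  define u where "u = 4 * of_int d / V"
  define S where "S = {a 2 ^ 2 * a 3 ^ 2 * a 4 ^ 4 * a 5 ^ 4 * a 6 ^ 6 * a 7 ^ 6,
      a 1 ^ 2 * a 2 ^ 6 * a 4 ^ 4 * a 5 ^ 6 * a 6 ^ 2 * a 7 ^ 4,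
      a 1 ^ 4 * a 2 ^ 2 * a 3 ^ 6 * a 4 ^ 4 * a 6 ^ 6 * a 7 ^ 2,
      a 1 ^ 6 * a 2 ^ 6 * a 3 ^ 4 * a 4 ^ 4 * a 5 ^ 2 * a 6 ^ 2, 64 * d ^ 3}"
  have "algebraic_int u"
  proof (rule algebraic_int_of_coprime_multiples)
    fix h assume "h \<in> S"
    then consider j where "odd j" "j < 8" "rad_res a j = d * h" | "h = 64 * d ^ 3"
      unfolding S_def using rad_res_eqs by (elim insertE) (auto intro: that(1)[of 1] that(1)[of 3] that(1)[of 5] that(1)[of 7])
    then show "algebraic_int (u * of_int h)"
    proof cases
      case 1
      then obtain g where "algebraic_int g" "4 * of_int (d * h) = g * V"
        using odd_case by metis
      moreover have "u * of_int h * V = 4 * of_int (d * h)"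
        using V unfolding u_def by simp
      ultimately have "u * of_int h = g"
        using V by (metis mult_right_cancel)
      then show ?thesis
        using \<open>algebraic_int g\<close> by simp
    next
      case 2
      obtain g where "algebraic_int g" "256 * of_int d ^ 4 = g * V"
        using four_case by blast
      moreover have "u * of_int h * V = 256 * of_int d ^ 4"
        using V unfolding u_def 2 by (simp add: eval_nat_numeral)
      ultimately have "u * of_int h = g"
        using V by simp
      then show ?thesis
        using \<open>algebraic_int g\<close> by simp
    qed
  next
    fix p :: int assume p: "prime p"
    show "\<exists>h\<in>S. \<not> p dvd h"
    proof (rule ccontr)
      assume "\<not> (\<exists>h\<in>S. \<not> p dvd h)"
      then have all: "\<And>h. h \<in> S \<Longrightarrow> p dvd h"
        by blast
      have "p dvd a 2 \<or> p dvd a 3 \<or> p dvd a 4 \<or> p dvd a 5 \<or> p dvd a 6 \<or> p dvd a 7"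
        using all[of "a 2 ^ 2 * a 3 ^ 2 * a 4 ^ 4 * a 5 ^ 4 * a 6 ^ 6 * a 7 ^ 6"] p
        by (auto simp: S_def prime_dvd_mult_iff prime_dvd_power_iff)
      moreover have "\<not> p dvd a 3"
        using all[of "a 1 ^ 2 * a 2 ^ 6 * a 4 ^ 4 * a 5 ^ 6 * a 6 ^ 2 * a 7 ^ 4"] p prime_dvd_unique[OF p, of 3]
        by (auto simp: S_def prime_dvd_mult_iff prime_dvd_power_iff)
      moreover have "\<not> p dvd a 5"
        using all[of "a 1 ^ 4 * a 2 ^ 2 * a 3 ^ 6 * a 4 ^ 4 * a 6 ^ 6 * a 7 ^ 2"] p prime_dvd_unique[OF p, of 5]
        by (auto simp: S_def prime_dvd_mult_iff prime_dvd_power_iff)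
      moreover have "\<not> p dvd a 7"
        using all[of "a 1 ^ 6 * a 2 ^ 6 * a 3 ^ 4 * a 4 ^ 4 * a 5 ^ 2 * a 6 ^ 2"] p prime_dvd_unique[OF p, of 7]
        by (auto simp: S_def prime_dvd_mult_iff prime_dvd_power_iff)
      ultimately have even_index: "p dvd a 2 \<or> p dvd a 4 \<or> p dvd a 6"
        by blast
      then have "\<not> p dvd a 1" "\<not> p dvd a 3" "\<not> p dvd a 5" "\<not> p dvd a 7"
        using prime_dvd_unique[OF p] by auto
      then have "\<not> p dvd d ^ 3"
        using p by (auto simp: prime_dvd_mult_iff prime_dvd_power_iff)
      moreover have "p dvd 64 * d ^ 3"
        using all by (simp add: S_def)
      ultimately have "p dvd 2 ^ 6"
        using p by (simp add: prime_dvd_mult_iff)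
      then have "p dvd 2"
        using p prime_dvd_power by blast
      then have "p = 2"
        using p primes_dvd_imp_eq[of p 2] by simp
      then show False
        using even_index odd_a by auto
    qed
  qed
  then show "algebraic_int (4 * of_int d / (conj_product f z * conj_product' f z))"
    by (simp add: u_def V_def)
qed

end

section \<open>Imaginary quadratic units and the relative discriminant\<close>

lemma Ints_algebraic_int_of_rat: "algebraic_int (of_int m / of_int n :: complex) \<Longrightarrow> \<exists>k. (of_int m / of_int n :: complex) = of_int k"
  using rational_algebraic_int_is_int[of "of_int m / of_int n :: complex"] by (auto elim: Ints_cases)

lemma unit_of_inverse_algebraic_int:
  assumes "algebraic_int (1 / of_int n :: complex)" "n \<noteq> 0"
  shows "\<bar>n\<bar> = 1"
proof -
  obtain k where "(1 / of_int n :: complex) = of_int k"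
    using Ints_algebraic_int_of_rat[of 1 n] assms(1) by auto
  then have "(of_int (k * n) :: complex) = of_int 1"
    using assms(2) by (simp add: field_simps)
  then have "k * n = 1"
    by (simp only: of_int_eq_iff)
  then have "n dvd 1"
    by (metis dvd_triv_right)
  then show ?thesis
    by simp
qed

text \<open>The norm n0^2 - e n1^2 equals 1, and -e \<ge> 2 leaves no room for a nonzero
  \<open>n1\<close>.\<close>

lemma imaginary_quadratic_unit:
  fixes n0 n1 e :: int and w :: complex
  assumes "w * w = of_int e" "e < -1" and nz: "of_int n0 + of_int n1 * w \<noteq> 0"
    and unit: "algebraic_int (1 / (of_int n0 + of_int n1 * w))"
  shows "n1 = 0 \<and> \<bar>n0\<bar> = 1"
proof -
  define u where "u = of_int n0 + of_int n1 * w"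
  have "cnj w = - w"
  proof -
    have "Re w * Im w = 0" "(Re w)\<^sup>2 - (Im w)\<^sup>2 = e"
      using assms(1) by (auto simp: complex_eq_iff power2_eq_square)
    moreover have "Im w \<noteq> 0"
    proof
      assume "Im w = 0"
      then have "(Re w)\<^sup>2 = e"
        using \<open>(Re w)\<^sup>2 - (Im w)\<^sup>2 = e\<close> by simp
      then show False
        using \<open>e < -1\<close> zero_le_power2[of "Re w"] by linarith
    qed
    ultimately show ?thesis
      by (simp add: complex_eq_iff)
  qed
  then have "u * cnj u = of_int n0 ^ 2 - of_int n1 ^ 2 * (w * w)"
    by (simp add: u_def power2_eq_square algebra_simps)
  then have norm: "u * cnj u = of_int (n0\<^sup>2 - e * n1\<^sup>2)"
    by (simp add: assms(1))
  have "algebraic_int ((1 / u) * cnj (1 / u))"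
    using unit unfolding u_def[symmetric] by (intro algebraic_int_mult algebraic_int_cnj)
  moreover have "(1 / u) * cnj (1 / u) = 1 / (u * cnj u)"
    by simp
  ultimately have "algebraic_int (1 / of_int (n0\<^sup>2 - e * n1\<^sup>2) :: complex)"
    unfolding norm by metis
  moreover have "n0\<^sup>2 - e * n1\<^sup>2 \<noteq> 0"
    using norm nz unfolding u_def[symmetric] by (metis complex_cnj_zero_iff mult_eq_0_iff of_int_0)
  ultimately have "\<bar>n0\<^sup>2 - e * n1\<^sup>2\<bar> = 1"
    by (rule unit_of_inverse_algebraic_int)
  moreover have "n0\<^sup>2 - e * n1\<^sup>2 \<ge> 0"
  proof -
    have "e * n1\<^sup>2 \<le> 0"
      using assms(2) by (intro mult_nonpos_nonneg) simp_all
    then show ?thesis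
      using zero_le_power2[of n0] by linarith
  qed
  ultimately have eq: "n0\<^sup>2 + (- e) * n1\<^sup>2 = 1"
    by simp
  have "n1 = 0"
  proof (rule ccontr)
    assume "n1 \<noteq> 0"
    then have "n1\<^sup>2 \<ge> 1"
      by (smt (verit) zero_less_power2)
    then have "(- e) * n1\<^sup>2 \<ge> 2 * 1"
      using assms(2) by (intro mult_mono) auto
    then show False
      using eq zero_le_power2[of n0] by linarith
  qed
  then show ?thesis
    using eq by (auto simp: power2_eq_1_iff)
qed

text \<open>Irrationality of the square root of a squarefree integer above 1.\<close>

lemma squarefree_mult_square_eq_square:
  fixes e u v :: int
  assumes "squarefree e" "e > 1" "u\<^sup>2 = e * v\<^sup>2"
  shows "v = 0"
proof (rule ccontr)
  assume "v \<noteq> 0"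
  have "v\<^sup>2 dvd u\<^sup>2"
    using assms(3) by simp
  then have "v dvd u"
    by simp
  then obtain q where q: "u = v * q" ..
  have "v\<^sup>2 * q\<^sup>2 = v\<^sup>2 * e"
    using assms(3) unfolding q by Groebner_Basis.algebra
  then have "q\<^sup>2 = e"
    using \<open>v \<noteq> 0\<close> by simp
  then have "q\<^sup>2 dvd e"
    by simp
  then have "is_unit q"
    using assms(1) unfolding squarefree_def by blast
  then have "\<bar>q\<bar> = 1"
    by simp
  then have "\<bar>q\<bar>\<^sup>2 = 1"
    by simp
  then show False
    using \<open>q\<^sup>2 = e\<close> assms(2) by simp
qed

context octic_index
begin

lemma squarefree_d: "squarefree d"
proof -
  have "squarefree (a i * k)" if "squarefree k" "coprime (a i) k" "i \<in> {1..7}" for i k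
    using that squarefree_a by (simp add: squarefree_mult_coprime)
  then show ?thesis
    using squarefree_a[of 1] squarefree_a[of 3] squarefree_a[of 5] squarefree_a[of 7]
      coprime_a[of 1 3] coprime_a[of 1 5] coprime_a[of 1 7] coprime_a[of 3 5] coprime_a[of 3 7] coprime_a[of 5 7]
    by (intro squarefree_mult_coprime) (auto simp: coprime_commute)
qed

text \<open>Uses the opposite pairs 1, -1 and i, -i. For odd j the element w_j changes sign under
  \<alpha> to -\<alpha>, so each pair contributes a factor 2, which explains the denominator
  4.\<close>

lemma odd_rad_pow_dvd:
  assumes "odd j" "j < 8"
  shows "\<exists>g. algebraic_int g \<and> w j ^ 2 = g * ((f 1 - f (-1)) * (f \<i> - f (- \<i>)) / 4)"
proof -
  obtain g g' where g: "algebraic_int g" "w j * (1 ^ j - (-1) ^ j) = g * (f 1 - f (-1))"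
    "algebraic_int g'" "w j * (\<i> ^ j - (- \<i>) ^ j) = g' * (f \<i> - f (- \<i>))"
    using conj_dvd[of 1 "-1" j] conj_dvd[of "\<i>" "-\<i>" j] assms(2) by (auto simp: eval_nat_numeral)
  have "\<i> ^ j * (- \<i>) ^ j = 1"
    by (simp flip: power_mult_distrib)
  then have "w j ^ 2 = (g * g' * (- \<i>) ^ j) * ((f 1 - f (-1)) * (f \<i> - f (- \<i>)) / 4)"
  proof -
    have "2 * w j = g * (f 1 - f (-1))" "2 * w j * \<i> ^ j = g' * (f \<i> - f (- \<i>))"
    proof -
      show "2 * w j = g * (f 1 - f (-1))"
        using g(2) assms(1) by (simp add: mult_ac)
      show "2 * w j * \<i> ^ j = g' * (f \<i> - f (- \<i>))"
        using g(4) assms(1) by (simp add: mult_ac)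
    qed
    moreover have "4 * u\<^sup>2 = (g * g' * q) * (r * s)" if "2 * u = g * r" "2 * u * p = g' * s" "p * q = 1" for u p q r s :: complex
      using that by Groebner_Basis.algebra
    ultimately have "4 * w j ^ 2 = (g * g' * (- \<i>) ^ j) * ((f 1 - f (-1)) * (f \<i> - f (- \<i>)))"
      using \<open>\<i> ^ j * (- \<i>) ^ j = 1\<close> by blast
    then show ?thesis
      by (metis (no_types) nonzero_mult_div_cancel_left times_divide_eq_right zero_neq_numeral)
  qed
  moreover have "algebraic_int (g * g' * (- \<i>) ^ j)"
    using g by (intro algebraic_int_mult algebraic_int_power) simp_all
  ultimately show ?thesis
    by blast
qed

text \<open>The component of the generator that is multiplied by i when \<alpha> becomes i \<alpha>;
  \<open>T2\<close> and \<open>T3\<close> belong to -1 and -i. The substitution fixes w_4, a square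
  root of d.\<close>

definition T1 :: complex where "T1 = of_int (x 1) * w 1 + of_int (x 5) * w 5"
definition T2 :: complex where "T2 = of_int (x 2) * w 2 + of_int (x 6) * w 6"
definition T3 :: complex where "T3 = of_int (x 3) * w 3 + of_int (x 7) * w 7"

lemma f_at_fourth_roots:
  "f 1 = of_int (x 0) + of_int (x 4) * w 4 + T1 + T2 + T3"
  "f (-1) = of_int (x 0) + of_int (x 4) * w 4 - T1 + T2 - T3"
  "f \<i> = of_int (x 0) + of_int (x 4) * w 4 + \<i> * T1 - T2 - \<i> * T3"
  "f (- \<i>) = of_int (x 0) + of_int (x 4) * w 4 - \<i> * T1 - T2 + \<i> * T3"
  by (simp_all add: octic_conj_def sum_lessThan8 T1_def T2_def T3_def w_0 eval_nat_numeral algebra_simps)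

text \<open>The four values are the conjugates of the generator under \<alpha> to i \<alpha>. Two
  opposite and four adjacent pairs make up the six differences of the relative discriminant.\<close>

lemma fourth_root_products:
  "(f 1 - f (-1)) * (f \<i> - f (- \<i>)) / 4 = \<i> * (T1\<^sup>2 - T3\<^sup>2)"
  "(f 1 - f \<i>) * (f (-1) - f (- \<i>)) * (f 1 - f (- \<i>)) * (f \<i> - f (-1))
     = - 4 * ((T1\<^sup>2 - T3\<^sup>2)\<^sup>2 + 4 * (T2\<^sup>2 - T1 * T3)\<^sup>2)"
proof -
  show "(f 1 - f (-1)) * (f \<i> - f (- \<i>)) / 4 = \<i> * (T1\<^sup>2 - T3\<^sup>2)"
    unfolding f_at_fourth_roots by (simp add: power2_eq_square algebra_simps)
  show "(f 1 - f \<i>) * (f (-1) - f (- \<i>)) * (f 1 - f (- \<i>)) * (f \<i> - f (-1))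
     = - 4 * ((T1\<^sup>2 - T3\<^sup>2)\<^sup>2 + 4 * (T2\<^sup>2 - T1 * T3)\<^sup>2)"
    unfolding f_at_fourth_roots using i_squared by Groebner_Basis.algebra
qed

lemma T_forms:
  obtains n0 n1 v0 v1 :: int where
    "(T1\<^sup>2 - T3\<^sup>2)\<^sup>2 = A 4 ^ 2 * of_int b * w 4 * (of_int n0 + of_int n1 * w 4)"
    "T2\<^sup>2 - T1 * T3 = of_int b * w 4 * (of_int v0 + of_int v1 * w 4)"
proof -
  define y where "y j = (of_int (x j) :: complex)" for j
  define g2 g6 where "g2 = a 5 * a 6 * a 7 * x 1 ^ 2 + a 1 * a 3 * a 6 * x 5 ^ 2 - 2 * a 1 * a 2 * a 5 * x 3 * x 7"
    and "g6 = 2 * a 3 * a 6 * a 7 * x 1 * x 5 - a 2 * a 5 * a 7 * x 3 ^ 2 - a 1 * a 2 * a 3 * x 7 ^ 2"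
  have "T1\<^sup>2 - T3\<^sup>2 = y 1 ^ 2 * (w 1 * w 1) + y 5 ^ 2 * (w 5 * w 5) - 2 * y 3 * y 7 * (w 3 * w 7)
      + (2 * y 1 * y 5 * (w 1 * w 5) - y 3 ^ 2 * (w 3 * w 3) - y 7 ^ 2 * (w 7 * w 7))"
    unfolding T1_def T3_def y_def by Groebner_Basis.algebra
  also have "\<dots> = A 4 * (of_int g2 * w 2 + of_int g6 * w 6)"
    unfolding w_2_eqs w_6_eqs g2_def g6_def y_def of_int_diff of_int_add of_int_mult of_int_power of_int_numeral
    by Groebner_Basis.algebra
  finally have W: "T1\<^sup>2 - T3\<^sup>2 = A 4 * (of_int g2 * w 2 + of_int g6 * w 6)" .
  have "(T1\<^sup>2 - T3\<^sup>2)\<^sup>2 = A 4 ^ 2 * (of_int g2 ^ 2 * (w 2 * w 2) + of_int g6 ^ 2 * (w 6 * w 6) + 2 * of_int g2 * of_int g6 * (w 2 * w 6))"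
    unfolding W by Groebner_Basis.algebra
  also have "\<dots> = A 4 ^ 2 * of_int b * w 4 * (of_int (g2 ^ 2 * a 3 * a 7 + g6 ^ 2 * a 1 * a 5) + of_int (2 * g2 * g6) * w 4)"
    unfolding w_4_eqs w_0_eqs(3) of_int_diff of_int_add of_int_mult of_int_power of_int_numeral
    using w_0_eqs(4) by Groebner_Basis.algebra
  finally have 1: "(T1\<^sup>2 - T3\<^sup>2)\<^sup>2 = \<dots>" .
  have "T2\<^sup>2 - T1 * T3 = y 2 ^ 2 * (w 2 * w 2) + y 6 ^ 2 * (w 6 * w 6) + 2 * y 2 * y 6 * (w 2 * w 6)
      - (y 1 * y 3 * (w 1 * w 3) + y 5 * y 7 * (w 5 * w 7) + y 1 * y 7 * (w 1 * w 7) + y 3 * y 5 * (w 3 * w 5))"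
    unfolding T1_def T2_def T3_def y_def by Groebner_Basis.algebra
  also have "\<dots> = of_int b * w 4 * (of_int (a 3 * a 7 * x 2 ^ 2 + a 1 * a 5 * x 6 ^ 2 - a 4 * a 5 * a 7 * x 1 * x 3 - a 1 * a 3 * a 4 * x 5 * x 7)
      + of_int (2 * x 2 * x 6 - a 4 * (x 1 * x 7 + x 3 * x 5)) * w 4)"
    unfolding w_4_eqs w_0_eqs(1-3) y_def of_int_diff of_int_add of_int_mult of_int_power of_int_numeral
    using w_0_eqs(4) by Groebner_Basis.algebra
  finally have 2: "T2\<^sup>2 - T1 * T3 = \<dots>" .
  show ?thesis
    using that 1 2 by blast
qed

end

context octic_index
begin

lemma prime_dvd_only:
  assumes "prime p" "p dvd a i" "i \<in> {1..7}"
  shows "\<forall>j\<in>{1, 2, 3, 4, 5, 6, 7} - {i}. \<not> p dvd a j"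
  using prime_dvd_unique[OF assms] by auto

lemma rad_pow4_dvd:
  assumes "j < 8"
  shows "\<exists>g. algebraic_int g \<and> w j ^ 4 * ((1 - \<i> ^ j) * (1 - (- \<i>) ^ j))\<^sup>2
      = g * ((T1\<^sup>2 - T3\<^sup>2)\<^sup>2 + 4 * (T2\<^sup>2 - T1 * T3)\<^sup>2) * 4"
proof -
  obtain g1 g2 g3 g4 where g: "algebraic_int g1" "w j * (1 ^ j - \<i> ^ j) = g1 * (f 1 - f \<i>)"
    "algebraic_int g2" "w j * ((-1) ^ j - (- \<i>) ^ j) = g2 * (f (-1) - f (- \<i>))"
    "algebraic_int g3" "w j * (1 ^ j - (- \<i>) ^ j) = g3 * (f 1 - f (- \<i>))"
    "algebraic_int g4" "w j * (\<i> ^ j - (-1) ^ j) = g4 * (f \<i> - f (-1))"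
    using conj_dvd[of 1 \<i> j] conj_dvd[of "-1" "- \<i>" j] conj_dvd[of 1 "- \<i>" j] conj_dvd[of \<i> "-1" j] assms
    by (auto simp: eval_nat_numeral)
  define p q s where "p = \<i> ^ j" and "q = (- \<i>) ^ j" and "s = (-1 :: complex) ^ j"
  have "s * p = q" "s * q = p" "s * s = 1"
    by (simp_all add: p_def q_def s_def flip: power_mult_distrib)
  have "w j ^ 4 * ((1 - p) * (1 - q))\<^sup>2 = - ((w j * (1 - p)) * (w j * (s - q)) * (w j * (1 - q)) * (w j * (p - s)))"
  proof -
    have "s - q = s * (1 - p)" "p - s = - (s * (1 - q))"
      using \<open>s * p = q\<close> \<open>s * q = p\<close> by (simp_all add: right_diff_distrib)
    then have "- ((w j * (1 - p)) * (w j * (s - q)) * (w j * (1 - q)) * (w j * (p - s)))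
        = (s * s) * (w j ^ 4 * ((1 - p) * (1 - q))\<^sup>2)"
      by (simp only:) (simp add: power2_eq_square power4_eq_xxxx mult_ac)
    then show ?thesis
      using \<open>s * s = 1\<close> by simp
  qed
  also have "\<dots> = - ((g1 * (f 1 - f \<i>)) * (g2 * (f (-1) - f (- \<i>))) * (g3 * (f 1 - f (- \<i>))) * (g4 * (f \<i> - f (-1))))"
    using g by (simp add: p_def q_def s_def)
  also have "\<dots> = - (g1 * g2 * g3 * g4) * ((f 1 - f \<i>) * (f (-1) - f (- \<i>)) * (f 1 - f (- \<i>)) * (f \<i> - f (-1)))"
    by (simp only: mult_ac minus_mult_left)
  also have "\<dots> = (g1 * g2 * g3 * g4) * ((T1\<^sup>2 - T3\<^sup>2)\<^sup>2 + 4 * (T2\<^sup>2 - T1 * T3)\<^sup>2) * 4"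
    unfolding fourth_root_products by (simp add: algebra_simps)
  finally show ?thesis
    unfolding p_def q_def using g by (intro exI[of _ "g1 * g2 * g3 * g4"] conjI algebraic_int_mult)
qed

lemma imaginary_unit_odd_power:
  assumes "odd j"
  shows "(1 - \<i> ^ j) * (1 - (- \<i>) ^ j) = 2"
proof -
  define p where "p = \<i> ^ j"
  have "\<i> ^ j * (- \<i>) ^ j = 1"
    by (simp flip: power_mult_distrib)
  moreover have minus: "(- \<i>) ^ j = - p"
    using assms by (simp add: p_def)
  ultimately have "p * - p = 1"
    unfolding p_def by simp
  then show ?thesis
    unfolding minus unfolding p_def[symmetric] by Groebner_Basis.algebra
qed

text \<open>Put (T1^2 - T3^2)^2 = a_4^2 b w_4 N, and let b w_4 M be the factor from adjacent pairs.
  Divisibility makes N and M units of \<int>[w_4], hence 1 or -1. Their difference, apart from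
  a_4^2, is the contribution of T2^2 - T1 T3, which must then vanish.\<close>

lemma harmonic:
  assumes d: "d < -1"
  shows "T2\<^sup>2 = T1 * T3" "(T1\<^sup>2 - T3\<^sup>2)\<^sup>2 = of_int b * w 4 \<or> (T1\<^sup>2 - T3\<^sup>2)\<^sup>2 = - (of_int b * w 4)"
proof -
  obtain n0 n1 v0 v1 :: int where n: "(T1\<^sup>2 - T3\<^sup>2)\<^sup>2 = A 4 ^ 2 * of_int b * w 4 * (of_int n0 + of_int n1 * w 4)"
    and v: "T2\<^sup>2 - T1 * T3 = of_int b * w 4 * (of_int v0 + of_int v1 * w 4)"
    using T_forms by blast
  define N where "N = of_int n0 + of_int n1 * w 4"
  define W2 where "W2 = (T1\<^sup>2 - T3\<^sup>2)\<^sup>2"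
  have W2: "W2 = A 4 ^ 2 * of_int b * w 4 * N"
    using n by (simp add: W2_def N_def)
  have w1: "w 1 \<noteq> 0"
    using w_2_eqs(1) w_4_eqs(3) w4_nz a_nz by auto
  have g: "\<exists>g. algebraic_int g \<and> w j ^ 8 = g * W2\<^sup>2" if j: "odd j" "j < 8" for j
  proof -
    obtain g where "algebraic_int g" "w j ^ 2 = g * (\<i> * (T1\<^sup>2 - T3\<^sup>2))"
      using odd_rad_pow_dvd[OF j] unfolding fourth_root_products by blast
    then have "w j ^ 8 = g ^ 4 * W2\<^sup>2"
      unfolding W2_def using i_squared by Groebner_Basis.algebra
    then show ?thesis
      using \<open>algebraic_int g\<close> by blast
  qed
  have "W2 \<noteq> 0"
    using g[of 1] w1 by auto
  then have "N \<noteq> 0"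
    using W2 by auto
  have quot: "algebraic_int ((1 / N)\<^sup>2 * of_int h)" if j: "odd j" "j < 8" and h: "rad_res a j = a 4 ^ 4 * b\<^sup>2 * d * h" for j h
  proof -
    obtain g where g: "algebraic_int g" "of_int (rad_res a j) = g * W2\<^sup>2"
      using g[OF j] rad_power8[of j] by auto
    have "W2\<^sup>2 = of_int (a 4 ^ 4 * b\<^sup>2 * d) * N\<^sup>2"
      unfolding W2 of_int_mult of_int_power using w_0_eqs(4) by Groebner_Basis.algebra
    then have "of_int (a 4 ^ 4 * b\<^sup>2 * d) * of_int h = of_int (a 4 ^ 4 * b\<^sup>2 * d) * (g * N\<^sup>2)"
      using g(2) unfolding h by (simp only: of_int_mult mult_ac)
    moreover have "(of_int (a 4 ^ 4 * b\<^sup>2 * d) :: complex) \<noteq> 0"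
      using a_nz by simp
    ultimately have "of_int h = g * N\<^sup>2"
      by (metis mult_left_cancel)
    then have "(1 / N)\<^sup>2 * of_int h = g"
      using \<open>N \<noteq> 0\<close> by (simp add: power_divide)
    then show ?thesis
      using g(1) by simp
  qed
  have "algebraic_int ((1 / N)\<^sup>2)"
  proof (rule algebraic_int_of_coprime_multiples)
    let ?S = "{a 3 ^ 2 * a 5 ^ 4 * a 6 ^ 4 * a 7 ^ 6, a 1 ^ 2 * a 2 ^ 4 * a 5 ^ 6 * a 7 ^ 4,
      a 1 ^ 4 * a 3 ^ 6 * a 6 ^ 4 * a 7 ^ 2, a 1 ^ 6 * a 2 ^ 4 * a 3 ^ 4 * a 5 ^ 2}"
    show "algebraic_int ((1 / N)\<^sup>2 * of_int h)" if "h \<in> ?S" for h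
    proof -
      have r1: "rad_res a 1 = a 4 ^ 4 * b\<^sup>2 * d * (a 3 ^ 2 * a 5 ^ 4 * a 6 ^ 4 * a 7 ^ 6)"
        unfolding rad_res_eqs by Groebner_Basis.algebra
      have q1: "algebraic_int ((1 / N)\<^sup>2 * of_int (a 3 ^ 2 * a 5 ^ 4 * a 6 ^ 4 * a 7 ^ 6))"
        by (rule quot[OF _ _ r1]) simp_all
      have r3: "rad_res a 3 = a 4 ^ 4 * b\<^sup>2 * d * (a 1 ^ 2 * a 2 ^ 4 * a 5 ^ 6 * a 7 ^ 4)"
        unfolding rad_res_eqs by Groebner_Basis.algebra
      have q3: "algebraic_int ((1 / N)\<^sup>2 * of_int (a 1 ^ 2 * a 2 ^ 4 * a 5 ^ 6 * a 7 ^ 4))"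
        by (rule quot[OF _ _ r3]) simp_all
      have r5: "rad_res a 5 = a 4 ^ 4 * b\<^sup>2 * d * (a 1 ^ 4 * a 3 ^ 6 * a 6 ^ 4 * a 7 ^ 2)"
        unfolding rad_res_eqs by Groebner_Basis.algebra
      have q5: "algebraic_int ((1 / N)\<^sup>2 * of_int (a 1 ^ 4 * a 3 ^ 6 * a 6 ^ 4 * a 7 ^ 2))"
        by (rule quot[OF _ _ r5]) simp_all
      have r7: "rad_res a 7 = a 4 ^ 4 * b\<^sup>2 * d * (a 1 ^ 6 * a 2 ^ 4 * a 3 ^ 4 * a 5 ^ 2)"
        unfolding rad_res_eqs by Groebner_Basis.algebra
      have q7: "algebraic_int ((1 / N)\<^sup>2 * of_int (a 1 ^ 6 * a 2 ^ 4 * a 3 ^ 4 * a 5 ^ 2))"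
        by (rule quot[OF _ _ r7]) simp_all
      show ?thesis
        using that by (elim insertE emptyE) (simp_all only: q1 q3 q5 q7)
    qed
    show "\<exists>h\<in>?S. \<not> p dvd h" if p: "prime p" for p :: int
    proof (rule ccontr)
      assume "\<not> (\<exists>h\<in>?S. \<not> p dvd h)"
      then have D: "p dvd a 3 \<or> p dvd a 5 \<or> p dvd a 6 \<or> p dvd a 7" "p dvd a 1 \<or> p dvd a 2 \<or> p dvd a 5 \<or> p dvd a 7"
        "p dvd a 1 \<or> p dvd a 3 \<or> p dvd a 6 \<or> p dvd a 7" "p dvd a 1 \<or> p dvd a 2 \<or> p dvd a 3 \<or> p dvd a 5"
        using p by (auto simp: prime_dvd_mult_iff prime_dvd_power_iff)
      from D(1) show False
      proof (elim disjE)
        assume "p dvd a 3"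
        from prime_dvd_only[OF p this] D(2) show False
          by simp
      next
        assume "p dvd a 5"
        from prime_dvd_only[OF p this] D(3) show False
          by simp
      next
        assume "p dvd a 6"
        from prime_dvd_only[OF p this] D(2) show False
          by simp
      next
        assume "p dvd a 7"
        from prime_dvd_only[OF p this] D(4) show False
          by simp
      qed
    qed
  qed
  then have "algebraic_int (1 / N)"
    by (rule algebraic_int_of_power) simp
  then have n01: "n1 = 0 \<and> \<bar>n0\<bar> = 1"
    using imaginary_quadratic_unit[OF w4_square d] \<open>N \<noteq> 0\<close> unfolding N_def by blast
  define U where "U = (T1\<^sup>2 - T3\<^sup>2)\<^sup>2 + 4 * (T2\<^sup>2 - T1 * T3)\<^sup>2"
  define M where "M = of_int (a 4 ^ 2 * n0 + 8 * b * v0 * v1 * d) + of_int (a 4 ^ 2 * n1 + 4 * b * (v0\<^sup>2 + v1\<^sup>2 * d)) * w 4"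
  have U: "U = of_int b * w 4 * M"
    unfolding U_def M_def n v of_int_mult of_int_add of_int_power of_int_numeral using w_0_eqs(4) by Groebner_Basis.algebra
  have g: "\<exists>g. algebraic_int g \<and> w j ^ 8 = g * U\<^sup>2" if j: "odd j" "j < 8" for j
  proof -
    obtain g where "algebraic_int g" "w j ^ 4 * 2\<^sup>2 = g * U * 4"
      using rad_pow4_dvd[OF j(2)] unfolding imaginary_unit_odd_power[OF j(1)] U_def by blast
    then have "w j ^ 8 = g\<^sup>2 * U\<^sup>2"
      by Groebner_Basis.algebra
    then show ?thesis
      using \<open>algebraic_int g\<close> by blast
  qed
  have g2: "\<exists>g. algebraic_int g \<and> 16 * w 2 ^ 8 = g * U\<^sup>2"
  proof -
    have "(1 - \<i> ^ 2) * (1 - (- \<i>) ^ 2) = 4"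
      by simp
    then obtain g where "algebraic_int g" "w 2 ^ 4 * 4\<^sup>2 = g * U * 4"
      using rad_pow4_dvd[of 2] unfolding U_def by auto
    then have "16 * w 2 ^ 8 = g\<^sup>2 * U\<^sup>2"
      by Groebner_Basis.algebra
    then show ?thesis
      using \<open>algebraic_int g\<close> by blast
  qed
  have "U \<noteq> 0"
    using g[of 1] w1 by auto
  then have "M \<noteq> 0"
    using U by auto
  have U2: "U\<^sup>2 = of_int (b\<^sup>2 * d) * M\<^sup>2"
    unfolding U of_int_mult of_int_power using w_0_eqs(4) by Groebner_Basis.algebra
  have quot: "algebraic_int ((1 / M)\<^sup>2 * of_int h)" if g: "algebraic_int g" "of_int (b\<^sup>2 * d * h) = g * U\<^sup>2" for g h
  proof -
    have "of_int (b\<^sup>2 * d) * of_int h = of_int (b\<^sup>2 * d) * (g * M\<^sup>2)"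
      using g(2) unfolding U2 by (simp only: of_int_mult mult_ac)
    moreover have "(of_int (b\<^sup>2 * d) :: complex) \<noteq> 0"
      using a_nz by simp
    ultimately have "of_int h = g * M\<^sup>2"
      by (metis mult_left_cancel)
    then have "(1 / M)\<^sup>2 * of_int h = g"
      using \<open>M \<noteq> 0\<close> by (simp add: power_divide)
    then show ?thesis
      using g(1) by simp
  qed
  have quot_odd: "algebraic_int ((1 / M)\<^sup>2 * of_int h)" if "odd j" "j < 8" "rad_res a j = b\<^sup>2 * d * h" for j h
    using quot g[OF that(1,2)] unfolding rad_power8 that(3) by blast
  \<comment> \<open>Odd indices leave the primes of a_4 undecided. Index 2 settles them, because
    w_2^8 is prime to a_4 and a_4 is odd.\<close>
  have quot_two: "algebraic_int ((1 / M)\<^sup>2 * of_int (16 * b\<^sup>2 * (a 3 * a 7) ^ 4 * d))"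
  proof -
    have "16 * w 2 ^ 8 = 16 * (w 2 * w 2) ^ 4"
      by Groebner_Basis.algebra
    also have "\<dots> = of_int (b\<^sup>2 * d * (16 * b\<^sup>2 * (a 3 * a 7) ^ 4 * d))"
      unfolding w_4_eqs of_int_mult of_int_power of_int_numeral using w_0_eqs(4) by Groebner_Basis.algebra
    finally show ?thesis
      using quot g2 by metis
  qed
  have "algebraic_int ((1 / M)\<^sup>2)"
  proof (rule algebraic_int_of_coprime_multiples)
    let ?S = "{a 3 ^ 2 * a 4 ^ 4 * a 5 ^ 4 * a 6 ^ 4 * a 7 ^ 6, a 1 ^ 2 * a 2 ^ 4 * a 4 ^ 4 * a 5 ^ 6 * a 7 ^ 4,
      a 1 ^ 4 * a 3 ^ 6 * a 4 ^ 4 * a 6 ^ 4 * a 7 ^ 2, a 1 ^ 6 * a 2 ^ 4 * a 3 ^ 4 * a 4 ^ 4 * a 5 ^ 2, 16 * b\<^sup>2 * (a 3 * a 7) ^ 4 * d}"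
    show "algebraic_int ((1 / M)\<^sup>2 * of_int h)" if "h \<in> ?S" for h
    proof -
      have r1: "rad_res a 1 = b\<^sup>2 * d * (a 3 ^ 2 * a 4 ^ 4 * a 5 ^ 4 * a 6 ^ 4 * a 7 ^ 6)"
        unfolding rad_res_eqs by Groebner_Basis.algebra
      have q1: "algebraic_int ((1 / M)\<^sup>2 * of_int (a 3 ^ 2 * a 4 ^ 4 * a 5 ^ 4 * a 6 ^ 4 * a 7 ^ 6))"
        by (rule quot_odd[OF _ _ r1]) simp_all
      have r3: "rad_res a 3 = b\<^sup>2 * d * (a 1 ^ 2 * a 2 ^ 4 * a 4 ^ 4 * a 5 ^ 6 * a 7 ^ 4)"
        unfolding rad_res_eqs by Groebner_Basis.algebra
      have q3: "algebraic_int ((1 / M)\<^sup>2 * of_int (a 1 ^ 2 * a 2 ^ 4 * a 4 ^ 4 * a 5 ^ 6 * a 7 ^ 4))"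
        by (rule quot_odd[OF _ _ r3]) simp_all
      have r5: "rad_res a 5 = b\<^sup>2 * d * (a 1 ^ 4 * a 3 ^ 6 * a 4 ^ 4 * a 6 ^ 4 * a 7 ^ 2)"
        unfolding rad_res_eqs by Groebner_Basis.algebra
      have q5: "algebraic_int ((1 / M)\<^sup>2 * of_int (a 1 ^ 4 * a 3 ^ 6 * a 4 ^ 4 * a 6 ^ 4 * a 7 ^ 2))"
        by (rule quot_odd[OF _ _ r5]) simp_all
      have r7: "rad_res a 7 = b\<^sup>2 * d * (a 1 ^ 6 * a 2 ^ 4 * a 3 ^ 4 * a 4 ^ 4 * a 5 ^ 2)"
        unfolding rad_res_eqs by Groebner_Basis.algebra
      have q7: "algebraic_int ((1 / M)\<^sup>2 * of_int (a 1 ^ 6 * a 2 ^ 4 * a 3 ^ 4 * a 4 ^ 4 * a 5 ^ 2))"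
        by (rule quot_odd[OF _ _ r7]) simp_all
      show ?thesis
        using that by (elim insertE emptyE) (simp_all only: q1 q3 q5 q7 quot_two)
    qed
    show "\<exists>h\<in>?S. \<not> p dvd h" if p: "prime p" for p :: int
    proof (rule ccontr)
      assume *: "\<not> (\<exists>h\<in>?S. \<not> p dvd h)"
      then have D: "p dvd a 3 \<or> p dvd a 4 \<or> p dvd a 5 \<or> p dvd a 6 \<or> p dvd a 7" "p dvd a 1 \<or> p dvd a 2 \<or> p dvd a 4 \<or> p dvd a 5 \<or> p dvd a 7"
        "p dvd a 1 \<or> p dvd a 3 \<or> p dvd a 4 \<or> p dvd a 6 \<or> p dvd a 7" "p dvd a 1 \<or> p dvd a 2 \<or> p dvd a 3 \<or> p dvd a 4 \<or> p dvd a 5"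
        using p by (auto simp: prime_dvd_mult_iff prime_dvd_power_iff)
      have p4: "p dvd a 4"
      proof (rule ccontr)
        assume n4: "\<not> p dvd a 4"
        have "\<not> p dvd a 3"
        proof
          assume "p dvd a 3"
          from prime_dvd_only[OF p this] D(2) n4 show False
            by simp
        qed
        moreover have "\<not> p dvd a 5"
        proof
          assume "p dvd a 5"
          from prime_dvd_only[OF p this] D(3) n4 show False
            by simp
        qed
        moreover have "\<not> p dvd a 6"
        proof
          assume "p dvd a 6"
          from prime_dvd_only[OF p this] D(2) n4 show False
            by simp
        qed
        moreover have "\<not> p dvd a 7"
        proof
          assume "p dvd a 7"
          from prime_dvd_only[OF p this] D(4) n4 show False
            by simp
        qed
        ultimately show False
          using D(1) n4 by blast
      qed
      have "p dvd 2 ^ 4 * (b\<^sup>2 * (a 3 * a 7) ^ 4 * d)"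
        using * by (simp add: mult.assoc)
      moreover have "\<not> p dvd b\<^sup>2 * (a 3 * a 7) ^ 4 * d"
        using prime_dvd_only[OF p p4] p by (simp add: prime_dvd_mult_iff prime_dvd_power_iff)
      ultimately have "p dvd 2 ^ 4"
        using p prime_dvd_mult_iff by blast
      then have "p dvd 2"
        using p prime_dvd_power by blast
      then have "p = 2"
        using p primes_dvd_imp_eq[of p 2] by simp
      then show False
        using p4 odd_a by auto
    qed
  qed
  then have "algebraic_int (1 / M)"
    by (rule algebraic_int_of_power) simp
  then have m01: "a 4 ^ 2 * n1 + 4 * b * (v0\<^sup>2 + v1\<^sup>2 * d) = 0 \<and> \<bar>a 4 ^ 2 * n0 + 8 * b * v0 * v1 * d\<bar> = 1"
    using imaginary_quadratic_unit[OF w4_square d] \<open>M \<noteq> 0\<close> unfolding M_def by blast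
  \<comment> \<open>With n1 = 0 the w_4-coordinate of the unit M is 4b (v0^2 + d v1^2). Its
    vanishing makes v0^2 equal to -d times v1^2, which is possible only for v0 = v1 = 0.\<close>
  then have "v0\<^sup>2 + v1\<^sup>2 * d = 0"
    using n01 b_nz by simp
  then have v0: "v0\<^sup>2 = (- d) * v1\<^sup>2"
    by Groebner_Basis.algebra
  have "squarefree (- d)"
    using squarefree_d unfolding squarefree_def by simp
  then have "v1 = 0"
    using d v0 by (intro squarefree_mult_square_eq_square[of "- d" v0 v1]) simp_all
  then have "v0 = 0"
    using v0 by simp
  show "T2\<^sup>2 = T1 * T3"
    using v \<open>v0 = 0\<close> \<open>v1 = 0\<close> by simp
  have "\<bar>a 4 ^ 2\<bar> * \<bar>n0\<bar> = 1"
    using m01 \<open>v0 = 0\<close> by (simp add: abs_mult)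
  then have "a 4 ^ 2 = 1"
    using n01 by simp
  then have "A 4 ^ 2 = 1"
    by (metis of_int_1 of_int_power)
  moreover have "n0 = 1 \<or> n0 = -1"
    using n01 by auto
  ultimately show "(T1\<^sup>2 - T3\<^sup>2)\<^sup>2 = of_int b * w 4 \<or> (T1\<^sup>2 - T3\<^sup>2)\<^sup>2 = - (of_int b * w 4)"
    using n n01 by auto
qed

end

section \<open>Values in \<int>[\<surd>2] and the bound on b\<close>

definition zeta8 :: complex where "zeta8 = Complex (1 / sqrt 2) (1 / sqrt 2)"

lemma zeta8_square: "zeta8\<^sup>2 = \<i>"
  by (simp add: zeta8_def complex_eq_iff power2_eq_square)

lemma zeta8_pow4: "zeta8 ^ 4 = -1" "(- zeta8) ^ 4 = -1"
proof -
  show "zeta8 ^ 4 = -1"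
    using power_mult[of zeta8 2 2] by (simp add: zeta8_square)
  then show "(- zeta8) ^ 4 = -1"
    by simp
qed

lemma zeta8_cube: "zeta8 ^ 3 = \<i> * zeta8"
  by (simp add: power3_eq_cube flip: zeta8_square) (simp add: power2_eq_square)

lemma cnj_zeta8: "cnj zeta8 = - (\<i> * zeta8)"
  by (simp add: zeta8_def complex_eq_iff)

lemma zeta8_minus_cube: "zeta8 - zeta8 ^ 3 = of_real (sqrt 2)"
  unfolding zeta8_cube by (simp add: zeta8_def complex_eq_iff real_div_sqrt)

text \<open>Reality of the value makes sqrt 2 times \<open>r\<close> an integer, so r = 0 and only
  \<int>[\<surd>2] is left. Replacing z by -z fixes i and negates sqrt 2.\<close>

lemma int_poly_fun_real_at_zeta8:
  assumes "int_poly_fun F" "Im (F zeta8) = 0"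
  shows "\<exists>p q :: int. F zeta8 = of_int p + of_int q * of_real (sqrt 2) \<and> F (- zeta8) = of_int p - of_int q * of_real (sqrt 2)"
proof -
  obtain p q r s :: int where F: "\<And>z. z ^ 4 = -1 \<Longrightarrow> F z = of_int p + of_int q * z + of_int r * z\<^sup>2 + of_int s * z ^ 3"
    using int_poly_fun_primitive_eighth_root[OF assms(1)] by blast
  have "Im (F zeta8) = (q + s) / sqrt 2 + r"
    unfolding F[OF zeta8_pow4(1)] zeta8_square zeta8_cube by (simp add: zeta8_def field_simps)
  then have "q + s = - r * sqrt 2"
    using assms(2) by (simp add: field_simps)
  then have "(of_int (q + s) :: real)\<^sup>2 = (- r * sqrt 2)\<^sup>2"
    by simp
  then have "(of_int ((q + s)\<^sup>2) :: real) = of_int (2 * r\<^sup>2)"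
    by (simp add: power_mult_distrib)
  then have "(q + s)\<^sup>2 = 2 * r\<^sup>2"
    by (simp only: of_int_eq_iff)
  then have "r = 0"
    by (intro squarefree_mult_square_eq_square[of 2 "q + s" r]) (simp_all add: squarefree_prime)
  then have "s = - q"
    using \<open>(q + s)\<^sup>2 = 2 * r\<^sup>2\<close> by simp
  have "F zeta8 = of_int p + of_int q * (zeta8 - zeta8 ^ 3)" "F (- zeta8) = of_int p - of_int q * (zeta8 - zeta8 ^ 3)"
    unfolding F[OF zeta8_pow4(1)] F[OF zeta8_pow4(2)] \<open>r = 0\<close> \<open>s = - q\<close> by (simp_all add: algebra_simps)
  then show ?thesis
    unfolding zeta8_minus_cube by blast
qed

lemma quadratic_square_sum:
  fixes r :: "'a::comm_ring_1"
  assumes "r * r = 2"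
  shows "B\<^sup>2 * (q + q' * r)\<^sup>2 + 4 * D * (h + h' * r)\<^sup>2
      = B\<^sup>2 * (q\<^sup>2 + 2 * q'\<^sup>2) + 4 * D * (h\<^sup>2 + 2 * h'\<^sup>2) + (2 * B\<^sup>2 * q * q' + 8 * D * h * h') * r"
proof -
  have "(u + v * r)\<^sup>2 = u\<^sup>2 + 2 * v\<^sup>2 + 2 * u * v * r" for u v
  proof -
    have "(u + v * r)\<^sup>2 = u\<^sup>2 + v\<^sup>2 * (r * r) + 2 * u * v * r"
      by (simp add: power2_eq_square algebra_simps)
    then show ?thesis
      by (simp add: assms mult.commute)
  qed
  then show ?thesis
    by (simp add: algebra_simps)
qed

lemma quadratic_conj_mult:
  fixes r :: "'a::comm_ring_1"
  assumes "r * r = 2"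
  shows "(A + B * r) * (A - B * r) = A\<^sup>2 - 2 * B\<^sup>2"
proof -
  have "(A + B * r) * (A - B * r) = A\<^sup>2 - B\<^sup>2 * (r * r)"
    by (simp add: power2_eq_square algebra_simps)
  then show ?thesis
    by (simp add: assms mult.commute)
qed

lemma quadratic_norm_sum:
  fixes r :: real
  assumes "r * r = 2"
  shows "(B\<^sup>2 * (q + q' * r)\<^sup>2 + 4 * D * (h + h' * r)\<^sup>2) * (B\<^sup>2 * (q - q' * r)\<^sup>2 + 4 * D * (h - h' * r)\<^sup>2)
      = (B\<^sup>2 * (q\<^sup>2 + 2 * q'\<^sup>2) + 4 * D * (h\<^sup>2 + 2 * h'\<^sup>2))\<^sup>2 - 2 * (2 * B\<^sup>2 * q * q' + 8 * D * h * h')\<^sup>2"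
  using quadratic_square_sum[OF assms, of B q q' D h h'] quadratic_square_sum[of "- r" B q q' D h h'] assms
  by (simp add: quadratic_conj_mult)

lemma quadratic_norm_square:
  fixes r :: real
  assumes "r * r = 2"
  shows "(B\<^sup>2 * (q + q' * r)\<^sup>2) * (B\<^sup>2 * (q - q' * r)\<^sup>2) = B ^ 4 * (q\<^sup>2 - 2 * q'\<^sup>2)\<^sup>2"
proof -
  have "(B\<^sup>2 * (q + q' * r)\<^sup>2) * (B\<^sup>2 * (q - q' * r)\<^sup>2) = B ^ 4 * ((q + q' * r) * (q - q' * r))\<^sup>2"
    by (simp add: power_mult_distrib eval_nat_numeral)
  then show ?thesis
    by (simp only: quadratic_conj_mult[OF assms])
qed

text \<open>Adapts the values to the parameters of \<open>unit_sum_of_squares_pos\<close>, where d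
  is -D, the pair e0, e1 is doubled and negated, and the sign \<epsilon> is moved into q0 and
  q1.\<close>

lemma Re_quadratic_form:
  fixes D B \<epsilon> e0 e1 q0 q1 :: int and s r :: real
  shows "u = 4 * of_int D * (of_int e0 + of_int e1 * of_real r) - 2 * (of_int (\<epsilon> * B) * of_real s) * (of_int q0 + of_int q1 * of_real r) \<Longrightarrow>
      Re u = real_of_int (2 * - D) * (of_int (- 2 * e0) + of_int (- 2 * e1) * r) - 2 * s * of_int B * (of_int (\<epsilon> * q0) + of_int (\<epsilon> * q1) * r)"
    and "u = 4 * of_int D * (of_int e0 + of_int e1 * of_real r) + 2 * (of_int (\<epsilon> * B) * of_real s) * (of_int q0 + of_int q1 * of_real r) \<Longrightarrow>
      Re u = real_of_int (2 * - D) * (of_int (- 2 * e0) + of_int (- 2 * e1) * r) + 2 * s * of_int B * (of_int (\<epsilon> * q0) + of_int (\<epsilon> * q1) * r)"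
proof -
  show "Re u = real_of_int (2 * - D) * (of_int (- 2 * e0) + of_int (- 2 * e1) * r) - 2 * s * of_int B * (of_int (\<epsilon> * q0) + of_int (\<epsilon> * q1) * r)"
    if u: "u = 4 * of_int D * (of_int e0 + of_int e1 * of_real r) - 2 * (of_int (\<epsilon> * B) * of_real s) * (of_int q0 + of_int q1 * of_real r)"
    unfolding u by (simp add: algebra_simps)
  show "Re u = real_of_int (2 * - D) * (of_int (- 2 * e0) + of_int (- 2 * e1) * r) + 2 * s * of_int B * (of_int (\<epsilon> * q0) + of_int (\<epsilon> * q1) * r)"
    if u: "u = 4 * of_int D * (of_int e0 + of_int e1 * of_real r) + 2 * (of_int (\<epsilon> * B) * of_real s) * (of_int q0 + of_int q1 * of_real r)"
    unfolding u by (simp add: algebra_simps)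
qed

lemma Im_divide_of_int: "Im (z / of_int n) = Im z / of_int n"
  using Im_divide_of_real[of z "of_int n"] by simp

lemma mult_four_diffs_swap: "(p - q) * (r - s) * (t - u) * (v - y) = (y - v) * (u - t) * (s - r) * (q - p)" for p :: "'a::comm_ring_1"
proof -
  have "(- A) * (- B) * (- C) * (- D) = D * C * B * A" for A B C D :: 'a
    by (simp add: mult_ac)
  from this[of "q - p" "s - r" "u - t" "y - v"] show ?thesis
    by (simp only: minus_diff_eq)
qed

text \<open>Follows from changing all four signs and rotating u to -i u, neither of which alters the
  product.\<close>

lemma rotation_product_twist:
  "rotation_product (- z0) z1 z2 z3 = rotation_product z0 (\<i> * z1) z2 (- (\<i> * z3))"
  unfolding rotation_product_expand using i_squared by Groebner_Basis.algebra

context octic_index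
begin

text \<open>The hypotheses put both parts into \<int>[\<surd>2], and evaluation at
  -\<open>zeta8\<close> yields the conjugates there. As (i w_4)^2 = -d, the two products multiply to
  4d times the quadratic form, which is therefore a unit of norm 1 or -1.\<close>

lemma real_parts:
  assumes re: "Im (conj_product f zeta8 + conj_product' f zeta8) = 0"
    and im: "Im ((conj_product' f zeta8 - conj_product f zeta8) / (\<i> * w 4)) = 0"
  obtains e0 e1 q0 q1 :: int where
    "\<And>z r. (z, r) \<in> {(zeta8, of_real (sqrt 2)), (- zeta8, - of_real (sqrt 2))} \<Longrightarrow>
       conj_product f z = 4 * of_int d * (of_int e0 + of_int e1 * r) - 2 * of_int b * (\<i> * w 4) * (of_int q0 + of_int q1 * r) \<and>
       conj_product' f z = 4 * of_int d * (of_int e0 + of_int e1 * r) + 2 * of_int b * (\<i> * w 4) * (of_int q0 + of_int q1 * r)"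
    "\<bar>(b\<^sup>2 * (q0\<^sup>2 + 2 * q1\<^sup>2) + 4 * d * (e0\<^sup>2 + 2 * e1\<^sup>2))\<^sup>2 - 2 * (2 * b\<^sup>2 * q0 * q1 + 8 * d * e0 * e1)\<^sup>2\<bar> = 1"
proof -
  obtain E Q where EQ: "int_poly_fun E" "int_poly_fun Q" "\<And>z. z ^ 4 = -1 \<Longrightarrow>
     conj_product f z + conj_product' f z = 8 * of_int d * ((- 2 * z + 3 * z\<^sup>2 - 2 * z ^ 3) * E z) \<and>
     conj_product' f z - conj_product f z = - 4 * of_int b * w 4 * ((- 2 * z + 3 * z\<^sup>2 - 2 * z ^ 3) * Q z)"
    using conj_product_parts[of x] by blast
  \<comment> \<open>The unit is absorbed, and the factor z^2 = i in \<open>F2\<close> trades w_4 for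
    i w_4, a square root of -d.\<close>
  define F1 F2 where "F1 = (\<lambda>z. (- 2 * z + 3 * z\<^sup>2 - 2 * z ^ 3) * E z)" and "F2 = (\<lambda>z. z\<^sup>2 * ((- 2 * z + 3 * z\<^sup>2 - 2 * z ^ 3) * Q z))"
  have F: "int_poly_fun F1" "int_poly_fun F2"
    unfolding F1_def F2_def by (auto intro!: int_poly_fun_intros EQ(1,2))
  have sum: "conj_product f z + conj_product' f z = 8 * of_int d * F1 z"
    and diff: "conj_product' f z - conj_product f z = 4 * of_int b * (\<i> * w 4) * F2 z" if "z = zeta8 \<or> z = - zeta8" for z
  proof -
    have z: "z ^ 4 = -1" "z\<^sup>2 = \<i>"
      using that zeta8_pow4 zeta8_square by auto
    show "conj_product f z + conj_product' f z = 8 * of_int d * F1 z"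
      using EQ(3)[OF z(1)] by (simp add: F1_def)
    have "F2 z = \<i> * ((- 2 * z + 3 * z\<^sup>2 - 2 * z ^ 3) * Q z)"
      by (simp add: F2_def z(2))
    then show "conj_product' f z - conj_product f z = 4 * of_int b * (\<i> * w 4) * F2 z"
      using EQ(3)[OF z(1)] by (simp add: mult_ac)
  qed
  have "F1 zeta8 = (conj_product f zeta8 + conj_product' f zeta8) / of_int (8 * d)"
    using sum[of zeta8] d_nz by simp
  then have "Im (F1 zeta8) = 0"
    using re by (simp only: Im_divide_of_int)
  moreover have "F2 zeta8 = (conj_product' f zeta8 - conj_product f zeta8) / (\<i> * w 4) / of_int (4 * b)"
    using diff[of zeta8] b_nz w4_nz by simp
  then have "Im (F2 zeta8) = 0"
    using im by (simp only: Im_divide_of_int)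
  ultimately obtain e0 e1 q0 q1 :: int where
    F1: "F1 zeta8 = of_int e0 + of_int e1 * of_real (sqrt 2)" "F1 (- zeta8) = of_int e0 - of_int e1 * of_real (sqrt 2)" and
    F2: "F2 zeta8 = of_int q0 + of_int q1 * of_real (sqrt 2)" "F2 (- zeta8) = of_int q0 - of_int q1 * of_real (sqrt 2)"
    using int_poly_fun_real_at_zeta8 F by meson
  define S where "S = {(zeta8, complex_of_real (sqrt 2)), (- zeta8, - of_real (sqrt 2))}"
  have S: "F1 z = of_int e0 + of_int e1 * r" "F2 z = of_int q0 + of_int q1 * r" "z = zeta8 \<or> z = - zeta8" "r\<^sup>2 = 2" "z ^ 4 = -1"
    if "(z, r) \<in> S" for z r
    using that F1 F2 zeta8_pow4 by (auto simp: S_def simp flip: of_real_power)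
  have vals: "conj_product f z = 4 * of_int d * (of_int e0 + of_int e1 * r) - 2 * of_int b * (\<i> * w 4) * (of_int q0 + of_int q1 * r) \<and>
       conj_product' f z = 4 * of_int d * (of_int e0 + of_int e1 * r) + 2 * of_int b * (\<i> * w 4) * (of_int q0 + of_int q1 * r)"
    if "(z, r) \<in> S" for z r
    using sum[OF S(3)[OF that]] diff[OF S(3)[OF that]] unfolding S(1,2)[OF that] by Groebner_Basis.algebra
  define A0 B0 where "A0 = b\<^sup>2 * (q0\<^sup>2 + 2 * q1\<^sup>2) + 4 * d * (e0\<^sup>2 + 2 * e1\<^sup>2)" and "B0 = 2 * b\<^sup>2 * q0 * q1 + 8 * d * e0 * e1"
  have prod: "conj_product f z * conj_product' f z = 4 * of_int d * (of_int A0 + of_int B0 * r)" if "(z, r) \<in> S" for z r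
  proof -
    define y where "y = \<i> * w 4"
    have "y * y = - (w 4 * w 4)"
      by (simp add: y_def power_mult_distrib flip: power2_eq_square)
    then have y: "y * y = - of_int d"
      unfolding w4_square .
    have r: "r * r = 2"
      using S(4)[OF that] by (simp only: power2_eq_square)
    have AB: "of_int A0 + of_int B0 * r
        = (of_int b)\<^sup>2 * (of_int q0 + of_int q1 * r)\<^sup>2 + 4 * of_int d * (of_int e0 + of_int e1 * r)\<^sup>2"
      unfolding A0_def B0_def quadratic_square_sum[OF r] by (simp only: of_int_mult of_int_add of_int_power of_int_numeral)
    have "(4 * D * U - 2 * B * y * V) * (4 * D * U + 2 * B * y * V) = 4 * D * (B\<^sup>2 * V\<^sup>2 + 4 * D * U\<^sup>2)"
      if "y * y = - D" for D U B V :: complex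
      using that by Groebner_Basis.algebra
    from this[OF y] show ?thesis
      unfolding vals[OF that, THEN conjunct1] vals[OF that, THEN conjunct2] AB y_def[symmetric] .
  qed
  have unit: "of_int A0 + of_int B0 * r \<noteq> 0 \<and> algebraic_int (1 / (of_int A0 + of_int B0 * r))" if "(z, r) \<in> S" for z r
  proof -
    have "4 * of_int d / (4 * of_int d * (of_int A0 + of_int B0 * r)) = 1 / (of_int A0 + of_int B0 * r)"
      using d_nz by simp
    then show ?thesis
      using conj_products_unit[OF S(5)[OF that]] unfolding prod[OF that] by auto
  qed
  have u: "of_int A0 + of_int B0 * of_real (sqrt 2) \<noteq> (0::complex)" "algebraic_int (1 / (of_int A0 + of_int B0 * of_real (sqrt 2)) :: complex)"
    "of_int A0 - of_int B0 * of_real (sqrt 2) \<noteq> (0::complex)" "algebraic_int (1 / (of_int A0 - of_int B0 * of_real (sqrt 2)) :: complex)"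
    using unit[of zeta8 "of_real (sqrt 2)"] unit[of "- zeta8" "- of_real (sqrt 2)"] by (simp_all add: S_def)
  have norm: "(of_int A0 + of_int B0 * of_real (sqrt 2)) * (of_int A0 - of_int B0 * of_real (sqrt 2)) = (of_int (A0\<^sup>2 - 2 * B0\<^sup>2) :: complex)"
    by (simp add: power2_eq_square algebra_simps flip: of_real_mult)
  have "\<bar>A0\<^sup>2 - 2 * B0\<^sup>2\<bar> = 1"
  proof (rule unit_of_inverse_algebraic_int)
    show "algebraic_int (1 / of_int (A0\<^sup>2 - 2 * B0\<^sup>2) :: complex)"
      unfolding norm[symmetric] using algebraic_int_mult[OF u(2) u(4)] by simp
    show "A0\<^sup>2 - 2 * B0\<^sup>2 \<noteq> 0"
      using norm u(1,3) by (metis mult_eq_0_iff of_int_0)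
  qed
  then show ?thesis
    using that vals unfolding S_def A0_def B0_def by blast
qed

text \<open>For real \<alpha>, conjugation sends index k to -k, exchanging the two products, while
  w_4 is real. With d > 0, dropping the nonnegative E-terms in both embeddings bounds the norm below
  by b^4 times a positive square.\<close>

lemma b_square_eq_1_of_real:
  assumes "cnj \<alpha> = \<alpha>" "d > 0"
  shows "b\<^sup>2 = 1"
proof -
  have cw: "cnj (w j) = w j" for j
    by (simp add: rad_def assms(1))
  have cf: "cnj (f t) = f (cnj t)" for t
    by (simp add: octic_conj_def cw)
  have c3: "cnj (\<i> * zeta8) = - zeta8"
    by (simp add: cnj_zeta8)
  have cv: "cnj (conj_product f zeta8) = conj_product' f zeta8"
  proof -
    have "cnj (f 1) = f 1" "cnj (f zeta8) = f (- \<i> * zeta8)" "cnj (f \<i>) = f (- \<i>)" "cnj (f (\<i> * zeta8)) = f (- zeta8)"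
      "cnj (f (-1)) = f (-1)" "cnj (f (- zeta8)) = f (\<i> * zeta8)" "cnj (f (- \<i>)) = f \<i>" "cnj (f (- \<i> * zeta8)) = f zeta8"
      unfolding cf by (simp_all add: cnj_zeta8)
    note cn = this
    show ?thesis
      unfolding conj_product_def conj_product'_def zeta8_square complex_cnj_mult complex_cnj_diff cn
      by (rule mult_four_diffs_swap)
  qed
  have cv': "cnj (conj_product' f zeta8) = conj_product f zeta8"
    using arg_cong[OF cv, of cnj] by simp
  have "cnj (conj_product f zeta8 + conj_product' f zeta8) = conj_product f zeta8 + conj_product' f zeta8"
    by (simp only: complex_cnj_add cv cv' add.commute)
  then have 1: "Im (conj_product f zeta8 + conj_product' f zeta8) = 0"
    by (simp add: complex_eq_iff)
  have "cnj ((conj_product' f zeta8 - conj_product f zeta8) / (\<i> * w 4)) = (conj_product' f zeta8 - conj_product f zeta8) / (\<i> * w 4)"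
    by (simp only: complex_cnj_divide complex_cnj_diff complex_cnj_mult cv cv' cw complex_cnj_i)
      (metis (no_types, lifting) minus_diff_eq minus_divide_divide mult_minus_left)
  then have 2: "Im ((conj_product' f zeta8 - conj_product f zeta8) / (\<i> * w 4)) = 0"
    by (metis Reals_cnj_iff complex_is_Real_iff)
  obtain e0 e1 q0 q1 :: int where
    unit: "\<bar>(b\<^sup>2 * (q0\<^sup>2 + 2 * q1\<^sup>2) + 4 * d * (e0\<^sup>2 + 2 * e1\<^sup>2))\<^sup>2 - 2 * (2 * b\<^sup>2 * q0 * q1 + 8 * d * e0 * e1)\<^sup>2\<bar> = 1"
    by (rule real_parts[OF 1 2], rule that)
  define g g' h h' :: real where "g = q0 + q1 * sqrt 2" and "g' = q0 - q1 * sqrt 2" and "h = e0 + e1 * sqrt 2" and "h' = e0 - e1 * sqrt 2"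
  have "(b\<^sup>2 * g\<^sup>2 + 4 * d * h\<^sup>2) * (b\<^sup>2 * g'\<^sup>2 + 4 * d * h'\<^sup>2)
      = of_int ((b\<^sup>2 * (q0\<^sup>2 + 2 * q1\<^sup>2) + 4 * d * (e0\<^sup>2 + 2 * e1\<^sup>2))\<^sup>2 - 2 * (2 * b\<^sup>2 * q0 * q1 + 8 * d * e0 * e1)\<^sup>2)" (is "_ = of_int ?n")
    unfolding g_def g'_def h_def h'_def of_int_diff of_int_mult of_int_add of_int_power of_int_numeral
    by (intro quadratic_norm_sum) simp
  moreover have "(b\<^sup>2 * g\<^sup>2 + 4 * d * h\<^sup>2) * (b\<^sup>2 * g'\<^sup>2 + 4 * d * h'\<^sup>2) \<ge> (b\<^sup>2 * g\<^sup>2) * (b\<^sup>2 * g'\<^sup>2)"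
  proof -
    have "p * p' \<le> (p + 4 * D * h\<^sup>2) * (p' + 4 * D * h'\<^sup>2)" if "D > 0" "p \<ge> 0" "p' \<ge> 0" for D p p' :: real
      using that by (intro mult_mono) simp_all
    from this[OF of_int_0_less_iff[THEN iffD2, OF assms(2)]] show ?thesis
      by simp
  qed
  moreover have "(b\<^sup>2 * g\<^sup>2) * (b\<^sup>2 * g'\<^sup>2) = of_int (b ^ 4 * (q0\<^sup>2 - 2 * q1\<^sup>2)\<^sup>2)"
    unfolding g_def g'_def of_int_diff of_int_mult of_int_power of_int_numeral
    by (intro quadratic_norm_square) simp
  ultimately have "of_int (b ^ 4 * (q0\<^sup>2 - 2 * q1\<^sup>2)\<^sup>2) \<le> (of_int ?n :: real)"
    by simp
  then have le: "b ^ 4 * (q0\<^sup>2 - 2 * q1\<^sup>2)\<^sup>2 \<le> ?n"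
    by (simp only: of_int_le_iff)
  \<comment> \<open>Otherwise \<open>q0\<close> would be even, and so would the norm, which is 1 or
    -1.\<close>
  have "q0\<^sup>2 - 2 * q1\<^sup>2 \<noteq> 0"
  proof
    assume "q0\<^sup>2 - 2 * q1\<^sup>2 = 0"
    then have "even (q0\<^sup>2)"
      by simp
    then have "even ?n"
      by simp
    then have "even \<bar>?n\<bar>"
      by simp
    then show False
      unfolding unit by simp
  qed
  then have "(q0\<^sup>2 - 2 * q1\<^sup>2)\<^sup>2 \<ge> 1"
    by (smt (verit) zero_less_power2)
  then have "b ^ 4 * 1 \<le> b ^ 4 * (q0\<^sup>2 - 2 * q1\<^sup>2)\<^sup>2"
    by (intro mult_left_mono) simp_all
  then have "b ^ 4 \<le> 1"
    using le unit by linarith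
  then have "(b\<^sup>2)\<^sup>2 \<le> 1\<^sup>2"
    by simp
  then have "b\<^sup>2 \<le> 1"
    by (rule power2_le_imp_le) simp
  moreover have "b\<^sup>2 > 0"
    using b_nz by simp
  ultimately show ?thesis
    by linarith
qed

text \<open>Conjugation sends index k to 1 - k and preserves each of the two products up to four
  sign changes, so both are real, as is i w_4. Reality is obtained together with the explicit
  quadratic forms, from \<open>harmonic\<close> and
  \<open>rotation_product_real_form\<close>.\<close>

lemma b_square_eq_1_of_imaginary:
  assumes ca: "cnj \<alpha> = zeta8 * \<alpha>" and d: "d < -1"
  shows "b\<^sup>2 = 1"
proof -
  have cw: "cnj (w j) = zeta8 ^ j * w j" for j
    by (simp add: rad_def ca power_mult_distrib)
  have z: "zeta8\<^sup>2 = \<i>" "zeta8 ^ 3 = \<i> * zeta8" "zeta8 ^ 4 = -1" "zeta8 ^ 5 = - zeta8" "zeta8 ^ 6 = - \<i>" "zeta8 ^ 7 = - (\<i> * zeta8)"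
    using zeta8_square zeta8_cube zeta8_pow4(1) by (simp_all add: eval_nat_numeral)
  have c: "cnj T1 = zeta8 * (of_int (x 1) * w 1 - of_int (x 5) * w 5)" "cnj T2 = \<i> * (of_int (x 2) * w 2 - of_int (x 6) * w 6)"
    "cnj T3 = \<i> * zeta8 * (of_int (x 3) * w 3 - of_int (x 7) * w 7)" "cnj (of_int (x 4) * w 4) = - (of_int (x 4) * w 4)"
    by (simp_all add: T1_def T2_def T3_def cw z algebra_simps)
  define t where "t = 2 * (of_int (x 4) * w 4)"
  have ct: "cnj t = - t"
    unfolding t_def using c(4) by simp
  have f: "f u = of_int (x 0) * w 0 + of_int (x 1) * w 1 * u + of_int (x 2) * w 2 * u\<^sup>2 + of_int (x 3) * w 3 * u ^ 3
      + of_int (x 4) * w 4 * u ^ 4 + of_int (x 5) * w 5 * u ^ 5 + of_int (x 6) * w 6 * u ^ 6 + of_int (x 7) * w 7 * u ^ 7" for u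
    by (simp add: octic_conj_def sum_lessThan8)
  define P where "P l = rotation_product t (T1 - l * cnj T1) (T2 - l\<^sup>2 * cnj T2) (T3 - l ^ 3 * cnj T3)" for l
  have zz: "zeta8 * zeta8 = \<i>" "zeta8 * (zeta8 * y) = \<i> * y" "\<i> * (\<i> * y) = - y" for y
    using zeta8_square by (simp_all add: power2_eq_square flip: mult.assoc)
  have P1: "conj_product f zeta8 = P 1"
    unfolding conj_product_eq(1)[OF zeta8_pow4(1) f] P_def c t_def z by (simp add: T1_def T2_def T3_def algebra_simps)
  have P2: "conj_product f (- zeta8) = P (-1)"
    unfolding conj_product_eq(1)[OF zeta8_pow4(2) f] P_def c t_def by (simp add: z T1_def T2_def T3_def algebra_simps)
  have P3: "conj_product' f zeta8 = P (- \<i>)"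
    unfolding conj_product_eq(2)[OF zeta8_pow4(1) f] mult_minus_left rotation_product_twist P_def c t_def z
    by (simp add: imaginary_unit_power_simps z zz T1_def T2_def T3_def algebra_simps)
  have P4: "conj_product' f (- zeta8) = P \<i>"
    unfolding conj_product_eq(2)[OF zeta8_pow4(2) f] mult_minus_left rotation_product_twist P_def c t_def
    by (simp add: imaginary_unit_power_simps z zz T1_def T2_def T3_def algebra_simps)
  define s where "s = sqrt (of_int (- d))"
  have s: "s > 0" "s\<^sup>2 = of_int (- d)"
  proof -
    have "(0::real) < of_int (- d)"
      unfolding of_int_0_less_iff using d by simp
    then show "s > 0" "s\<^sup>2 = of_int (- d)"
      unfolding s_def by (simp_all only: real_sqrt_gt_0_iff real_sqrt_pow2 less_imp_le)
  qed
  have w4: "w 4 = \<i> * of_real s \<or> w 4 = - (\<i> * of_real s)"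
  proof -
    have "(\<i> * of_real s)\<^sup>2 = - of_real (s\<^sup>2)"
      by (simp add: power_mult_distrib)
    also have "\<dots> = of_int d"
      unfolding s(2) by simp
    finally have "(w 4)\<^sup>2 = (\<i> * of_real s)\<^sup>2"
      unfolding power2_eq_square w4_square by (rule sym)
    then show ?thesis
      by (simp add: power2_eq_iff)
  qed
  \<comment> \<open>Neither the sign of \<open>b\<close> nor the choice of the square root w_4 is
    known; \<epsilon> collects both.\<close>
  obtain \<epsilon> :: int where eps: "\<epsilon> = 1 \<or> \<epsilon> = -1" "of_int b * (\<i> * w 4) = of_int (\<epsilon> * \<bar>b\<bar>) * of_real s"
  proof -
    have "\<bar>b\<bar> = b \<or> \<bar>b\<bar> = - b"
      by linarith
    then have "of_int b * (\<i> * w 4) = of_int (1 * \<bar>b\<bar>) * of_real s \<or> of_int b * (\<i> * w 4) = of_int (-1 * \<bar>b\<bar>) * of_real s"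
      using w4 by auto
    then show ?thesis
      using that by blast
  qed
  \<comment> \<open>T2^2 = T1 T3 says that the three are a geometric progression. If T1 = 0, then T2
    = 0 as well, and T3 alone is parametrized by p = 0, q = 1.\<close>
  obtain \<sigma> p q where param: "T1 = \<sigma> * p\<^sup>2" "T2 = \<sigma> * p * q" "T3 = \<sigma> * q\<^sup>2"
  proof (cases "T1 = 0")
    case True
    then have "T2 = 0"
      using harmonic(1)[OF d] by simp
    then show ?thesis
      using that[of T3 0 1] True by simp
  next
    case False
    then have "T3 = T1 * (T2 / T1)\<^sup>2"
      using harmonic(1)[OF d] by (simp add: power_divide power2_eq_square)
    then show ?thesis
      using that[of T1 1 "T2 / T1"] False by simp
  qed
  have W: "T1\<^sup>2 - T3\<^sup>2 = \<sigma> * \<sigma> * (p ^ 4 - q ^ 4)"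
    unfolding param by Groebner_Basis.algebra
  have Wn: "(cmod (T1\<^sup>2 - T3\<^sup>2))\<^sup>2 = of_int \<bar>b\<bar> * s"
  proof -
    have w4': "cmod (w 4) = s"
      using w4 s(1) by (auto simp: norm_mult)
    have "(cmod (T1\<^sup>2 - T3\<^sup>2))\<^sup>2 = cmod ((T1\<^sup>2 - T3\<^sup>2)\<^sup>2)"
      by (simp only: norm_power)
    also have "\<dots> = cmod (of_int b * w 4)"
      using harmonic(2)[OF d] by (elim disjE) (simp_all only: norm_minus_cancel)
    finally show ?thesis
      by (simp only: norm_mult norm_of_int of_int_abs w4')
  qed
  have nz: "\<sigma> * \<sigma> * (p ^ 4 - q ^ 4) \<noteq> 0"
  proof
    assume "\<sigma> * \<sigma> * (p ^ 4 - q ^ 4) = 0"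
    then have "(cmod 0)\<^sup>2 = of_int \<bar>b\<bar> * s"
      using Wn unfolding W by (simp only:)
    then show False
      using b_nz s(1) by simp
  qed
  obtain e g cc R J :: real where form: "e \<ge> 0" "g \<ge> 0" "e * g = cc\<^sup>2" "R\<^sup>2 + J\<^sup>2 = (1 + cc)\<^sup>2"
    "P 1 = of_real ((of_int \<bar>b\<bar> * s) * ((e + g)\<^sup>2 - 4 * (R - 1)\<^sup>2))"
    "P (-1) = of_real ((of_int \<bar>b\<bar> * s) * ((e + g)\<^sup>2 - 4 * (R + 1)\<^sup>2))"
    "P (-\<i>) = of_real ((of_int \<bar>b\<bar> * s) * ((e - g)\<^sup>2 + 4 * (J + 1)\<^sup>2))"
    "P \<i> = of_real ((of_int \<bar>b\<bar> * s) * ((e - g)\<^sup>2 + 4 * (J - 1)\<^sup>2))"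
    using rotation_product_real_form[OF ct nz] unfolding param[symmetric] W[symmetric] Wn P_def by blast
  have i_w4: "\<exists>r. \<i> * w 4 = of_real r \<and> r \<noteq> 0"
    using w4 s(1) by (auto intro: exI[of _ s] exI[of _ "- s"])
  have 1: "Im (conj_product f zeta8 + conj_product' f zeta8) = 0"
    unfolding P1 P3 form by simp
  have 2: "Im ((conj_product' f zeta8 - conj_product f zeta8) / (\<i> * w 4)) = 0"
    using i_w4 unfolding P1 P3 form by (auto simp flip: of_real_diff of_real_divide)
  obtain e0 e1 q0 q1 :: int where
    vals: "\<And>z r. (z, r) \<in> {(zeta8, of_real (sqrt 2)), (- zeta8, - of_real (sqrt 2))} \<Longrightarrow>
       conj_product f z = 4 * of_int d * (of_int e0 + of_int e1 * r) - 2 * of_int b * (\<i> * w 4) * (of_int q0 + of_int q1 * r) \<and>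
       conj_product' f z = 4 * of_int d * (of_int e0 + of_int e1 * r) + 2 * of_int b * (\<i> * w 4) * (of_int q0 + of_int q1 * r)" and
    unit: "\<bar>(b\<^sup>2 * (q0\<^sup>2 + 2 * q1\<^sup>2) + 4 * d * (e0\<^sup>2 + 2 * e1\<^sup>2))\<^sup>2 - 2 * (2 * b\<^sup>2 * q0 * q1 + 8 * d * e0 * e1)\<^sup>2\<bar> = 1"
    by (rule real_parts[OF 1 2], rule that)
  have vals': "conj_product f z = 4 * of_int d * (of_int e0 + of_int e1 * r) - 2 * (of_int (\<epsilon> * \<bar>b\<bar>) * of_real s) * (of_int q0 + of_int q1 * r) \<and>
       conj_product' f z = 4 * of_int d * (of_int e0 + of_int e1 * r) + 2 * (of_int (\<epsilon> * \<bar>b\<bar>) * of_real s) * (of_int q0 + of_int q1 * r)"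
    if "(z, r) \<in> {(zeta8, of_real (sqrt 2)), (- zeta8, - of_real (sqrt 2))}" for z r
    unfolding eps(2)[symmetric] using vals[OF that] by (simp only: mult.assoc)
  define v :: "nat \<Rightarrow> real" where "v = (\<lambda>k. Re (P (if k = 0 then 1 else if k = 1 then - \<i> else if k = 2 then -1 else \<i>)))"
  have v_eq: "v 0 = Re (P 1)" "v 1 = Re (P (- \<i>))" "v 2 = Re (P (-1))" "v 3 = Re (P \<i>)"
    by (simp_all add: v_def)
  have v: "v 0 = real_of_int (2 * - d) * (of_int (- 2 * e0) + of_int (- 2 * e1) * sqrt 2) - 2 * s * of_int \<bar>b\<bar> * (of_int (\<epsilon> * q0) + of_int (\<epsilon> * q1) * sqrt 2)"
      "v 1 = real_of_int (2 * - d) * (of_int (- 2 * e0) + of_int (- 2 * e1) * sqrt 2) + 2 * s * of_int \<bar>b\<bar> * (of_int (\<epsilon> * q0) + of_int (\<epsilon> * q1) * sqrt 2)"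
      "v 2 = real_of_int (2 * - d) * (of_int (- 2 * e0) - of_int (- 2 * e1) * sqrt 2) - 2 * s * of_int \<bar>b\<bar> * (of_int (\<epsilon> * q0) - of_int (\<epsilon> * q1) * sqrt 2)"
      "v 3 = real_of_int (2 * - d) * (of_int (- 2 * e0) - of_int (- 2 * e1) * sqrt 2) + 2 * s * of_int \<bar>b\<bar> * (of_int (\<epsilon> * q0) - of_int (\<epsilon> * q1) * sqrt 2)"
  proof -
    have h: "(zeta8, of_real (sqrt 2)) \<in> {(zeta8, complex_of_real (sqrt 2)), (- zeta8, - of_real (sqrt 2))}"
      "(- zeta8, of_real (- sqrt 2)) \<in> {(zeta8, complex_of_real (sqrt 2)), (- zeta8, - of_real (sqrt 2))}"
      by simp_all
    show "v 0 = real_of_int (2 * - d) * (of_int (- 2 * e0) + of_int (- 2 * e1) * sqrt 2) - 2 * s * of_int \<bar>b\<bar> * (of_int (\<epsilon> * q0) + of_int (\<epsilon> * q1) * sqrt 2)"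
      unfolding v_eq P1[symmetric] by (rule Re_quadratic_form(1)[OF vals'[OF h(1), THEN conjunct1]])
    show "v 1 = real_of_int (2 * - d) * (of_int (- 2 * e0) + of_int (- 2 * e1) * sqrt 2) + 2 * s * of_int \<bar>b\<bar> * (of_int (\<epsilon> * q0) + of_int (\<epsilon> * q1) * sqrt 2)"
      unfolding v_eq P3[symmetric] by (rule Re_quadratic_form(2)[OF vals'[OF h(1), THEN conjunct2]])
    show "v 2 = real_of_int (2 * - d) * (of_int (- 2 * e0) - of_int (- 2 * e1) * sqrt 2) - 2 * s * of_int \<bar>b\<bar> * (of_int (\<epsilon> * q0) - of_int (\<epsilon> * q1) * sqrt 2)"
      unfolding v_eq P2[symmetric] using Re_quadratic_form(1)[OF vals'[OF h(2), THEN conjunct1]] by (simp only: mult_minus_right add_uminus_conv_diff)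
    show "v 3 = real_of_int (2 * - d) * (of_int (- 2 * e0) - of_int (- 2 * e1) * sqrt 2) + 2 * s * of_int \<bar>b\<bar> * (of_int (\<epsilon> * q0) - of_int (\<epsilon> * q1) * sqrt 2)"
      unfolding v_eq P4[symmetric] using Re_quadratic_form(2)[OF vals'[OF h(2), THEN conjunct2]] by (simp only: mult_minus_right add_uminus_conv_diff)
  qed
  have "\<bar>b\<bar>\<^sup>2 = 1"
  proof (rule unit_sum_of_squares_pos[where v = v and a = "\<bar>b\<bar>" and d = "- d" and ?e0.0 = "- 2 * e0" and ?e1.0 = "- 2 * e1"
        and ?q0.0 = "\<epsilon> * q0" and ?q1.0 = "\<epsilon> * q1" and s = s and e = e and g = g and c = cc and R = R and J = J, OF _ _ _ _ _ _ _ s v form(1-4)])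
    show "\<bar>b\<bar> > 0" "odd \<bar>b\<bar>"
      using b_nz odd_a by simp_all
    show "- d \<ge> 2" "squarefree (- d)" "(- d) mod 4 \<noteq> 3" "even (- 2 * e0)" "even (- 2 * e1)"
      using d squarefree_d d_mod_4 by (simp_all add: squarefree_def) presburger
    show "v 0 = of_int \<bar>b\<bar> * s * ((e + g)\<^sup>2 - 4 * (R - 1)\<^sup>2)" "v 2 = of_int \<bar>b\<bar> * s * ((e + g)\<^sup>2 - 4 * (R + 1)\<^sup>2)"
      "v 1 = of_int \<bar>b\<bar> * s * ((e - g)\<^sup>2 + 4 * (J + 1)\<^sup>2)" "v 3 = of_int \<bar>b\<bar> * s * ((e - g)\<^sup>2 + 4 * (J - 1)\<^sup>2)"
      unfolding v_eq form(5-8) by (rule Re_complex_of_real)+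
    have "\<epsilon>\<^sup>2 = 1"
      using eps(1) by auto
    then show "\<bar>(\<bar>b\<bar>\<^sup>2 * ((\<epsilon> * q0)\<^sup>2 + 2 * (\<epsilon> * q1)\<^sup>2) - - d * ((- 2 * e0)\<^sup>2 + 2 * (- 2 * e1)\<^sup>2))\<^sup>2
        - 2 * (2 * \<bar>b\<bar>\<^sup>2 * (\<epsilon> * q0) * (\<epsilon> * q1) - 2 * - d * (- 2 * e0) * (- 2 * e1))\<^sup>2\<bar> = 1"
    proof -
      have 1: "\<bar>b\<bar>\<^sup>2 * ((\<epsilon> * q0)\<^sup>2 + 2 * (\<epsilon> * q1)\<^sup>2) - - d * ((- 2 * e0)\<^sup>2 + 2 * (- 2 * e1)\<^sup>2) = b\<^sup>2 * (q0\<^sup>2 + 2 * q1\<^sup>2) + 4 * d * (e0\<^sup>2 + 2 * e1\<^sup>2)"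
        unfolding power2_abs using \<open>\<epsilon>\<^sup>2 = 1\<close> by Groebner_Basis.algebra
      have 2: "2 * \<bar>b\<bar>\<^sup>2 * (\<epsilon> * q0) * (\<epsilon> * q1) - 2 * - d * (- 2 * e0) * (- 2 * e1) = 2 * b\<^sup>2 * q0 * q1 + 8 * d * e0 * e1"
        unfolding power2_abs using \<open>\<epsilon>\<^sup>2 = 1\<close> by Groebner_Basis.algebra
      show ?thesis
        unfolding 1 2 by (rule unit)
    qed
  qed
  then show ?thesis
    by simp
qed

end

section \<open>Monogenic fields\<close>

lemma ring_of_type_algebra_sel [simp]:
  "carrier (ring_of_type_algebra :: 'a::field ring) = UNIV"
  "\<one>\<^bsub>ring_of_type_algebra\<^esub> = (1 :: 'a::field)"
  "\<zero>\<^bsub>ring_of_type_algebra\<^esub> = (0 :: 'a::field)"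
  "u \<otimes>\<^bsub>ring_of_type_algebra\<^esub> v = u * (v :: 'a::field)"
  "u \<oplus>\<^bsub>ring_of_type_algebra\<^esub> v = u + (v :: 'a::field)"
  by (simp_all add: ring_of_type_algebra_def)

lemma ring_of_type_algebra_inverses [simp]:
  fixes u :: "'a::field"
  shows "\<ominus>\<^bsub>ring_of_type_algebra\<^esub> u = - u"
    and "u \<noteq> 0 \<Longrightarrow> inv\<^bsub>ring_of_type_algebra\<^esub> u = inverse u"
proof -
  interpret R: Ring.field "ring_of_type_algebra :: 'a ring"
    by (rule field_from_type_algebra)
  show "\<ominus>\<^bsub>ring_of_type_algebra\<^esub> u = - u"
    by (rule R.minus_equality) simp_all
  show "inv\<^bsub>ring_of_type_algebra\<^esub> u = inverse u" if "u \<noteq> 0"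
    by (rule R.comm_inv_char) (use that in simp_all)
qed

lemma rat_adjoin_closed:
  fixes z :: "'a::field_char_0"
  shows rat_adjoin_1: "1 \<in> rat_adjoin z"
    and rat_adjoin_self: "z \<in> rat_adjoin z"
    and rat_adjoin_uminus: "u \<in> rat_adjoin z \<Longrightarrow> - u \<in> rat_adjoin z"
    and rat_adjoin_inverse: "u \<in> rat_adjoin z \<Longrightarrow> u \<noteq> 0 \<Longrightarrow> inverse u \<in> rat_adjoin z"
    and rat_adjoin_add: "u \<in> rat_adjoin z \<Longrightarrow> v \<in> rat_adjoin z \<Longrightarrow> u + v \<in> rat_adjoin z"
    and rat_adjoin_mult: "u \<in> rat_adjoin z \<Longrightarrow> v \<in> rat_adjoin z \<Longrightarrow> u * v \<in> rat_adjoin z"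
  using generate_field.one[of ring_of_type_algebra "{z}"] generate_field.incl[of z "{z}" ring_of_type_algebra]
    generate_field.a_inv[of u ring_of_type_algebra "{z}"] generate_field.m_inv[of u ring_of_type_algebra "{z}"]
    generate_field.eng_add[of u ring_of_type_algebra "{z}" v] generate_field.eng_mult[of u ring_of_type_algebra "{z}" v]
  by (simp_all add: rat_adjoin_def)

lemma rat_adjoin_power: "z ^ n \<in> rat_adjoin z"
  by (induction n) (auto intro: rat_adjoin_closed)

lemma rat_adjoin_of_int: "of_int n \<in> rat_adjoin z"
proof (induction n rule: int_induct[of _ 0])
  case base
  show ?case
    using rat_adjoin_add[OF rat_adjoin_1 rat_adjoin_uminus[OF rat_adjoin_1], of z] by simp
next
  case (step1 i)
  then show ?case
    using rat_adjoin_add[OF _ rat_adjoin_1] by simp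
next
  case (step2 i)
  then show ?case
    using rat_adjoin_add[OF _ rat_adjoin_uminus[OF rat_adjoin_1], of "of_int i" z] by simp
qed

section \<open>Field elements as polynomial functions of the root\<close>

lemma int_adjoin_imp_int_poly:
  assumes "u \<in> int_adjoin \<theta>"
  shows "\<exists>p. u = poly (map_poly of_int p) \<theta>"
  using assms unfolding int_adjoin_def
proof (induction rule: generate_ring.induct)
  case one
  show ?case
    by (rule exI[of _ "[:1:]"]) (simp add: of_int_hom.map_poly_pCons_hom)
next
  case (incl h)
  then show ?case
    by (intro exI[of _ "[:0, 1:]"]) (simp add: of_int_hom.map_poly_pCons_hom)
next
  case (a_inv h)
  then obtain p where "h = poly (map_poly of_int p) \<theta>"
    by blast
  then show ?case
    by (intro exI[of _ "- p"]) (simp add: of_int_poly_hom.hom_uminus)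
next
  case (eng_add h1 h2)
  then obtain p q where "h1 = poly (map_poly of_int p) \<theta>" "h2 = poly (map_poly of_int q) \<theta>"
    by blast
  then show ?case
    by (intro exI[of _ "p + q"]) (simp add: of_int_poly_hom.hom_add)
next
  case (eng_mult h1 h2)
  then obtain p q where "h1 = poly (map_poly of_int p) \<theta>" "h2 = poly (map_poly of_int q) \<theta>"
    by blast
  then show ?case
    by (intro exI[of _ "p * q"]) (simp add: of_int_poly_hom.hom_mult)
qed

interpretation of_rat_poly_hom: map_poly_idom_hom "of_rat :: rat \<Rightarrow> complex"
  by (unfold_locales; auto simp: of_rat_add of_rat_mult)

text \<open>Elements of \<rat>(\<alpha>) are represented by such functions, so that conjugation is
  evaluation at another root.\<close>

definition rat_poly_fun :: "(complex \<Rightarrow> complex) \<Rightarrow> bool" where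
  "rat_poly_fun F \<longleftrightarrow> (\<exists>p :: rat poly. \<forall>z. F z = poly (map_poly of_rat p) z)"

lemma rat_poly_fun_const: "rat_poly_fun (\<lambda>z. of_rat c)"
  unfolding rat_poly_fun_def by (rule exI[of _ "[:c:]"]) (simp add: of_rat_hom.map_poly_pCons_hom)

lemma rat_poly_fun_id: "rat_poly_fun (\<lambda>z. z)"
  unfolding rat_poly_fun_def by (rule exI[of _ "[:0, 1:]"]) (simp add: of_rat_hom.map_poly_pCons_hom)

lemma rat_poly_fun_add: "rat_poly_fun F \<Longrightarrow> rat_poly_fun G \<Longrightarrow> rat_poly_fun (\<lambda>z. F z + G z)"
  unfolding rat_poly_fun_def by (metis of_rat_poly_hom.hom_add poly_add)

lemma rat_poly_fun_mult: "rat_poly_fun F \<Longrightarrow> rat_poly_fun G \<Longrightarrow> rat_poly_fun (\<lambda>z. F z * G z)"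
  unfolding rat_poly_fun_def by (metis of_rat_poly_hom.hom_mult poly_mult)

lemma rat_poly_fun_diff: "rat_poly_fun F \<Longrightarrow> rat_poly_fun G \<Longrightarrow> rat_poly_fun (\<lambda>z. F z - G z)"
  unfolding rat_poly_fun_def by (metis of_rat_poly_hom.hom_minus poly_diff)

lemma rat_poly_fun_power: "rat_poly_fun (\<lambda>z. z ^ n)"
  using rat_poly_fun_const[of 1] by (induction n) (auto intro: rat_poly_fun_mult rat_poly_fun_id)

lemma rat_poly_fun_int_poly:
  assumes "rat_poly_fun F"
  shows "rat_poly_fun (\<lambda>z. poly (map_poly of_int p) (F z))"
proof (induction p)
  case 0
  show ?case
    using rat_poly_fun_const[of 0] by simp
next
  case (pCons c p)
  have "rat_poly_fun (\<lambda>z. of_rat (of_int c) + F z * poly (map_poly of_int p) (F z))"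
    by (intro rat_poly_fun_add rat_poly_fun_const rat_poly_fun_mult assms pCons.IH)
  then show ?case
    by (simp add: of_int_hom.map_poly_pCons_hom)
qed

text \<open>Evaluate a Bezout identity for the coprime polynomials \<open>f\<close> and
  \<open>g\<close> at the root of \<open>f\<close>.\<close>

lemma irreducible_root_inverse:
  fixes f g :: "rat poly" and z :: complex
  assumes "Factorial_Ring.irreducible f" "poly (map_poly of_rat f) z = 0" "\<not> f dvd g"
  shows "\<exists>h. poly (map_poly of_rat h) z * poly (map_poly of_rat g) z = 1"
proof -
  have "prime_elem f"
    using assms(1) by (rule irreducible_imp_prime_elem_gcd)
  then have "gcd f g = 1"
    using prime_elem_imp_coprime[OF _ assms(3)] by (simp add: coprime_iff_gcd_eq_1)
  then obtain s h where "s * f + h * g = 1"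
    using bezout_coefficients_fst_snd[of f g] by metis
  then have "poly (map_poly of_rat (s * f + h * g)) z = poly (map_poly of_rat 1) z"
    by (rule arg_cong)
  then have "poly (map_poly of_rat h) z * poly (map_poly of_rat g) z = 1"
    unfolding of_rat_poly_hom.hom_add of_rat_poly_hom.hom_mult of_rat_poly_hom.hom_one poly_add poly_mult assms(2) by simp
  then show ?thesis
    by blast
qed

lemma rat_adjoin_imp_rat_poly_fun:
  assumes f: "Factorial_Ring.irreducible f" "poly (map_poly of_rat f) \<alpha> = 0" and u: "u \<in> rat_adjoin \<alpha>"
  shows "\<exists>F. rat_poly_fun F \<and> F \<alpha> = u"
  using u unfolding rat_adjoin_def
proof (induction rule: generate_field.induct)
  case one
  show ?case
    using rat_poly_fun_const[of 1] by (intro exI[of _ "\<lambda>_. 1"]) simp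
next
  case (incl h)
  then show ?case
    using rat_poly_fun_id by (intro exI[of _ "\<lambda>z. z"]) simp
next
  case (a_inv h)
  then obtain F where "rat_poly_fun F" "F \<alpha> = h"
    by blast
  then show ?case
    using rat_poly_fun_diff[OF rat_poly_fun_const[of 0], of F] by (intro exI[of _ "\<lambda>z. 0 - F z"]) simp
next
  case (m_inv h)
  then obtain F where F: "rat_poly_fun F" "F \<alpha> = h" and h: "h \<noteq> 0"
    by auto
  then obtain g where g: "h = poly (map_poly of_rat g) \<alpha>"
    unfolding rat_poly_fun_def by metis
  have "\<not> f dvd g"
  proof
    assume "f dvd g"
    then obtain q where "g = f * q" ..
    then show False
      using g h f(2) by (simp add: of_rat_poly_hom.hom_mult)
  qed
  then obtain q where "poly (map_poly of_rat q) \<alpha> * h = 1"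
    using irreducible_root_inverse[OF f] g by blast
  then have "poly (map_poly of_rat q) \<alpha> = inverse h"
    using h by (simp add: field_simps)
  then show ?case
    using h by (intro exI[of _ "poly (map_poly of_rat q)"]) (auto simp: rat_poly_fun_def)
next
  case (eng_add h1 h2)
  then obtain F G where "rat_poly_fun F" "F \<alpha> = h1" "rat_poly_fun G" "G \<alpha> = h2"
    by blast
  then show ?case
    using rat_poly_fun_add[of F G] by (intro exI[of _ "\<lambda>z. F z + G z"]) simp
next
  case (eng_mult h1 h2)
  then obtain F G where "rat_poly_fun F" "F \<alpha> = h1" "rat_poly_fun G" "G \<alpha> = h2"
    by blast
  then show ?case
    using rat_poly_fun_mult[of F G] by (intro exI[of _ "\<lambda>z. F z * G z"]) simp
qed

lemma rat_poly_fun_conjugate_zero: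
  assumes f: "Factorial_Ring.irreducible f" "poly (map_poly of_rat f) \<alpha> = 0" "poly (map_poly of_rat f) \<beta> = 0"
    and F: "rat_poly_fun F" "F \<alpha> = 0"
  shows "F \<beta> = 0"
proof -
  obtain g where g: "\<And>z. F z = poly (map_poly of_rat g) z"
    using F(1) unfolding rat_poly_fun_def by blast
  have "f dvd g"
  proof (rule ccontr)
    assume "\<not> f dvd g"
    from irreducible_root_inverse[OF f(1,2) this] show False
      using F(2) g by simp
  qed
  then obtain q where "g = f * q" ..
  then show ?thesis
    using g f(3) by (simp add: of_rat_poly_hom.hom_mult)
qed

lemma rat_poly_fun_octic:
  assumes "rat_poly_fun F"
  shows "\<exists>y. \<forall>z. z ^ 8 = of_int m \<longrightarrow> F z = (\<Sum>j<8. of_rat (y j) * z ^ j)"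
proof -
  have step: "C + z * (Y0 * z ^ 0 + Y1 * z ^ 1 + Y2 * z ^ 2 + Y3 * z ^ 3 + Y4 * z ^ 4 + Y5 * z ^ 5 + Y6 * z ^ 6 + Y7 * z ^ 7)
      = (C + Y7 * M) * z ^ 0 + Y0 * z ^ 1 + Y1 * z ^ 2 + Y2 * z ^ 3 + Y3 * z ^ 4 + Y4 * z ^ 5 + Y5 * z ^ 6 + Y6 * z ^ 7"
    if "z ^ 8 = M" for C z Y0 Y1 Y2 Y3 Y4 Y5 Y6 Y7 M :: complex
    unfolding that[symmetric] by (simp add: algebra_simps eval_nat_numeral)
  have "\<exists>y. \<forall>z :: complex. z ^ 8 = of_int m \<longrightarrow> poly (map_poly of_rat p) z = (\<Sum>j<8. of_rat (y j) * z ^ j)" for p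
  proof (induction p)
    case 0
    show ?case
      by (rule exI[of _ "\<lambda>_. 0"]) simp
  next
    case (pCons c p)
    then obtain y where y: "\<And>z :: complex. z ^ 8 = of_int m \<Longrightarrow> poly (map_poly of_rat p) z = (\<Sum>j<8. of_rat (y j) * z ^ j)"
      by blast
    define y' where "y' j = (if j = 0 then c + y 7 * of_int m else y (j - 1))" for j :: nat
    have y': "y' 0 = c + y 7 * of_int m" "y' 1 = y 0" "y' 2 = y 1" "y' 3 = y 2" "y' 4 = y 3" "y' 5 = y 4" "y' 6 = y 5" "y' 7 = y 6"
      by (simp_all add: y'_def)
    have "poly (map_poly of_rat (pCons c p)) z = (\<Sum>j<8. of_rat (y' j) * z ^ j)" if z: "z ^ 8 = of_int m" for z :: complex
    proof -
      have "poly (map_poly of_rat (pCons c p)) z = of_rat c + z * (\<Sum>j<8. of_rat (y j) * z ^ j)"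
        using y[OF z] by (simp add: of_rat_hom.map_poly_pCons_hom)
      then show ?thesis
        unfolding sum_lessThan8 step[OF z] y' of_rat_add of_rat_mult of_rat_of_int_eq .
    qed
    then show ?case
      by blast
  qed
  then show ?thesis
    using assms unfolding rat_poly_fun_def by metis
qed

section \<open>Coordinates of algebraic integers up to a factor 8\<close>

lemma zeta8_powers:
  "zeta8 ^ 5 = - zeta8" "zeta8 ^ 6 = - \<i>" "zeta8 ^ 7 = - (\<i> * zeta8)" "zeta8 ^ 8 = 1"
proof -
  show "zeta8 ^ 5 = - zeta8" "zeta8 ^ 6 = - \<i>" "zeta8 ^ 7 = - (\<i> * zeta8)" "zeta8 ^ 8 = 1"
    using zeta8_pow4(1) zeta8_square zeta8_cube power_add[of zeta8 4 1] power_add[of zeta8 4 2] power_add[of zeta8 4 3] power_add[of zeta8 4 4]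
    by simp_all
qed

lemma zeta8_power_neq_1:
  assumes "0 < k" "k < 8"
  shows "zeta8 ^ k \<noteq> 1"
proof -
  have ne: "zeta8 \<noteq> 1" "\<i> \<noteq> 1" "\<i> * zeta8 \<noteq> 1" "(-1 :: complex) \<noteq> 1" "- zeta8 \<noteq> 1" "- \<i> \<noteq> 1" "- (\<i> * zeta8) \<noteq> 1"
    by (simp_all add: zeta8_def complex_eq_iff)
  have "k \<in> {1, 2, 3, 4, 5, 6, 7}"
    using assms by auto
  then show ?thesis
    by (elim insertE) (simp_all only: ne zeta8_square zeta8_cube zeta8_pow4(1) zeta8_powers power_one_right empty_iff simp_thms)
qed

lemma zeta8_power_sum: "(\<Sum>k<8. (zeta8 ^ n) ^ k) = (if 8 dvd n then 8 else 0)"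
proof (cases "8 dvd n")
  case True
  then obtain q where "n = 8 * q" ..
  then show ?thesis
    by (simp add: power_mult zeta8_powers(4))
next
  case False
  have "zeta8 ^ n = (zeta8 ^ 8) ^ (n div 8) * zeta8 ^ (n mod 8)"
    by (simp flip: power_mult power_add)
  then have "zeta8 ^ n = zeta8 ^ (n mod 8)"
    by (simp add: zeta8_powers(4))
  then have ne: "zeta8 ^ n \<noteq> 1"
    using zeta8_power_neq_1[of "n mod 8"] False by (simp add: mod_greater_zero_iff_not_dvd)
  have "(zeta8 ^ n) ^ 8 = (zeta8 ^ 8) ^ n"
    by (simp add: mult.commute flip: power_mult)
  then have "(zeta8 ^ n) ^ 8 = 1"
    by (simp add: zeta8_powers(4))
  then show ?thesis
    using False geometric_sum[OF ne, of 8] by simp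
qed

text \<open>Averaging over the conjugates isolates one coefficient.\<close>

lemma algebraic_int_octic_coefficient:
  assumes F: "\<And>z. z ^ 8 = M \<Longrightarrow> F z = (\<Sum>i<8. y i * z ^ i)" "\<And>z. z ^ 8 = M \<Longrightarrow> algebraic_int (F z)"
    and \<alpha>: "\<alpha> ^ 8 = M" and j: "j < 8"
  shows "algebraic_int (8 * y j * \<alpha> ^ j :: complex)"
proof -
  have root: "(\<alpha> * zeta8 ^ k) ^ 8 = M" for k
    unfolding power_mult_distrib \<alpha> power_mult[symmetric] mult.commute[of k] unfolding power_mult zeta8_powers(4) by simp
  \<comment> \<open>The factor \<open>zeta8 ^ (8 - j)\<close> is the inverse of
    \<open>zeta8 ^ j\<close> as a natural power; summing over k then kills every index except
    j.\<close>
  have "(\<Sum>k<8. F (\<alpha> * zeta8 ^ k) * (zeta8 ^ (8 - j)) ^ k) = (\<Sum>k<8. \<Sum>i<8. y i * \<alpha> ^ i * (zeta8 ^ (i + (8 - j))) ^ k)"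
  proof (intro sum.cong refl)
    fix k
    have "(zeta8 ^ k) ^ i * (zeta8 ^ (8 - j)) ^ k = (zeta8 ^ (i + (8 - j))) ^ k" for i
      by (simp add: power_add power_mult_distrib mult.commute flip: power_mult)
    then show "F (\<alpha> * zeta8 ^ k) * (zeta8 ^ (8 - j)) ^ k = (\<Sum>i<8. y i * \<alpha> ^ i * (zeta8 ^ (i + (8 - j))) ^ k)"
      unfolding F(1)[OF root] power_mult_distrib sum_distrib_right by (simp only: mult.assoc)
  qed
  also have "\<dots> = (\<Sum>i<8. y i * \<alpha> ^ i * (\<Sum>k<8. (zeta8 ^ (i + (8 - j))) ^ k))"
    unfolding sum_distrib_left by (rule sum.swap)
  also have "\<dots> = (\<Sum>i<8. if i = j then 8 * y i * \<alpha> ^ i else 0)"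
  proof (intro sum.cong refl)
    fix i :: nat assume "i \<in> {..<8}"
    then have "8 dvd i + (8 - j) \<longleftrightarrow> i = j"
      using j by (simp only: lessThan_iff) presburger
    then show "y i * \<alpha> ^ i * (\<Sum>k<8. (zeta8 ^ (i + (8 - j))) ^ k) = (if i = j then 8 * y i * \<alpha> ^ i else 0)"
      unfolding zeta8_power_sum by simp
  qed
  also have "\<dots> = 8 * y j * \<alpha> ^ j"
    using j by simp
  finally show ?thesis
    by (rule subst) (intro algebraic_int_sum algebraic_int_mult algebraic_int_power F(2)[OF root]
        algebraic_int_eighth_root[OF zeta8_powers(4)])
qed

text \<open>A prime divides at most one a_k, and that one only to the first power, so its exponent
  in the product is e k < 8.\<close>

lemma not_eighth_power_dvd_prod:
  fixes a :: "nat \<Rightarrow> int"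
  assumes q: "prime q" and cop: "\<And>i j. i \<in> {1..7} \<Longrightarrow> j \<in> {1..7} \<Longrightarrow> i \<noteq> j \<Longrightarrow> coprime (a i) (a j)"
    and sqf: "\<And>i. i \<in> {1..7} \<Longrightarrow> squarefree (a i)" and e: "\<And>i. e i < (8::nat)"
  shows "\<not> q ^ 8 dvd (\<Prod>i=1..7. a i ^ e i)"
proof
  assume dvd: "q ^ 8 dvd (\<Prod>i=1..7. a i ^ e i)"
  have "q dvd (\<Prod>i=1..7. a i ^ e i)"
    by (rule dvd_trans[OF _ dvd]) simp
  then obtain k where k: "k \<in> {1..7}" "q dvd a k ^ e k"
    using q by (auto simp: prime_dvd_prod_iff)
  then have qk: "q dvd a k"
    using q prime_dvd_power by blast
  have "coprime (q ^ 8) (\<Prod>i\<in>{1..7} - {k}. a i ^ e i)"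
  proof (rule prod_coprime_right)
    fix i assume "i \<in> {1..7} - {k}"
    then have "\<not> q dvd a i"
      using cop[of i k] k(1) qk q by (metis DiffD1 DiffD2 coprime_common_divisor insertI1 not_prime_unit)
    then have "coprime q (a i)"
      using q by (simp add: prime_imp_coprime)
    then show "coprime (q ^ 8) (a i ^ e i)"
      by simp
  qed
  moreover have "(\<Prod>i=1..7. a i ^ e i) = a k ^ e k * (\<Prod>i\<in>{1..7} - {k}. a i ^ e i)"
    using k(1) by (intro prod.remove) simp_all
  ultimately have dvd_k: "q ^ 8 dvd a k ^ e k"
    using dvd by (simp add: coprime_dvd_mult_left_iff)
  obtain c where c: "a k = q * c"
    using qk ..
  have "\<not> q dvd c"
  proof
    assume "q dvd c"
    then have "q\<^sup>2 dvd a k"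
      unfolding c power2_eq_square by simp
    then show False
      using sqf[OF k(1)] q unfolding squarefree_def by (metis not_prime_unit)
  qed
  have "q ^ 8 = q ^ e k * q ^ (8 - e k)"
    using e[of k] by (simp flip: power_add)
  then have "q ^ e k * q ^ (8 - e k) dvd q ^ e k * c ^ e k"
    using dvd_k unfolding c power_mult_distrib by simp
  then have "q ^ (8 - e k) dvd c ^ e k"
    using q by (simp add: dvd_mult_cancel_left)
  moreover have "q dvd q ^ (8 - e k)"
    using e[of k] by simp
  ultimately have "q dvd c ^ e k"
    by (rule dvd_trans[rotated])
  then show False
    using q \<open>\<not> q dvd c\<close> prime_dvd_power by blast
qed

text \<open>The eighth power r^8 R is rational and integral. In lowest terms the denominator's
  eighth power must divide \<open>R\<close>, which has no eighth power of a prime as a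
  divisor.\<close>

lemma rat_in_Ints_of_algebraic_int:
  fixes W :: complex and r :: rat
  assumes "algebraic_int (of_rat r * W)" "W ^ 8 = of_int R" "\<And>q :: int. prime q \<Longrightarrow> \<not> q ^ 8 dvd R"
  shows "r \<in> \<int>"
proof -
  have "of_rat (r ^ 8 * of_int R) = (of_rat r * W) ^ 8"
    by (simp add: of_rat_mult of_rat_power power_mult_distrib assms(2))
  then have "algebraic_int (of_rat (r ^ 8 * of_int R) :: complex)"
    using assms(1) by auto
  then have "(of_rat (r ^ 8 * of_int R) :: complex) \<in> \<int>"
    by (rule rational_algebraic_int_is_int) simp
  then obtain n where "of_rat (r ^ 8 * of_int R) = (of_int n :: complex)"
    by (elim Ints_cases)
  then have n: "r ^ 8 * of_int R = of_int n"
    by (metis of_rat_eq_iff of_rat_of_int_eq)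
  obtain p q where pq: "r = Rat.Fract p q" "q > 0" "coprime p q"
    by (cases r) auto
  have "of_int (p ^ 8 * R) = (of_int (n * q ^ 8) :: rat)"
    using n pq(2) by (simp add: pq(1) Rat.Fract_of_int_quotient field_simps)
  then have "p ^ 8 * R = n * q ^ 8"
    by (simp only: of_int_eq_iff)
  then have "q ^ 8 dvd p ^ 8 * R"
    by simp
  moreover have "coprime (q ^ 8) (p ^ 8)"
    using pq(3) by (simp add: coprime_commute)
  ultimately have dvd: "q ^ 8 dvd R"
    by (simp add: coprime_dvd_mult_right_iff)
  have "is_unit q"
  proof (rule ccontr)
    assume "\<not> is_unit q"
    then obtain s where "s dvd q" "prime s"
      using pq(2) prime_divisor_exists[of q] by auto
    then show False
      using assms(3)[of s] dvd by (meson dvd_power_same dvd_trans)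
  qed
  then have "q = 1"
    using pq(2) by simp
  then show ?thesis
    by (simp add: pq(1) Rat.Fract_of_int_quotient)
qed

section \<open>Removing the factor 8: parity of the coordinates\<close>

lemma even_of_algebraic_int_half:
  assumes "of_int n = 2 * (z :: complex)" "algebraic_int z"
  shows "even n"
proof -
  have "z = of_int n / of_int 2"
    using assms(1) by simp
  then have "z \<in> \<rat>"
    by (metis Rats_divide Rats_of_int)
  then have "z \<in> \<int>"
    using assms(2) by (rule rational_algebraic_int_is_int[rotated])
  then obtain k where "z = of_int k"
    by (elim Ints_cases)
  then have "(of_int n :: complex) = of_int (2 * k)"
    using assms(1) by simp
  then show ?thesis
    unfolding of_int_eq_iff by simp
qed

text \<open>
  The element \<open>l\<close> generates the totally ramified prime above \<open>2\<close>, and the \<open>u t\<close> are units there, so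
  the terms with odd coefficients have distinct valuations below that of \<open>2\<close>.
\<close>

lemma even_coefficients_at_ramified:
  fixes l \<kappa> \<kappa>' S :: complex and c U :: "nat \<Rightarrow> int" and u :: "nat \<Rightarrow> complex" and n :: int
  assumes l: "l ^ 8 = 2 * \<kappa>" "algebraic_int l"
    and \<kappa>: "\<kappa> = of_int n + l * \<kappa>'" "odd n" "algebraic_int \<kappa>'"
    and u: "\<And>t. t < 8 \<Longrightarrow> algebraic_int (u t)" "\<And>t. t < 8 \<Longrightarrow> u t ^ 8 = of_int (U t)" "\<And>t. t < 8 \<Longrightarrow> odd (U t)"
    and sum: "(\<Sum>t<8. of_int (c t) * u t * l ^ t) = 2 * S" "algebraic_int S"
  shows "t < 8 \<Longrightarrow> even (c t)"
proof (induction t rule: less_induct)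
  case (less t)
  define e where "e s = c s div 2" for s
  have e: "c s = 2 * e s" if "s < t" for s
    using less.IH[OF that] less.prems that by (simp add: e_def)
  define E where "E = (\<Sum>s<t. of_int (e s) * u s * l ^ s)"
  define R where "R = (\<Sum>s\<in>{Suc t..<8}. of_int (c s) * u s * l ^ (s - Suc t))"
  have split: "(\<Sum>s<8. h s) = (\<Sum>s<t. h s) + h t + (\<Sum>s\<in>{Suc t..<8}. h s)" for h :: "nat \<Rightarrow> complex"
    using sum.atLeastLessThan_concat[of 0 "Suc t" 8 h] less.prems unfolding lessThan_atLeast0 by simp
  have low: "(\<Sum>s<t. of_int (c s) * u s * l ^ s) = 2 * E"
    unfolding E_def sum_distrib_left by (intro sum.cong refl) (simp add: e)
  have high: "(\<Sum>s\<in>{Suc t..<8}. of_int (c s) * u s * l ^ s) = l * l ^ t * R"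
    unfolding R_def sum_distrib_left
  proof (intro sum.cong refl)
    fix s assume "s \<in> {Suc t..<8}"
    then have "s = Suc t + (s - Suc t)"
      by simp
    then have "l ^ s = l * l ^ t * l ^ (s - Suc t)"
      by (metis power_add power_Suc)
    then show "of_int (c s) * u s * l ^ s = l * l ^ t * (of_int (c s) * u s * l ^ (s - Suc t))"
      by (simp only: mult_ac)
  qed
  define v where "v = of_int (c t) * u t"
  have "v * l ^ t = 2 * (S - E) - l * l ^ t * R"
    using sum(1) unfolding split low high v_def by (simp add: algebra_simps)
  moreover have "l ^ t * l * l ^ (7 - t) = 2 * \<kappa>"
  proof -
    have "8 = t + 1 + (7 - t)"
      using less.prems by simp
    then show ?thesis
      using l(1) by (metis power_add power_one_right)
  qed
  \<comment> \<open>With q = l^t and p = l^(7-t) one has q l p = 2\<kappa>. Multiplying by l p and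
    cancelling 2 shows that v \<kappa> is divisible by l.\<close>
  moreover have "v * \<kappa> = l * (p * V - \<kappa> * R)" if "v * q = 2 * V - l * q * R" "q * l * p = 2 * \<kappa>" for q p V
    using that by Groebner_Basis.algebra
  ultimately have "v * \<kappa> = l * (l ^ (7 - t) * (S - E) - \<kappa> * R)"
    by blast
  then have eq: "v * of_int n = l * (l ^ (7 - t) * (S - E) - \<kappa> * R - v * \<kappa>')" (is "_ = l * ?B")
    unfolding \<kappa>(1) by (simp add: algebra_simps)
  have int: "algebraic_int v" "algebraic_int E" "algebraic_int R" "algebraic_int \<kappa>"
    using less.prems u(1) l(2) \<kappa>(3) unfolding v_def E_def R_def \<kappa>(1)
    by (auto intro!: algebraic_int_add algebraic_int_mult algebraic_int_sum algebraic_int_power)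
  have B: "algebraic_int ?B"
    using int l(2) \<kappa>(3) sum(2) by (intro algebraic_int_diff algebraic_int_mult algebraic_int_power)
  \<comment> \<open>The eighth power turns one factor l into 2\<kappa>, so a rational integer is
    twice an algebraic integer; its factors \<open>U t\<close> and \<open>n\<close> are odd.\<close>
  have "of_int (c t ^ 8 * U t * n ^ 8) = (v * of_int n) ^ 8"
    using u(2)[OF less.prems] by (simp add: v_def power_mult_distrib)
  also have "\<dots> = 2 * (\<kappa> * ?B ^ 8)"
    unfolding eq power_mult_distrib l(1) by (simp only: mult.assoc)
  finally have "even (c t ^ 8 * U t * n ^ 8)"
    using B int(4) by (intro even_of_algebraic_int_half[of _ "\<kappa> * ?B ^ 8"] algebraic_int_mult algebraic_int_power)
  then show ?case
    using u(3)[OF less.prems] \<kappa>(2) by simp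
qed

text \<open>The binomial matrix is unitriangular, so evenness propagates from t = 7
  downwards.\<close>

lemma even_coefficients_of_even_binomial_sums:
  fixes c :: "nat \<Rightarrow> int"
  assumes "\<And>t. t < 8 \<Longrightarrow> even (\<Sum>j<8. c j * int (j choose t))"
  shows "t < 8 \<Longrightarrow> even (c t)"
proof (induction "8 - t" arbitrary: t rule: less_induct)
  case less
  have "even (\<Sum>j\<in>{..<8} - {t}. c j * int (j choose t))"
  proof (rule dvd_sum)
    fix j assume j: "j \<in> {..<8} - {t}"
    show "even (c j * int (j choose t))"
    proof (cases "j < t")
      case True
      then show ?thesis
        by (simp add: binomial_eq_0)
    next
      case False
      then show ?thesis
        using less.hyps[of j] j by auto
    qed
  qed
  moreover have "(\<Sum>j<8. c j * int (j choose t)) = c t * int (t choose t) + (\<Sum>j\<in>{..<8} - {t}. c j * int (j choose t))"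
    using less.prems by (intro sum.remove) simp_all
  ultimately show ?case
    using assms[OF less.prems] by simp
qed

context octic_radical
begin

text \<open>Here l is the eighth root of 2, and w_i is l^(k i mod 8) times an element with odd
  eighth power. Since k^2 = 1 modulo 8, multiplication by k is an involution sorting the basis by
  powers of l.\<close>

lemma even_rad_coefficients_even_radicand:
  assumes k: "k \<in> {1, 3, 5, 7}" "a k = 2 * a'" "odd a'" "\<And>i. i \<in> {1..7} \<Longrightarrow> i \<noteq> k \<Longrightarrow> odd (a i)"
    and sum: "(\<Sum>j<8. of_int (c j) * w j) = 2 * S" "algebraic_int S" and j: "j < 8"
  shows "even (c j)"
proof -
  define l where "l = complex_of_real (root 8 2)"
  have l8: "l ^ 8 = 2"
    unfolding l_def of_real_power[symmetric] by simp
  have "l \<noteq> 0"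
    using l8 by auto
  define U where "U i = (\<Prod>s=1..7. if s = k then a' ^ (k * i mod 8) else a s ^ (s * i mod 8))" for i
  define u where "u i = w i / l ^ (k * i mod 8)" for i
  have "rad_res a i = (\<Prod>s=1..7. (if s = k then 2 ^ (k * i mod 8) else 1) * (if s = k then a' ^ (k * i mod 8) else a s ^ (s * i mod 8)))" for i
    unfolding rad_res_def by (intro prod.cong refl) (simp add: k(2) power_mult_distrib)
  then have res: "rad_res a i = 2 ^ (k * i mod 8) * U i" for i
    using k(1) by (auto simp: prod.distrib U_def)
  have u8: "u i ^ 8 = of_int (U i)" for i
  proof -
    have "(l ^ n) ^ 8 = 2 ^ n" for n
      by (metis l8 mult.commute power_mult)
    then show ?thesis
      by (simp add: u_def power_divide rad_power8 res)
  qed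
  have U: "odd (U i)" for i
    using k(3,4) by (auto simp: U_def even_prod_iff)
  have w: "w i = u i * l ^ (k * i mod 8)" for i
    using \<open>l \<noteq> 0\<close> by (simp add: u_def)
  have kk: "k * (k * t mod 8) mod 8 = t" if "t < 8" for t
  proof -
    have "k * k mod 8 = 1"
      using k(1) by auto
    then have "k * k * t mod 8 = 1 * t mod 8"
      by (metis mod_mult_left_eq mult_1)
    then show ?thesis
      using that by (simp add: mod_mult_right_eq mult.assoc)
  qed
  have "(\<Sum>t<8. of_int (c (k * t mod 8)) * u (k * t mod 8) * l ^ t) = (\<Sum>i<8. of_int (c i) * w i)"
    by (rule sum.reindex_bij_witness[of _ "\<lambda>i. k * i mod 8" "\<lambda>t. k * t mod 8"]) (simp_all add: kk w)
  then have sum': "(\<Sum>t<8. of_int (c (k * t mod 8)) * u (k * t mod 8) * l ^ t) = 2 * S"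
    using sum(1) by simp
  have "even (c (k * t mod 8))" if "t < 8" for t
  proof (rule even_coefficients_at_ramified[where l = l and \<kappa> = 1 and \<kappa>' = 0 and n = 1
        and u = "\<lambda>t. u (k * t mod 8)" and U = "\<lambda>t. U (k * t mod 8)" and c = "\<lambda>t. c (k * t mod 8)", OF _ _ _ _ _ _ _ _ sum' sum(2) that])
    show "algebraic_int l"
      by (rule algebraic_int_of_power[of _ 8]) (simp_all add: l8)
    show "algebraic_int (u (k * t mod 8))" for t
      by (rule algebraic_int_of_power[of _ 8]) (simp_all add: u8)
  qed (simp_all add: l8 u8 U)
  from this[of "k * j mod 8"] have "even (c (k * (k * j mod 8) mod 8))"
    by simp
  then show ?thesis
    by (simp add: kk[OF j])
qed

text \<open>Now l = \<alpha> - 1 takes the ramified role, since (l + 1)^8 = m with m = 3 modulo 4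
  gives l^8 = 2 (odd + l times an integer). The odd number \<open>M\<close> clears denominators, and
  passing from powers of \<alpha> to powers of l is a binomial transformation.\<close>

lemma even_rad_coefficients_odd_radicand:
  assumes m: "radicand a = 4 * q + 3" and odd: "\<And>i. i \<in> {1..7} \<Longrightarrow> odd (a i)"
    and sum: "(\<Sum>j<8. of_int (c j) * w j) = 2 * S" "algebraic_int S" and j: "j < 8"
  shows "even (c j)"
proof -
  define M where "M = (\<Prod>j<8. rad_den a j)"
  define N where "N j = M div rad_den a j" for j
  have M: "M = rad_den a j * N j" if "j < 8" for j
    unfolding N_def M_def using that by (intro dvd_mult_div_cancel[symmetric] dvd_prodI) simp_all
  have "odd M"
    using odd by (auto simp: M_def rad_den_def even_prod_iff)
  then have N: "odd (N j)" if "j < 8" for j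
    using M[OF that] by auto
  define C where "C j = c j * N j" for j
  define l where "l = \<alpha> - 1"
  have "(\<Sum>j<8. of_int (C j) * \<alpha> ^ j) = of_int M * (\<Sum>j<8. of_int (c j) * w j)"
    unfolding sum_distrib_left
  proof (intro sum.cong refl)
    fix j :: nat assume "j \<in> {..<8}"
    then have "of_int M * w j = of_int (N j) * \<alpha> ^ j"
      using M[of j] rad_den_nz by (simp add: rad_def)
    then show "of_int (C j) * \<alpha> ^ j = of_int M * (of_int (c j) * w j)"
      unfolding C_def of_int_mult by (metis mult.assoc mult.left_commute)
  qed
  then have sumC: "(\<Sum>j<8. of_int (C j) * \<alpha> ^ j) = 2 * (of_int M * S)"
    unfolding sum(1) by simp
  have pow: "\<alpha> ^ j = (\<Sum>t<8. of_int (int (j choose t)) * l ^ t)" if "j < 8" for j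
  proof -
    have "\<alpha> ^ j = (l + 1) ^ j"
      by (simp add: l_def)
    also have "\<dots> = (\<Sum>t\<le>j. of_int (int (j choose t)) * l ^ t)"
      unfolding binomial_ring by simp
    also have "\<dots> = (\<Sum>t<8. of_int (int (j choose t)) * l ^ t)"
      using that by (intro sum.mono_neutral_left) (auto simp: binomial_eq_0)
    finally show ?thesis .
  qed
  have "(\<Sum>j<8. of_int (C j) * \<alpha> ^ j) = (\<Sum>j<8. \<Sum>t<8. of_int (C j * int (j choose t)) * l ^ t)"
    by (intro sum.cong refl) (simp add: pow sum_distrib_left mult.assoc)
  also have "\<dots> = (\<Sum>t<8. of_int (\<Sum>j<8. C j * int (j choose t)) * 1 * l ^ t)"
    by (subst sum.swap) (simp add: sum_distrib_right)
  finally have sum': "(\<Sum>t<8. of_int (\<Sum>j<8. C j * int (j choose t)) * 1 * l ^ t) = 2 * (of_int M * S)"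
    unfolding sumC by (rule sym)
  \<comment> \<open>The coefficients of -((l + 1)^8 - l^8 - 1) / (2l).\<close>
  define p :: "int poly" where "p = [:-4, -14, -28, -35, -28, -14, -4:]"
  define \<kappa>' where "\<kappa>' = poly (map_poly of_int p) l"
  have \<kappa>': "\<kappa>' = -4 + l * (-14 + l * (-28 + l * (-35 + l * (-28 + l * (-14 + l * (-4))))))"
    by (simp add: \<kappa>'_def p_def of_int_hom.map_poly_pCons_hom)
  have "(l + 1) ^ 8 = 4 * of_int q + 3"
    using root unfolding l_def m by simp
  moreover have "l ^ 8 = 2 * (2 * Q + 1 + l * (-4 + l * (-14 + l * (-28 + l * (-35 + l * (-28 + l * (-14 + l * (-4))))))))"
    if "(l + 1) ^ 8 = 4 * Q + 3" for Q
    using that by Groebner_Basis.algebra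
  ultimately have l8: "l ^ 8 = 2 * (of_int (2 * q + 1) + l * \<kappa>')"
    unfolding \<kappa>' by simp
  have "algebraic_int \<alpha>"
    by (rule algebraic_int_of_power[of _ 8]) (simp_all add: root)
  then have l: "algebraic_int l"
    unfolding l_def by (intro algebraic_int_diff) simp_all
  have "even (\<Sum>j<8. C j * int (j choose t))" if "t < 8" for t
  proof (rule even_coefficients_at_ramified[where c = "\<lambda>t. \<Sum>j<8. C j * int (j choose t)" and u = "\<lambda>_. 1" and U = "\<lambda>_. 1",
        OF l8 l refl _ _ _ _ _ sum' _ that])
    show "algebraic_int \<kappa>'"
      unfolding \<kappa>'_def using l by (rule algebraic_int_poly)
    show "algebraic_int (of_int M * S)"
      using sum(2) by (intro algebraic_int_mult) simp_all
  qed simp_all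
  then have "even (C j)"
    using even_coefficients_of_even_binomial_sums[of C j] j by blast
  then show ?thesis
    using N[OF j] by (simp add: C_def)
qed

end

text \<open>The 8 left by averaging over the conjugates is 2^3, so the halving property is applied
  three times.\<close>

lemma (in octic_radical) rad_sum_divide_8:
  assumes halve: "\<And>c S j. (\<Sum>j<8. of_int (c j) * w j) = 2 * S \<Longrightarrow> algebraic_int S \<Longrightarrow> j < 8 \<Longrightarrow> even (c j)"
    and sum: "(\<Sum>j<8. of_int (c j) * w j) = 8 * S" "algebraic_int S"
  shows "\<exists>x. \<forall>j<8. c j = 8 * x j"
proof -
  have half: "\<exists>c'. (\<forall>j<8. c j = 2 * c' j) \<and> (\<Sum>j<8. of_int (c' j) * w j) = S"
    if c: "(\<Sum>j<8. of_int (c j) * w j) = 2 * S" "algebraic_int S" for c S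
  proof -
    have c': "c j = 2 * (c j div 2)" if "j < 8" for j
      using halve[OF c that] by simp
    have "2 * (\<Sum>j<8. of_int (c j div 2) * w j) = (\<Sum>j<8. of_int (2 * (c j div 2)) * w j)"
      unfolding sum_distrib_left by (intro sum.cong refl) simp
    also have "\<dots> = (\<Sum>j<8. of_int (c j) * w j)"
      by (intro sum.cong refl) (metis c' lessThan_iff)
    finally have "(\<Sum>j<8. of_int (c j div 2) * w j) = S"
      using c(1) by simp
    then show ?thesis
      using c' by (intro exI[of _ "\<lambda>j. c j div 2"]) auto
  qed
  have int: "algebraic_int (4 * S)" "algebraic_int (2 * S)"
    using algebraic_int_mult[OF _ sum(2), of "of_int 4"] algebraic_int_mult[OF _ sum(2), of "of_int 2"] by simp_all
  obtain c1 where c1: "\<forall>j<8. c j = 2 * c1 j" "(\<Sum>j<8. of_int (c1 j) * w j) = 4 * S"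
    using half[of c "4 * S"] sum(1) int(1) by auto
  obtain c2 where c2: "\<forall>j<8. c1 j = 2 * c2 j" "(\<Sum>j<8. of_int (c2 j) * w j) = 2 * S"
    using half[of c1 "2 * S"] c1(2) int(2) by auto
  obtain c3 where c3: "\<forall>j<8. c2 j = 2 * c3 j"
    using half[OF c2(2) sum(2)] by auto
  show ?thesis
    using c1(1) c2(1) c3 by (intro exI[of _ c3]) simp
qed

lemma poly_octic_eq_0_iff:
  "poly (map_poly of_rat (monom 1 8 - [:of_int m:])) (z :: complex) = 0 \<longleftrightarrow> z ^ 8 = of_int m"
  by (simp add: of_rat_poly_hom.hom_minus map_poly_monom poly_monom of_rat_hom.map_poly_pCons_hom)

text \<open>The generator gets integer coordinates \<open>x\<close>. Each w_j is an integer
  polynomial in it, and this relation carries over to every root of the irreducible polynomial.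
  \<open>x\<close> is chosen before \<beta>, so that the root can be picked later.\<close>

lemma monogenic_conj_dvd:
  fixes a :: "nat \<Rightarrow> int" and \<alpha> :: complex
  defines "f \<equiv> monom 1 8 - [:of_int (radicand a):] :: rat poly"
  assumes irr: "Factorial_Ring.irreducible f"
    and cop: "\<And>i j. i \<in> {1..7} \<Longrightarrow> j \<in> {1..7} \<Longrightarrow> i \<noteq> j \<Longrightarrow> coprime (a i) (a j)"
    and sqf: "\<And>i. i \<in> {1..7} \<Longrightarrow> squarefree (a i)"
    and \<alpha>: "\<alpha> ^ 8 = of_int (radicand a)" and mono: "monogenic (rat_adjoin \<alpha>)"
    and halve: "\<And>c S j. (\<Sum>j<8. of_int (c j) * rad a \<alpha> j) = 2 * S \<Longrightarrow> algebraic_int S \<Longrightarrow> j < 8 \<Longrightarrow> even (c j)"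
  shows "\<exists>x. \<forall>\<beta> t u j. \<beta> ^ 8 = of_int (radicand a) \<longrightarrow> t ^ 8 = 1 \<longrightarrow> u ^ 8 = 1 \<longrightarrow> j < 8 \<longrightarrow>
    (\<exists>g. algebraic_int g \<and> rad a \<beta> j * (t ^ j - u ^ j) = g * (octic_conj a x \<beta> t - octic_conj a x \<beta> u))"
proof -
  interpret octic_radical a \<alpha>
    using sqf \<alpha> by unfold_locales (metis not_squarefree_0, simp)
  have f0: "poly (map_poly of_rat f) z = 0 \<longleftrightarrow> z ^ 8 = of_int (radicand a)" for z :: complex
    unfolding f_def by (rule poly_octic_eq_0_iff)
  have zero: "G z = 0" if "rat_poly_fun G" "G \<alpha> = 0" "z ^ 8 = of_int (radicand a)" for G z
    using rat_poly_fun_conjugate_zero[OF irr _ _ that(1,2)] \<alpha> that(3) unfolding f0 by blast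
  obtain \<theta> where \<theta>: "\<theta> \<in> rat_adjoin \<alpha>" "algebraic_int \<theta>" "ring_of_integers (rat_adjoin \<alpha>) = int_adjoin \<theta>"
    using mono unfolding monogenic_def ring_of_integers_def by auto
  obtain F where F: "rat_poly_fun F" "F \<alpha> = \<theta>"
    using rat_adjoin_imp_rat_poly_fun[OF irr _ \<theta>(1)] \<alpha> f0 by blast
  have int_F: "algebraic_int (F z)" if z: "z ^ 8 = of_int (radicand a)" for z
  proof -
    obtain p where p: "poly (map_poly of_int p) \<theta> = 0" "lead_coeff p = 1"
      using \<theta>(2) by (auto simp: algebraic_int_altdef_ipoly)
    have "poly (map_poly of_int p) (F z) = 0"
      using zero[OF rat_poly_fun_int_poly[OF F(1)] _ z, of p] p(1) F(2) by simp
    then show ?thesis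
      using p(2) by (auto simp: algebraic_int_altdef_ipoly)
  qed
  obtain y where y: "\<And>z. z ^ 8 = of_int (radicand a) \<Longrightarrow> F z = (\<Sum>j<8. of_rat (y j) * z ^ j)"
    using rat_poly_fun_octic[OF F(1), of "radicand a"] by blast
  have free: "\<not> q ^ 8 dvd rad_res a j" if q: "prime q" for q j
    unfolding rad_res_def
  proof (rule not_eighth_power_dvd_prod[OF q])
    show "coprime (a i) (a k)" if "i \<in> {1..7}" "k \<in> {1..7}" "i \<noteq> k" for i k
      using that by (rule cop)
    show "squarefree (a i)" if "i \<in> {1..7}" for i
      using that by (rule sqf)
  qed simp
  have "\<forall>j\<in>{..<8}. \<exists>c. of_int c = 8 * y j * of_int (rad_den a j)"
  proof
    fix j :: nat assume j: "j \<in> {..<8}"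
    have "8 * of_rat (y j) * \<alpha> ^ j = of_rat (8 * y j * of_int (rad_den a j)) * w j"
      using rad_den_nz by (simp add: rad_def of_rat_mult)
    moreover have "algebraic_int (8 * of_rat (y j) * \<alpha> ^ j)"
      using j by (intro algebraic_int_octic_coefficient[OF y int_F \<alpha>]) simp_all
    ultimately have "algebraic_int (of_rat (8 * y j * of_int (rad_den a j)) * w j)"
      by simp
    then have "8 * y j * of_int (rad_den a j) \<in> \<int>"
      by (rule rat_in_Ints_of_algebraic_int[OF _ rad_power8 free])
    then show "\<exists>c. of_int c = 8 * y j * of_int (rad_den a j)"
      by (elim Ints_cases) metis
  qed
  then obtain c where c: "\<And>j. j < 8 \<Longrightarrow> of_int (c j) = 8 * y j * of_int (rad_den a j)"
    by (metis lessThan_iff)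
  have cy: "of_int (c j) * rad a z j = 8 * (of_rat (y j) * z ^ j)" if "j < 8" for j z
  proof -
    have "(of_int (c j) :: complex) = of_rat (of_int (c j))"
      by simp
    also have "\<dots> = 8 * of_rat (y j) * of_int (rad_den a j)"
      unfolding c[OF that] by (simp add: of_rat_mult)
    finally show ?thesis
      using rad_den_nz by (simp add: rad_def)
  qed
  have c_sum: "(\<Sum>j<8. of_int (c j) * w j) = 8 * F \<alpha>"
    unfolding y[OF \<alpha>] sum_distrib_left by (intro sum.cong refl cy) simp
  have "\<exists>x. \<forall>j<8. c j = 8 * x j"
  proof (rule rad_sum_divide_8[OF _ c_sum int_F[OF \<alpha>]])
    show "even (c' j)" if "(\<Sum>j<8. of_int (c' j) * w j) = 2 * S" "algebraic_int S" "j < 8" for c' S j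
      using that by (rule halve)
  qed
  then obtain x where x: "\<And>j. j < 8 \<Longrightarrow> c j = 8 * x j"
    by blast
  have conj: "F (\<beta> * t) = octic_conj a x \<beta> t" if \<beta>: "\<beta> ^ 8 = of_int (radicand a)" "t ^ 8 = 1" for \<beta> t
  proof -
    have "(\<beta> * t) ^ 8 = of_int (radicand a)"
      using \<beta> by (simp add: power_mult_distrib)
    then have "F (\<beta> * t) = (\<Sum>j<8. of_rat (y j) * (\<beta> * t) ^ j)"
      by (rule y)
    also have "\<dots> = octic_conj a x \<beta> t"
      unfolding octic_conj_def
    proof (intro sum.cong refl)
      fix j :: nat assume "j \<in> {..<8}"
      then show "of_rat (y j) * (\<beta> * t) ^ j = of_int (x j) * rad a \<beta> j * t ^ j"
        using cy[of j \<beta>] x[of j] by (simp add: power_mult_distrib)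
    qed
    finally show ?thesis .
  qed
  have "\<exists>g. algebraic_int g \<and> rad a \<beta> j * (t ^ j - u ^ j) = g * (octic_conj a x \<beta> t - octic_conj a x \<beta> u)"
    if \<beta>: "\<beta> ^ 8 = of_int (radicand a)" "t ^ 8 = 1" "u ^ 8 = 1" for \<beta> t u j
  proof -
    have "\<alpha> ^ j * inverse (of_int (rad_den a j)) \<in> rat_adjoin \<alpha>"
      using rad_den_nz by (intro rat_adjoin_mult rat_adjoin_power rat_adjoin_inverse rat_adjoin_of_int) simp
    then have "w j \<in> ring_of_integers (rat_adjoin \<alpha>)"
      using algebraic_int_rad[of j] by (simp add: ring_of_integers_def rad_def divide_inverse)
    then obtain p where p: "w j = poly (map_poly of_int p) (F \<alpha>)"
      unfolding \<theta>(3) F(2) using int_adjoin_imp_int_poly by blast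
    have G: "rat_poly_fun (\<lambda>z. poly (map_poly of_int p) (F z) - z ^ j * of_rat (1 / of_int (rad_den a j)))"
      by (intro rat_poly_fun_diff rat_poly_fun_int_poly rat_poly_fun_mult rat_poly_fun_power rat_poly_fun_const F(1))
    have root: "(\<beta> * s) ^ 8 = of_int (radicand a)" if "s ^ 8 = 1" for s
      using \<beta>(1) that by (simp add: power_mult_distrib)
    have val: "poly (map_poly of_int p) (F (\<beta> * s)) = rad a \<beta> j * s ^ j" if s: "s ^ 8 = 1" for s
      using zero[OF G _ root[OF s]] p by (simp add: rad_def of_rat_divide power_mult_distrib)
    obtain g where g: "algebraic_int g"
      "poly (map_poly of_int p) (F (\<beta> * t)) - poly (map_poly of_int p) (F (\<beta> * u)) = g * (F (\<beta> * t) - F (\<beta> * u))"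
      by (rule algebraic_int_poly_diff_quotient[OF int_F[OF root[OF \<beta>(2)]] int_F[OF root[OF \<beta>(3)]]])
    have "rad a \<beta> j * (t ^ j - u ^ j) = g * (F (\<beta> * t) - F (\<beta> * u))"
      using g(2) unfolding val[OF \<beta>(2)] val[OF \<beta>(3)] right_diff_distrib .
    then show ?thesis
      unfolding conj[OF \<beta>(1,2)] conj[OF \<beta>(1,3)] by (intro exI[of _ g] conjI g(1))
  qed
  then show ?thesis
    by (intro exI[of _ x] allI impI)
qed

section \<open>Arithmetic of the radicand and choice of the root\<close>

lemma radicand_eq_squares:
  "radicand a = (a 1 * a 3 * a 5 * a 7) * (a 2 * a 3 * a 4 ^ 2 * a 5 ^ 2 * a 6 ^ 3 * a 7 ^ 3)\<^sup>2"
  unfolding radicand_def prod_atLeast1_atMost7 by (simp add: eval_nat_numeral mult_ac)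

text \<open>By coprimality only one a_k is even, and being squarefree it contains 2 once; so the
  valuation is k itself, which must be odd.\<close>

lemma odd_multiplicity_2_radicand:
  assumes odd: "odd (Factorial_Ring.multiplicity 2 (radicand a))"
    and cop: "\<And>i j. i \<in> {1..7} \<Longrightarrow> j \<in> {1..7} \<Longrightarrow> i \<noteq> j \<Longrightarrow> coprime (a i) (a j)"
    and sqf: "\<And>i. i \<in> {1..7} \<Longrightarrow> squarefree (a i)"
  shows "\<exists>k a'. k \<in> {1, 3, 5, 7} \<and> a k = 2 * a' \<and> odd a' \<and> (\<forall>i\<in>{1..7}. i \<noteq> k \<longrightarrow> odd (a i))"
proof -
  have "even (radicand a)"
    using odd not_dvd_imp_multiplicity_0[of 2 "radicand a"] by (cases "even (radicand a)") simp_all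
  then obtain k where k: "k \<in> {1..7}" "even (a k)"
    by (auto simp: radicand_def even_prod_iff)
  then obtain a' where a': "a k = 2 * a'" by blast
  have "odd a'"
  proof
    assume "even a'"
    then have "2\<^sup>2 dvd a k"
      unfolding a' by auto
    then have "2 dvd (1 :: int)"
      by (rule squarefreeD[OF sqf[OF k(1)]])
    then show False
      by simp
  qed
  have others: "odd (a i)" if "i \<in> {1..7}" "i \<noteq> k" for i
    using cop[OF that(1) k(1) that(2)] k(2) coprime_common_divisor[of "a i" "a k" 2] by auto
  have "radicand a = a k ^ k * (\<Prod>i\<in>{1..7} - {k}. a i ^ i)" (is "_ = _ * ?R")
    unfolding radicand_def using k(1) by (intro prod.remove) simp_all
  then have rad: "radicand a = 2 ^ k * (a' ^ k * ?R)"
    unfolding a' power_mult_distrib by simp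
  have "odd (a' ^ k * ?R)"
    using others \<open>odd a'\<close> by (auto simp: even_prod_iff)
  then have "Factorial_Ring.multiplicity 2 (radicand a) = k"
    unfolding rad by (intro multiplicity_eqI) (simp_all add: mult.commute[of 2])
  then have "odd k"
    using odd by simp
  moreover have "k = 1 \<or> k = 2 \<or> k = 3 \<or> k = 4 \<or> k = 5 \<or> k = 6 \<or> k = 7"
    using k(1) by auto
  ultimately have "k \<in> {1, 3, 5, 7}"
    by auto
  then show ?thesis
    using a' \<open>odd a'\<close> others by blast
qed

lemma zeta8_eq_cis: "zeta8 = cis (pi / 4)"
  by (simp add: zeta8_def complex_eq_iff cos_45 sin_45 real_div_sqrt field_simps)

theorem theorem2p3:
  fixes m :: int and a :: "nat \<Rightarrow> int" and f :: "rat poly" and \<alpha> :: complex and K :: "complex set"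
  assumes "m \<noteq> 1" and "m \<noteq> -1"
    and "f = monom 1 8 - [:of_int m:]"
    and "Factorial_Ring.irreducible f"
    and "m = a 1 * a 2 ^ 2 * a 3 ^ 3 * a 4 ^ 4 * a 5 ^ 5 * a 6 ^ 6 * a 7 ^ 7"
    and "\<And>i. i \<in> {1..7} \<Longrightarrow> Squarefree.squarefree (a i)"
    and "pairwise (\<lambda>i j. Rings.coprime (a i) (a j)) {1..7}"
    and "poly (map_poly of_rat f) \<alpha> = 0"
    and "K = rat_adjoin \<alpha>"
    and "odd (Factorial_Ring.multiplicity 2 m) \<or> [m = 3] (mod 4)"
    and "monogenic K"
  shows "8 * a 1 * a 3 * a 5 * a 7 dvd (a 2)^2 * (a 6)^2 + 1 \<or>
         8 * a 1 * a 3 * a 5 * a 7 dvd (a 2)^2 * (a 6)^2 - 1"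
proof -
  have m: "m = radicand a"
    unfolding radicand_def prod_atLeast1_atMost7 using assms(5) by simp
  note sqf = assms(6)
  have cop: "coprime (a i) (a j)" if "i \<in> {1..7}" "j \<in> {1..7}" "i \<noteq> j" for i j
    using assms(7) that by (auto simp: pairwise_def)
  have \<alpha>: "\<alpha> ^ 8 = of_int (radicand a)"
    using assms(8) unfolding assms(3) m poly_octic_eq_0_iff .
  have nz: "a i \<noteq> 0" if "i \<in> {1..7}" for i
    using sqf[OF that] by (metis not_squarefree_0)
  interpret octic_radical a \<alpha>
    using nz \<alpha> by unfold_locales
  define d b where "d = a 1 * a 3 * a 5 * a 7" and "b = a 2 * a 6"
  define s where "s = a 2 * a 3 * a 4 ^ 2 * a 5 ^ 2 * a 6 ^ 3 * a 7 ^ 3"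
  have ms: "m = d * s\<^sup>2"
    unfolding m radicand_eq_squares d_def s_def ..
  have parity: "(\<forall>c S j. (\<Sum>j<8. of_int (c j) * w j) = 2 * S \<longrightarrow> algebraic_int S \<longrightarrow> j < 8 \<longrightarrow> even (c j)) \<and>
      odd (a 2) \<and> odd (a 4) \<and> odd (a 6) \<and> d mod 4 \<noteq> 1"
    using assms(10)
  proof
    assume "odd (Factorial_Ring.multiplicity 2 m)"
    then obtain k a' where k: "k \<in> {1, 3, 5, 7}" "a k = 2 * a'" "odd a'" and odd: "\<And>i. i \<in> {1..7} \<Longrightarrow> i \<noteq> k \<Longrightarrow> odd (a i)"
      using odd_multiplicity_2_radicand[of a] cop sqf unfolding m by blast
    have "even d"
      using k(1,2) unfolding d_def by auto
    then have "d mod 4 \<noteq> 1"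
      by presburger
    moreover have "2 \<noteq> k" "4 \<noteq> k" "6 \<noteq> k"
      using k(1) by auto
    then have "odd (a 2)" "odd (a 4)" "odd (a 6)"
      using odd[of 2] odd[of 4] odd[of 6] by simp_all
    ultimately show ?thesis
      by (intro conjI allI impI even_rad_coefficients_even_radicand[OF k odd])
  next
    assume "[m = 3] (mod 4)"
    then have "m mod 4 = 3"
      by (simp add: cong_def)
    then have q: "radicand a = 4 * (m div 4) + 3"
      unfolding m by presburger
    then have "odd (radicand a)"
      by presburger
    then have odd: "odd (a i)" if "i \<in> {1..7}" for i
      using that by (auto simp: radicand_def even_prod_iff)
    then have "odd s"
      unfolding s_def by simp
    then obtain r where "s = 2 * r + 1"
      by (elim oddE)
    \<comment> \<open>As \<open>s\<close> is odd, s^2 = 1 modulo 4, so \<open>d\<close> and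
      \<open>m\<close> agree modulo 4.\<close>
    then have "m = d + 4 * (d * (r\<^sup>2 + r))"
      unfolding ms by (simp add: power2_eq_square algebra_simps)
    then have "d mod 4 \<noteq> 1"
      using \<open>m mod 4 = 3\<close> by simp
    then show ?thesis
      by (intro conjI allI impI even_rad_coefficients_odd_radicand[OF q odd] odd) simp_all
  qed
  have halve: "even (c j)" if "(\<Sum>j<8. of_int (c j) * w j) = 2 * S" "algebraic_int S" "j < 8" for c S j
    using conjunct1[OF parity] that by (elim allE impE)
  have "\<exists>x. \<forall>\<beta> t u j. \<beta> ^ 8 = of_int (radicand a) \<longrightarrow> t ^ 8 = 1 \<longrightarrow> u ^ 8 = 1 \<longrightarrow> j < 8 \<longrightarrow>
      (\<exists>g. algebraic_int g \<and> rad a \<beta> j * (t ^ j - u ^ j) = g * (octic_conj a x \<beta> t - octic_conj a x \<beta> u))"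
  proof (rule monogenic_conj_dvd[OF assms(4)[unfolded assms(3) m] _ _ \<alpha> assms(11)[unfolded assms(9)]])
    show "coprime (a i) (a j)" if "i \<in> {1..7}" "j \<in> {1..7}" "i \<noteq> j" for i j
      using that by (rule cop)
    show "squarefree (a i)" if "i \<in> {1..7}" for i
      using that by (rule sqf)
    show "even (c j)" if "(\<Sum>j<8. of_int (c j) * w j) = 2 * S" "algebraic_int S" "j < 8" for c S j
      using that by (rule halve)
  qed
  then obtain x where conj_dvd: "\<forall>\<beta> t u j. \<beta> ^ 8 = of_int (radicand a) \<longrightarrow> t ^ 8 = 1 \<longrightarrow> u ^ 8 = 1 \<longrightarrow> j < 8 \<longrightarrow>
      (\<exists>g. algebraic_int g \<and> rad a \<beta> j * (t ^ j - u ^ j) = g * (octic_conj a x \<beta> t - octic_conj a x \<beta> u))" ..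
  have index: "octic_index a \<beta> x" if "\<beta> ^ 8 = of_int m" for \<beta>
  proof unfold_locales
    show "\<beta> ^ 8 = of_int (radicand a)"
      using that unfolding m .
    then show "\<exists>g. algebraic_int g \<and> rad a \<beta> j * (t ^ j - u ^ j) = g * (octic_conj a x \<beta> t - octic_conj a x \<beta> u)"
      if "t ^ 8 = 1" "u ^ 8 = 1" "j < 8" for t u j
      using that by (intro conj_dvd[rule_format])
    show "a i \<noteq> 0" if "i \<in> {1..7}" for i
      using that by (rule nz)
    show "coprime (a i) (a j)" if "i \<in> {1..7}" "j \<in> {1..7}" "i \<noteq> j" for i j
      using that by (rule cop)
    show "squarefree (a i)" if "i \<in> {1..7}" for i
      using that by (rule sqf)
    show "odd (a 2)" "odd (a 4)" "odd (a 6)" "(a 1 * a 3 * a 5 * a 7) mod 4 \<noteq> 1 \<or> a 1 * a 3 * a 5 * a 7 > 0"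
      using conjunct2[OF parity] unfolding d_def by (elim conjE; simp only: simp_thms)+
  qed
  have "d \<noteq> 0"
    using nz by (simp add: d_def)
  have "s \<noteq> 0"
    using nz by (simp add: s_def)
  have "odd b"
    using parity by (simp add: b_def)
  have "8 * d dvd b\<^sup>2 - 1"
  proof (cases "d = 1 \<or> d = -1")
    case True
    obtain r where "b = 2 * r + 1"
      using \<open>odd b\<close> by (elim oddE)
    then have "b\<^sup>2 - 1 = 4 * (r * (r + 1))"
      by (simp add: power2_eq_square algebra_simps)
    moreover have "even (r * (r + 1))"
      by simp
    then obtain v where "r * (r + 1) = 2 * v" ..
    ultimately show ?thesis
      using True by auto
  next
    case False
    have "b\<^sup>2 = 1"
    proof (cases "d > 0")
      case True
      then have "m > 0"
        unfolding ms using \<open>s \<noteq> 0\<close> by simp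
      then have "complex_of_real (root 8 (of_int m)) ^ 8 = of_int m"
        unfolding of_real_power[symmetric] by simp
      from octic_index.b_square_eq_1_of_real[OF index[OF this]] show ?thesis
        using True unfolding b_def d_def by simp
    next
      case neg: False
      then have "d < -1"
        using False \<open>d \<noteq> 0\<close> by linarith
      then have "m < 0"
        unfolding ms using \<open>s \<noteq> 0\<close> by (simp add: mult_neg_pos)
      \<comment> \<open>The argument -pi/8 makes the eighth power negative and the ratio of the
        conjugate of \<beta> to \<beta> equal to exp(i pi/4).\<close>
      define \<beta> where "\<beta> = complex_of_real (root 8 (of_int (- m))) * cis (- (pi / 8))"
      have "complex_of_real (root 8 (of_int (- m))) ^ 8 = of_int (- m)"
        unfolding of_real_power[symmetric] using \<open>m < 0\<close> by simp
      then have "\<beta> ^ 8 = of_int m"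
        unfolding \<beta>_def power_mult_distrib DeMoivre by (simp add: cis.ctr complex_eq_iff)
      moreover have "cnj \<beta> = zeta8 * \<beta>"
        by (simp add: \<beta>_def zeta8_eq_cis cis_cnj cis_mult mult.left_commute[of "cis (pi / 4)"])
      ultimately show ?thesis
        using octic_index.b_square_eq_1_of_imaginary[OF index[of \<beta>]] \<open>d < -1\<close> unfolding b_def d_def by simp
    qed
    then show ?thesis
      by simp
  qed
  then show ?thesis
    unfolding d_def b_def power_mult_distrib mult.assoc by blast
qed

end
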